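(* For any arboricity-$\alpha$ preserving sequence, there is a local algorithm for maintaining a maximal matching on the corresponding dynamic $n$-vertex graph $G$ with amortized update time $O(\alpha+\sqrt{\alpha\log n})$, whose space usage is linear in the graph size. Moreover, there is a distributed algorithm for maintaining a maximal matching with amortized message complexity $O(\alpha+\sqrt{\alpha\log n})$ and constant worst-case update time.
   Context: Arboricity of $G=(V,E)$: $\max_{U\subseteq V,|U|\ge2}\lceil |E(U)|/(|U|-1)\rceil$. An arboricity-$\alpha$ preserving sequence is a sequence of edge insertions and deletions starting from the empty graph such that the arboricity stays at most $\alpha$ at all times. A maximal matching is a matching to which no edge of the current graph can be added. A dynamic algorithm is local if processing an update or operation at a vertex $v$ (or at an edge $(u,v)$) only reads and modifies information at the involved vertices and their immediate neighbors. In the distributed (local wakeup) model, after each update only the affected vertices wake up and communicate with neighbors in synchronous rounds; amortized message complexity is the worst-case over update sequences of the average number of messages per update, and worst-case update time is the maximum number of rounds per update. *)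

theory Defs
  imports Complex_Main "HOL-Library.Disjoint_Sets"
begin

section \<open>Dynamic graphs, arboricity, matchings\<close>

text \<open>The vertex set of an \<open>n\<close>-vertex graph is \<open>{..<n}\<close>; a graph is given by its set of
  two-element edges.\<close>

type_synonym graph = "nat set set"

datatype update = Insert nat nat | Delete nat nat

fun endpoints :: "update \<Rightarrow> nat set" where
  "endpoints (Insert u v) = {u, v}"
| "endpoints (Delete u v) = {u, v}"

fun valid_update :: "nat \<Rightarrow> graph \<Rightarrow> update \<Rightarrow> bool" where
  "valid_update n E (Insert u v) \<longleftrightarrow> u < n \<and> v < n \<and> u \<noteq> v \<and> {u, v} \<notin> E"
| "valid_update n E (Delete u v) \<longleftrightarrow> {u, v} \<in> E"

fun apply_update :: "graph \<Rightarrow> update \<Rightarrow> graph" where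
  "apply_update E (Insert u v) = insert {u, v} E"
| "apply_update E (Delete u v) = E - {{u, v}}"

definition graph_after :: "update list \<Rightarrow> graph" where
  "graph_after us = foldl apply_update {} us"

definition induced_edges :: "graph \<Rightarrow> nat set \<Rightarrow> graph" where
  "induced_edges E U = {e \<in> E. e \<subseteq> U}"

text \<open>The supremum is over a finite set of naturals, hence a maximum; for \<open>n < 2\<close> the set is
  empty and the value is \<open>0\<close>.\<close>

definition arboricity :: "nat \<Rightarrow> graph \<Rightarrow> nat" where
  "arboricity n E =
     (SUP U \<in> {U. U \<subseteq> {..<n} \<and> 2 \<le> card U}.
        nat \<lceil>real (card (induced_edges E U)) / (real (card U) - 1)\<rceil>)"

definition arboricity_preserving :: "nat \<Rightarrow> nat \<Rightarrow> update list \<Rightarrow> bool" where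
  "arboricity_preserving n \<alpha> us \<longleftrightarrow>
     (\<forall>i < length us. valid_update n (graph_after (take i us)) (us ! i)) \<and>
     (\<forall>i \<le> length us. arboricity n (graph_after (take i us)) \<le> \<alpha>)"

definition matching :: "graph \<Rightarrow> graph \<Rightarrow> bool" where
  "matching E M \<longleftrightarrow> M \<subseteq> E \<and> disjoint M"

definition maximal_matching :: "graph \<Rightarrow> graph \<Rightarrow> bool" where
  "maximal_matching E M \<longleftrightarrow>
     matching E M \<and> (\<forall>e \<in> E. e \<notin> M \<longrightarrow> \<not> matching E (insert e M))"

text \<open>An algorithm outputs a matching by naming at every vertex its mate (\<open>None\<close>: free).\<close>

definition outputs_maximal_matching :: "nat \<Rightarrow> graph \<Rightarrow> (nat \<Rightarrow> nat option) \<Rightarrow> bool" where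
  "outputs_maximal_matching n E mate \<longleftrightarrow>
     (\<exists>M. maximal_matching E M \<and> (\<forall>v < n. \<forall>w. mate v = Some w \<longleftrightarrow> {v, w} \<in> M))"

definition closed_nbhd :: "graph \<Rightarrow> nat set \<Rightarrow> nat set" where
  "closed_nbhd E S = S \<union> {y. \<exists>x \<in> S. {x, y} \<in> E}"

section \<open>Sequential algorithms\<close>

text \<open>
  The machine is a word RAM with a heap of constant-size records. Every record belongs to one
  vertex (its owner), and the information at a vertex is what is stored in its records.
  Addresses \<open>v < n\<close> are the permanent root records of the vertices; further records are
  allocated and freed dynamically.

  All arguments of commands are names of registers, except for the numeral \<open>k\<close> in
  \<open>Const x k\<close> and the field indices \<open>f\<close> in \<open>Load\<close> and \<open>Store\<close>. Since field indices are
  literals, a program uses only a constant number of words per record and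
  the number of allocated records measures space up to a constant factor.
\<close>

datatype com =
    Skip
  | Const nat nat
  | Add nat nat nat
  | Sub nat nat nat
  | Load nat nat nat
  | Store nat nat nat
  | Alloc nat nat
  | Free nat
  | Seq com com
  | IfLess nat nat com com
  | WhileLess nat nat com

record state =
  reg :: "nat \<Rightarrow> nat"
  owner :: "nat \<Rightarrow> nat option"
  cell :: "nat \<Rightarrow> nat \<Rightarrow> nat"

text \<open>
  \<open>owner s p = None\<close> means that address \<open>p\<close> is unallocated. \<open>Alloc x p\<close> creates a zeroed
  record with the same owner as the record at the address in register \<open>p\<close>. The least free
  address is taken, so the address range ever used is bounded by the peak number of records.
  Root records, the only ones with \<open>owner s p = Some p\<close>, cannot be freed.
  Accesses to unallocated addresses are ruled out by the locality condition below.
\<close>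

fun step :: "com \<Rightarrow> state \<Rightarrow> com \<times> state" where
  "step Skip s = (Skip, s)"
| "step (Const x k) s = (Skip, s\<lparr>reg := (reg s)(x := k)\<rparr>)"
| "step (Add x y z) s = (Skip, s\<lparr>reg := (reg s)(x := reg s y + reg s z)\<rparr>)"
| "step (Sub x y z) s = (Skip, s\<lparr>reg := (reg s)(x := reg s y - reg s z)\<rparr>)"
| "step (Load x p f) s = (Skip, s\<lparr>reg := (reg s)(x := cell s (reg s p) f)\<rparr>)"
| "step (Store p f x) s =
     (Skip, s\<lparr>cell := (cell s)(reg s p := (cell s (reg s p))(f := reg s x))\<rparr>)"
| "step (Alloc x p) s =
     (let a = (LEAST a. owner s a = None)
      in (Skip, s\<lparr>reg := (reg s)(x := a),
                  owner := (owner s)(a := owner s (reg s p)),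
                  cell := (cell s)(a := (\<lambda>_. 0))\<rparr>))"
| "step (Free p) s =
     (Skip, if owner s (reg s p) = Some (reg s p) then s
            else s\<lparr>owner := (owner s)(reg s p := None)\<rparr>)"
| "step (Seq c d) s =
     (if c = Skip then (d, s) else (let (c', s') = step c s in (Seq c' d, s')))"
| "step (IfLess x y c d) s = (if reg s x < reg s y then c else d, s)"
| "step (WhileLess x y c) s =
     (if reg s x < reg s y then Seq c (WhileLess x y c) else Skip, s)"

text \<open>The addresses of the records read, modified, extended or freed by the next step.\<close>

fun accessed :: "com \<Rightarrow> state \<Rightarrow> nat set" where
  "accessed (Load x p f) s = {reg s p}"
| "accessed (Store p f x) s = {reg s p}"
| "accessed (Alloc x p) s = {reg s p}"
| "accessed (Free p) s = {reg s p}"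
| "accessed (Seq c d) s = accessed c s"
| "accessed _ s = {}"

definition initial_state :: "nat \<Rightarrow> state" where
  "initial_state n =
     \<lparr>reg = (\<lambda>_. 0), owner = (\<lambda>p. if p < n then Some p else None), cell = (\<lambda>_ _. 0)\<rparr>"

text \<open>Registers are reinitialised with the input at every update: all information that is kept
  between updates is held at the vertices.\<close>

fun input :: "update \<Rightarrow> nat \<Rightarrow> nat" where
  "input (Insert u v) = (\<lambda>_. 0)(0 := 0, 1 := u, 2 := v)"
| "input (Delete u v) = (\<lambda>_. 0)(0 := 1, 1 := u, 2 := v)"

definition config :: "com \<Rightarrow> update \<Rightarrow> state \<Rightarrow> nat \<Rightarrow> com \<times> state" where
  "config P u s j = ((\<lambda>(c, t). step c t) ^^ j) (P, s\<lparr>reg := input u\<rparr>)"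

definition terminates :: "com \<Rightarrow> update \<Rightarrow> state \<Rightarrow> bool" where
  "terminates P u s \<longleftrightarrow> (\<exists>j. fst (config P u s j) = Skip)"

definition time :: "com \<Rightarrow> update \<Rightarrow> state \<Rightarrow> nat" where
  "time P u s = (LEAST j. fst (config P u s j) = Skip)"

definition process :: "com \<Rightarrow> state \<Rightarrow> update \<Rightarrow> state" where
  "process P s u = snd (config P u s (time P u s))"

definition state_after :: "com \<Rightarrow> nat \<Rightarrow> update list \<Rightarrow> state" where
  "state_after P n us = foldl (process P) (initial_state n) us"

text \<open>The output is read from field \<open>0\<close> of the root records.\<close>

definition mate_of :: "state \<Rightarrow> nat \<Rightarrow> nat option" where
  "mate_of s v = (case cell s v 0 of 0 \<Rightarrow> None | Suc w \<Rightarrow> Some w)"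

definition maintains_maximal_matching :: "com \<Rightarrow> nat \<Rightarrow> update list \<Rightarrow> bool" where
  "maintains_maximal_matching P n us \<longleftrightarrow>
     (\<forall>i < length us. terminates P (us ! i) (state_after P n (take i us))) \<and>
     (\<forall>i \<le> length us. outputs_maximal_matching n (graph_after (take i us))
                       (mate_of (state_after P n (take i us))))"

text \<open>
  The vertices involved in an update are the endpoints of the updated edge and the vertices
  whose mate changes in response; the latter must be endpoints or immediate neighbours of
  endpoints. Only information at involved vertices and at their immediate neighbours may be
  accessed.
\<close>

definition involved :: "nat \<Rightarrow> update \<Rightarrow> state \<Rightarrow> state \<Rightarrow> nat set" where
  "involved n u s s' = endpoints u \<union> {x. x < n \<and> mate_of s x \<noteq> mate_of s' x}"

definition local_update :: "com \<Rightarrow> nat \<Rightarrow> graph \<Rightarrow> update \<Rightarrow> state \<Rightarrow> bool" where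
  "local_update P n E u s \<longleftrightarrow>
     (let I = involved n u s (process P s u)
      in I \<subseteq> closed_nbhd E (endpoints u) \<and>
         (\<forall>j < time P u s. case config P u s j of (c, t) \<Rightarrow>
            \<forall>p \<in> accessed c t. \<exists>v \<in> closed_nbhd E I. owner t p = Some v))"

definition local_algorithm :: "com \<Rightarrow> nat \<Rightarrow> update list \<Rightarrow> bool" where
  "local_algorithm P n us \<longleftrightarrow>
     (\<forall>i < length us. local_update P n (graph_after (take (Suc i) us)) (us ! i)
                       (state_after P n (take i us)))"

definition total_time :: "com \<Rightarrow> nat \<Rightarrow> update list \<Rightarrow> nat" where
  "total_time P n us = (\<Sum>i < length us. time P (us ! i) (state_after P n (take i us)))"

text \<open>Words have \<open>O(log n)\<close> bits: all values are polynomially bounded in \<open>n\<close>, at every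
  moment of the computation.\<close>

definition uses_words_up_to :: "nat \<Rightarrow> com \<Rightarrow> nat \<Rightarrow> update list \<Rightarrow> bool" where
  "uses_words_up_to B P n us \<longleftrightarrow>
     (\<forall>i < length us. \<forall>j \<le> time P (us ! i) (state_after P n (take i us)).
        let t = snd (config P (us ! i) (state_after P n (take i us)) j)
        in (\<forall>x. reg t x \<le> B) \<and> (\<forall>p f. cell t p f \<le> B))"

text \<open>At every moment, the space is at most \<open>C\<close> times the size of the current graph.\<close>

definition uses_linear_space :: "nat \<Rightarrow> com \<Rightarrow> nat \<Rightarrow> update list \<Rightarrow> bool" where
  "uses_linear_space C P n us \<longleftrightarrow>
     (\<forall>i < length us. \<forall>j \<le> time P (us ! i) (state_after P n (take i us)).
        card (dom (owner (snd (config P (us ! i) (state_after P n (take i us)) j))))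
          \<le> C * (n + card (graph_after (take (Suc i) us))))"

section \<open>Distributed algorithms with local wakeup\<close>

text \<open>
  Every vertex is a processor with unbounded local memory and unrestricted local computation.
  It initially knows only its own identifier. After an update the two endpoints are told which
  of their incident edges has been inserted or deleted, and wake up. In each synchronous round
  the active vertices (those awake and those that have received a message) compute a new local
  memory, at most one message for each neighbour in the current graph, and whether they stay
  awake for the next round.
\<close>

type_synonym local_memory = "nat \<Rightarrow> nat"

datatype link_event = Inserted nat | Deleted nat

record distributed_algorithm =
  start_memory :: "nat \<Rightarrow> local_memory"
  on_event :: "link_event \<Rightarrow> local_memory \<Rightarrow> local_memory"
  on_round :: "local_memory \<Rightarrow> (nat \<Rightarrow> nat option)
                 \<Rightarrow> local_memory \<times> (nat \<Rightarrow> nat option) \<times> bool"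
  mate_output :: "local_memory \<Rightarrow> nat option"

text \<open>\<open>inbox N v w\<close> is the message received by \<open>v\<close> from \<open>w\<close>.\<close>

record network =
  memory :: "nat \<Rightarrow> local_memory"
  awake :: "nat set"
  inbox :: "nat \<Rightarrow> nat \<Rightarrow> nat option"

definition active :: "network \<Rightarrow> nat set" where
  "active N = awake N \<union> {v. \<exists>w. inbox N v w \<noteq> None}"

definition new_memory :: "distributed_algorithm \<Rightarrow> network \<Rightarrow> nat \<Rightarrow> local_memory" where
  "new_memory A N v = fst (on_round A (memory N v) (inbox N v))"

definition outbox :: "distributed_algorithm \<Rightarrow> network \<Rightarrow> nat \<Rightarrow> nat \<Rightarrow> nat option" where
  "outbox A N v = fst (snd (on_round A (memory N v) (inbox N v)))"

definition stays_awake :: "distributed_algorithm \<Rightarrow> network \<Rightarrow> nat \<Rightarrow> bool" where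
  "stays_awake A N v = snd (snd (on_round A (memory N v) (inbox N v)))"

definition sent :: "distributed_algorithm \<Rightarrow> graph \<Rightarrow> network \<Rightarrow> (nat \<times> nat \<times> nat) set" where
  "sent A E N = {(v, w, m). v \<in> active N \<and> {v, w} \<in> E \<and> outbox A N v w = Some m}"

definition round :: "distributed_algorithm \<Rightarrow> graph \<Rightarrow> network \<Rightarrow> network" where
  "round A E N =
     \<lparr>memory = (\<lambda>v. if v \<in> active N then new_memory A N v else memory N v),
      awake = {v \<in> active N. stays_awake A N v},
      inbox = (\<lambda>w v. if v \<in> active N \<and> {v, w} \<in> E then outbox A N v w else None)\<rparr>"

fun wakeup :: "distributed_algorithm \<Rightarrow> update \<Rightarrow> (nat \<Rightarrow> local_memory) \<Rightarrow> network" where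
  "wakeup A (Insert u v) L =
     \<lparr>memory = L(u := on_event A (Inserted v) (L u), v := on_event A (Inserted u) (L v)),
      awake = {u, v}, inbox = (\<lambda>_ _. None)\<rparr>"
| "wakeup A (Delete u v) L =
     \<lparr>memory = L(u := on_event A (Deleted v) (L u), v := on_event A (Deleted u) (L v)),
      awake = {u, v}, inbox = (\<lambda>_ _. None)\<rparr>"

text \<open>Below, \<open>E\<close> is the graph resulting from the update \<open>u\<close>, and \<open>L\<close> are the local memories
  before it. An update is over when no vertex is active any more.\<close>

definition network_at ::
    "distributed_algorithm \<Rightarrow> graph \<Rightarrow> update \<Rightarrow> (nat \<Rightarrow> local_memory) \<Rightarrow> nat \<Rightarrow> network" where
  "network_at A E u L j = (round A E ^^ j) (wakeup A u L)"

definition quiesces ::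
    "distributed_algorithm \<Rightarrow> graph \<Rightarrow> update \<Rightarrow> (nat \<Rightarrow> local_memory) \<Rightarrow> bool" where
  "quiesces A E u L \<longleftrightarrow> (\<exists>j. active (network_at A E u L j) = {})"

definition rounds ::
    "distributed_algorithm \<Rightarrow> graph \<Rightarrow> update \<Rightarrow> (nat \<Rightarrow> local_memory) \<Rightarrow> nat" where
  "rounds A E u L = (LEAST j. active (network_at A E u L j) = {})"

definition messages ::
    "distributed_algorithm \<Rightarrow> graph \<Rightarrow> update \<Rightarrow> (nat \<Rightarrow> local_memory) \<Rightarrow> nat" where
  "messages A E u L = (\<Sum>j < rounds A E u L. card (sent A E (network_at A E u L j)))"

text \<open>The local memories after the first \<open>i\<close> updates of \<open>us\<close>.\<close>

fun memories :: "distributed_algorithm \<Rightarrow> update list \<Rightarrow> nat \<Rightarrow> nat \<Rightarrow> local_memory" where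
  "memories A us 0 = start_memory A"
| "memories A us (Suc i) =
     (let E = graph_after (take (Suc i) us); L = memories A us i
      in memory (network_at A E (us ! i) L (rounds A E (us ! i) L)))"

definition dist_maintains_maximal_matching ::
    "distributed_algorithm \<Rightarrow> nat \<Rightarrow> update list \<Rightarrow> bool" where
  "dist_maintains_maximal_matching A n us \<longleftrightarrow>
     (\<forall>i < length us. quiesces A (graph_after (take (Suc i) us)) (us ! i) (memories A us i)) \<and>
     (\<forall>i \<le> length us. outputs_maximal_matching n (graph_after (take i us))
                       (\<lambda>v. mate_output A (memories A us i v)))"

definition total_messages :: "distributed_algorithm \<Rightarrow> update list \<Rightarrow> nat" where
  "total_messages A us =
     (\<Sum>i < length us. messages A (graph_after (take (Suc i) us)) (us ! i) (memories A us i))"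

definition worst_case_rounds_le :: "nat \<Rightarrow> distributed_algorithm \<Rightarrow> update list \<Rightarrow> bool" where
  "worst_case_rounds_le C A us \<longleftrightarrow>
     (\<forall>i < length us. rounds A (graph_after (take (Suc i) us)) (us ! i) (memories A us i) \<le> C)"

text \<open>With a bound polynomial in \<open>n\<close>, messages have \<open>O(log n)\<close> bits.\<close>

definition sends_messages_up_to ::
    "nat \<Rightarrow> distributed_algorithm \<Rightarrow> update list \<Rightarrow> bool" where
  "sends_messages_up_to B A us \<longleftrightarrow>
     (\<forall>i < length us. \<forall>j.
        let E = graph_after (take (Suc i) us)
        in \<forall>(v, w, m) \<in> sent A E (network_at A E (us ! i) (memories A us i) j). m \<le> B)"

end

theory Submission
  imports Defs
begin

text \<open>
  Both algorithms maintain an orientation in which every vertex knows which of its in-neighbours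
  are free. A vertex changes its own status only while it has no out-edges, so nobody has to be
  told; to get there it is flushed, i.e. all its out-edges are reversed. After an update both
  endpoints are flushed and, if free, try to match a free in-neighbour, which is flushed as well.

  The cost is the number of reversals. Let \<open>R\<close> be any orientation of out-degree at most \<open>d\<close>. Flushing
  a vertex with \<open>k\<close> out-edges lowers the number of edges on which the current orientation disagrees
  with \<open>R\<close> by at least \<open>k - 2 d\<close>. So the amortised cost is \<open>O(d + r)\<close> if \<open>R\<close> can follow the graph
  with out-degrees at most \<open>d\<close> and \<open>r\<close> amortised reversals per update.

  For \<open>n\<^sup>2 \<le> 2 ^ (m h)\<close> this is possible with \<open>d = 4 \<alpha> (h + 1)\<close> and \<open>r = O(m)\<close>; the bound follows with
  \<open>m \<approx> sqrt (\<alpha> log n)\<close> and \<open>h \<approx> 2 log n / m\<close>. Since the whole sequence is known, build a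
  \<open>2 ^ m\<close>-ary tree of height \<open>h\<close> over time, cut the lifetimes of the edges at the borders of blocks of
  length \<open>2 ^ (m h)\<close>, and assign each piece to the smallest interval of the tree that contains it.
  The pieces of one interval are oriented together, with the children of the interval as time steps.
  Let there be \<open>N\<close> pieces. Vertices on few of them own all of these; on the \<open>O(N / \<alpha>)\<close> others, new
  edges are accommodated by reversing shortest paths from overfull to underfull vertices. At total
  excess \<open>X\<close> such a path has length \<open>O(log (N / X))\<close>: as long as no underfull vertex is reached, the
  density bound lets the lower bound \<open>X / \<alpha>\<close> on the number of reached vertices double with every
  step. Over the \<open>2 ^ m\<close> children these lengths sum up to at most \<open>(m + 2) N\<close>.
\<close>

section \<open>Orientations with few reversals\<close>

text \<open>The orientation \<open>R\<close> exists only in the analysis, so it may depend on future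
  updates; the algorithms never see it, and their cost is bounded against every reference
  orientation at once. The tree over time is a compromise. One level for a whole block
  (\<open>h = 1\<close>) would keep the out-degree at O(\<alpha>) but cost about log n reversals per
  piece, because the path lengths sum up to the logarithm of the number of time steps. With
  \<open>h\<close> levels each piece still belongs to one level and pays only for the
  \<open>2 ^ m\<close> children there, but the out-degrees of the levels add up at every vertex. As
  m h has to be about 2 log n, balancing m against \<alpha> h gives the square root. Blocks need
  length at least \<open>n\<^sup>2\<close> because a border restarts every edge that is present, and
  a whole block of updates has to pay for this. In the out-degree \<open>4 * \<alpha>\<close> of a
  level, one factor 2 is the slack over the density that makes the balls double; the other arises
  because a child interval is seen only at its two ends.\<close>

definition outdeg :: "('i \<Rightarrow> nat) \<Rightarrow> 'i set \<Rightarrow> nat \<Rightarrow> nat" where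
  "outdeg own A v = card {i \<in> A. own i = v}"

text \<open>A step leads from the owner of an edge to its other endpoint: handing the edge over
  moves one unit of out-degree along the step, so a path of steps is an augmenting path.\<close>

definition own_step :: "'i set \<Rightarrow> ('i \<Rightarrow> nat set) \<Rightarrow> ('i \<Rightarrow> nat) \<Rightarrow> nat \<Rightarrow> nat \<Rightarrow> bool" where
  "own_step A e own v w \<longleftrightarrow> (\<exists>i\<in>A. own i = v \<and> e i = {v, w} \<and> v \<noteq> w)"

text \<open>The corrections stand on both sides so that the equations add up along a path without
  subtraction of naturals.\<close>

lemma outdeg_flip:
  assumes "finite A" "i \<in> A" "own i = v" "v \<noteq> w"
  shows "outdeg (own(i := w)) A u + (if u = v then 1 else 0)
       = outdeg own A u + (if u = w then 1 else 0)"
proof -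
  consider "u = v" | "u = w" | "u \<noteq> v" "u \<noteq> w" by blast
  then show ?thesis
  proof cases
    case 1
    have "{j \<in> A. own j = v} = insert i {j \<in> A. (own(i := w)) j = v}"
      using assms by auto
    moreover have "i \<notin> {j \<in> A. (own(i := w)) j = v}" using assms by auto
    ultimately have "card {j \<in> A. own j = v} = Suc (card {j \<in> A. (own(i := w)) j = v})"
      using assms(1) by simp
    then show ?thesis using 1 assms by (simp add: outdeg_def)
  next
    case 2
    have "{j \<in> A. (own(i := w)) j = w} = insert i {j \<in> A. own j = w}"
      using assms by auto
    moreover have "i \<notin> {j \<in> A. own j = w}" using assms by auto
    ultimately have "card {j \<in> A. (own(i := w)) j = w} = Suc (card {j \<in> A. own j = w})"
      using assms(1) by simp
    then show ?thesis using 2 assms by (simp add: outdeg_def)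
  next
    case 3
    have "{j \<in> A. (own(i := w)) j = u} = {j \<in> A. own j = u}"
      using assms 3 by auto
    then show ?thesis using 3 by (simp add: outdeg_def)
  qed
qed

text \<open>The first edge is handed over and the induction continues from the next vertex. The
  corrections at inner vertices cancel, so only the two ends change their out-degree.\<close>

lemma augment_path:
  assumes "finite A"
    and "successively (own_step A e own) (v # vs)" "distinct (v # vs)" "\<forall>i\<in>A. own i \<in> e i"
  shows "\<exists>own'. (\<forall>i\<in>A. own' i \<in> e i) \<and> (\<forall>i. i \<notin> A \<longrightarrow> own' i = own i) \<and>
           card {i\<in>A. own' i \<noteq> own i} \<le> length vs \<and>
           (\<forall>u. outdeg own' A u + (if u = v then 1 else 0)
              = outdeg own A u + (if u = last (v # vs) then 1 else 0))"
  using assms(2-)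
proof (induction vs arbitrary: v own)
  case Nil
  then show ?case by (intro exI[of _ own]) auto
next
  case (Cons w vs)
  from Cons.prems(1) have st: "own_step A e own v w"
    and su: "successively (own_step A e own) (w # vs)" by auto
  from st obtain i where i: "i \<in> A" "own i = v" "e i = {v, w}" "v \<noteq> w"
    unfolding own_step_def by blast
  let ?o = "own(i := w)"
  \<comment> \<open>A step from \<open>x\<close> uses an edge owned by \<open>x\<close>. Only
    \<open>i\<close>, owned by \<open>v\<close>, has changed hands, and \<open>v\<close> does not
    recur on the path, so the remaining steps survive.\<close>
  have step: "own_step A e ?o x y" if x: "x \<in> set (w # vs)" and xy: "own_step A e own x y" for x y
  proof -
    obtain k where k: "k \<in> A" "own k = x" "e k = {x, y}" "x \<noteq> y"
      using xy unfolding own_step_def by (elim bexE conjE)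
    have "x \<noteq> v" using x Cons.prems(2) by auto
    then have "?o k = x" using k(2) i(2) by auto
    then show ?thesis unfolding own_step_def using k by (intro bexI[of _ k] conjI)
  qed
  have "successively (own_step A e ?o) (w # vs)"
    by (rule successively_mono[OF su]) (rule step)
  moreover have "distinct (w # vs)" using Cons.prems(2) by simp
  moreover have "\<forall>j\<in>A. ?o j \<in> e j" using Cons.prems(3) i by auto
  ultimately obtain own' where o: "\<forall>i\<in>A. own' i \<in> e i" "\<forall>i. i \<notin> A \<longrightarrow> own' i = ?o i"
      "card {i\<in>A. own' i \<noteq> ?o i} \<le> length vs"
      "\<forall>u. outdeg own' A u + (if u = w then 1 else 0)
              = outdeg ?o A u + (if u = last (w # vs) then 1 else 0)"
    using Cons.IH by blast
  have "{j\<in>A. own' j \<noteq> own j} \<subseteq> insert i {j\<in>A. own' j \<noteq> ?o j}" by auto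
  then have "card {j\<in>A. own' j \<noteq> own j} \<le> card (insert i {j\<in>A. own' j \<noteq> ?o j})"
    using assms(1) by (intro card_mono) auto
  also have "\<dots> \<le> Suc (length vs)" using o(3) assms(1) by (simp add: card_insert_if)
  finally have c: "card {j\<in>A. own' j \<noteq> own j} \<le> Suc (length vs)" .
  have "outdeg own' A u + (if u = v then 1 else 0)
      = outdeg own A u + (if u = last (v # w # vs) then 1 else 0)" for u
    using o(4)[rule_format, of u] outdeg_flip[where own=own and u=u, OF assms(1) i(1,2,4)] by auto
  with o c i(1) show ?case by (intro exI[of _ own']) auto
qed

lemma outdeg_sum:
  assumes "finite A" "finite S"
  shows "(\<Sum>v\<in>S. outdeg own A v) = card {i\<in>A. own i \<in> S}"
proof -
  have "{i\<in>A. own i \<in> S} = (\<Union>v\<in>S. {i\<in>A. own i = v})" by auto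
  also have "card \<dots> = (\<Sum>v\<in>S. card {i\<in>A. own i = v})"
    using assms by (intro card_UN_disjoint) auto
  finally show ?thesis by (simp add: outdeg_def)
qed

primrec ball_from :: "(nat \<Rightarrow> nat \<Rightarrow> bool) \<Rightarrow> nat set \<Rightarrow> nat \<Rightarrow> nat set" where
  "ball_from r S 0 = S"
| "ball_from r S (Suc j) = ball_from r S j \<union> {w. \<exists>v\<in>ball_from r S j. r v w}"

text \<open>A vertex reached for the first time lies outside the earlier ball. Keeping the whole
  path inside that ball therefore makes the extended path distinct, as the reversal of its edges
  requires.\<close>

lemma ball_from_path:
  "w \<in> ball_from r S j \<Longrightarrow> \<exists>v vs. v \<in> S \<and> last (v # vs) = w \<and> length vs \<le> j \<and>
      distinct (v # vs) \<and> successively r (v # vs) \<and> set (v # vs) \<subseteq> ball_from r S j"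
proof (induction j arbitrary: w)
  case 0
  then show ?case by (intro exI[of _ w] exI[of _ "[]"]) auto
next
  case (Suc j)
  show ?case
  proof (cases "w \<in> ball_from r S j")
    case True
    from Suc.IH[OF this] obtain v vs where "v \<in> S" "last (v # vs) = w" "length vs \<le> j"
      "distinct (v # vs)" "successively r (v # vs)" "set (v # vs) \<subseteq> ball_from r S j" by blast
    then show ?thesis by (intro exI[of _ v] exI[of _ vs]) auto
  next
    case False
    with Suc.prems obtain u where u: "u \<in> ball_from r S j" "r u w" by auto
    from Suc.IH[OF u(1)] obtain v vs where p: "v \<in> S" "last (v # vs) = u" "length vs \<le> j"
      "distinct (v # vs)" "successively r (v # vs)" "set (v # vs) \<subseteq> ball_from r S j" by blast
    have "successively r ((v # vs) @ [w])"
      using p u(2) by (subst successively_append_iff) auto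
    moreover have "distinct ((v # vs) @ [w])" using p False by auto
    moreover have "w \<in> ball_from r S (Suc j)" using Suc.prems .
    ultimately show ?thesis
      using p by (intro exI[of _ v] exI[of _ "vs @ [w]"]) auto
  qed
qed

text \<open>Truncated subtraction lets underfull vertices contribute 0, so they cannot compensate
  for overfull ones.\<close>

definition excess :: "nat \<Rightarrow> ('i \<Rightarrow> nat) \<Rightarrow> 'i set \<Rightarrow> nat set \<Rightarrow> nat" where
  "excess c own A H = (\<Sum>v\<in>H. outdeg own A v - c)"

lemma augmenting_path_exists:
  assumes fin: "finite A" "finite H"
    and e: "\<And>i. i \<in> A \<Longrightarrow> card (e i) = 2 \<and> e i \<subseteq> H"
    and own: "\<forall>i\<in>A. own i \<in> e i"
    and dens: "\<And>U. U \<subseteq> H \<Longrightarrow> card {i\<in>A. e i \<subseteq> U} \<le> a * card U"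
    and H: "a * card H \<le> N"
    and j: "N < 2 ^ j * excess (2 * a) own A H"
  shows "\<exists>v vs. v \<in> H \<and> last (v # vs) \<in> H \<and> 2 * a < outdeg own A v \<and>
      outdeg own A (last (v # vs)) < 2 * a \<and>
      length vs \<le> j \<and> distinct (v # vs) \<and> successively (own_step A e own) (v # vs)"
proof -
  let ?X = "excess (2 * a) own A H"
  let ?B = "{v\<in>H. 2 * a < outdeg own A v}"
  let ?S = "ball_from (own_step A e own) ?B"
  have SH: "?S i \<subseteq> H" for i
  proof (induction i)
    case (Suc i)
    have "w \<in> H" if "own_step A e own v w" for v w
      using that e unfolding own_step_def by fastforce
    with Suc show ?case by auto
  qed auto
  have finS: "finite (?S i)" for i using SH fin(2) finite_subset by blast
  \<comment> \<open>Edges owned inside a ball lie entirely inside the next one, where the density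
    bound applies. So the out-degrees in a ball force the next ball to be large.\<close>
  have grow: "(\<Sum>v\<in>?S i. outdeg own A v) \<le> a * card (?S (Suc i))" for i
  proof -
    have "e k \<subseteq> ?S (Suc i)" if "k \<in> A" "own k \<in> ?S i" for k
    proof -
      have "own k \<in> e k" "card (e k) = 2" using that own e by auto
      then obtain w where "e k = {own k, w}" "own k \<noteq> w"
        by (metis card_2_iff insert_commute insertE singletonD)
      moreover from this have "own_step A e own (own k) w"
        unfolding own_step_def using that by blast
      ultimately show ?thesis using that by auto
    qed
    then have "{k\<in>A. own k \<in> ?S i} \<subseteq> {k\<in>A. e k \<subseteq> ?S (Suc i)}" by blast
    then have "card {k\<in>A. own k \<in> ?S i} \<le> card {k\<in>A. e k \<subseteq> ?S (Suc i)}"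
      using fin by (intro card_mono) auto
    also have "\<dots> \<le> a * card (?S (Suc i))" using dens SH by blast
    finally show ?thesis using outdeg_sum[OF fin(1) finS] by simp
  qed
  have "\<exists>w\<in>?S j. outdeg own A w < 2 * a"
  proof (rule ccontr)
    assume "\<not> ?thesis"
    then have full: "\<And>w. w \<in> ?S j \<Longrightarrow> 2 * a \<le> outdeg own A w" by force
    have mono: "i \<le> k \<Longrightarrow> ?S i \<subseteq> ?S k" for i k :: nat
      by (induction k) (auto simp: le_Suc_eq)
    \<comment> \<open>Out-degree at least \<open>2 * a\<close> at every reached vertex, against
      density \<open>a\<close>, yields the doubling. The induction starts at the overfull vertices,
      whose out-degrees sum to at least the excess.\<close>
    have "i \<le> j \<Longrightarrow> 2 ^ i * ?X \<le> a * card (?S (Suc i))" for i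
    proof (induction i)
      case 0
      have "?X = (\<Sum>v\<in>?B. outdeg own A v - 2 * a)"
        unfolding excess_def using fin(2) by (intro sum.mono_neutral_right) auto
      also have "\<dots> \<le> (\<Sum>v\<in>?B. outdeg own A v)" by (intro sum_mono) auto
      finally show ?case using grow[of 0] by simp
    next
      case (Suc i)
      have "2 ^ Suc i * ?X \<le> 2 * (a * card (?S (Suc i)))" using Suc by simp
      also have "\<dots> = (\<Sum>v\<in>?S (Suc i). 2 * a)" by simp
      also have "\<dots> \<le> (\<Sum>v\<in>?S (Suc i). outdeg own A v)"
        using full mono[OF Suc.prems] by (intro sum_mono) blast
      finally show ?case using grow[of "Suc i"] by linarith
    qed
    from this[of j] have "2 ^ j * ?X \<le> a * card (?S (Suc j))" by simp
    also have "\<dots> \<le> a * card H" using SH[of "Suc j"] fin(2)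
      by (intro mult_left_mono card_mono) (simp_all del: ball_from.simps)
    finally show False using j H by linarith
  qed
  then obtain w where w: "w \<in> ?S j" "outdeg own A w < 2 * a" by blast
  from ball_from_path[OF w(1)] obtain v vs where "v \<in> ?B" "last (v # vs) = w" "length vs \<le> j"
      "distinct (v # vs)" "successively (own_step A e own) (v # vs)" by blast
  moreover have "w \<in> H" using w(1) SH by blast
  ultimately show ?thesis using w(2) by (intro exI[of _ v] exI[of _ vs]) auto
qed

section \<open>Lengths of augmenting paths and their sums\<close>

text \<open>For positive \<open>X\<close> this is the least \<open>j\<close> with
  \<open>N < 2 ^ j * X\<close>, roughly 1 + log2 (N / X) as long as \<open>X \<le> N\<close>: the
  length that suffices for an augmenting path at excess \<open>X\<close>.\<close>

definition halvings :: "nat \<Rightarrow> nat \<Rightarrow> nat" where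
  "halvings N X = card {j. 2 ^ j * X \<le> N}"

lemma halvings_set:
  assumes "0 < X"
  shows "{j. 2 ^ j * X \<le> N} = {..<halvings N X}"
proof -
  have fin: "finite {j. 2 ^ j * X \<le> N}"
  proof (rule finite_subset)
    show "{j. 2 ^ j * X \<le> N} \<subseteq> {..N}"
    proof
      fix j assume "j \<in> {j. 2 ^ j * X \<le> N}"
      then have "2 ^ j * X \<le> N" by simp
      moreover have "j < 2 ^ j" by simp
      moreover have "(2::nat) ^ j * 1 \<le> 2 ^ j * X" using assms by (intro mult_left_mono) auto
      ultimately have "j \<le> N" by linarith
      then show "j \<in> {..N}" by simp
    qed
  qed simp
  have "\<exists>n. {j. 2 ^ j * X \<le> N} = {..<n}"
  proof -
    have down: "i \<in> {j. 2 ^ j * X \<le> N}" if "k \<in> {j. 2 ^ j * X \<le> N}" "i \<le> k" for i k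
    proof -
      have "(2::nat) ^ i * X \<le> 2 ^ k * X" using that(2) by (intro mult_right_mono) (auto intro: power_increasing)
      also have "\<dots> \<le> N" using that(1) by simp
      finally show ?thesis by simp
    qed
    show ?thesis
    proof (cases "{j. 2 ^ j * X \<le> N} = {}")
      case True then show ?thesis by (intro exI[of _ 0]) auto
    next
      case False
      let ?m = "Max {j. 2 ^ j * X \<le> N}"
      have "?m \<in> {j. 2 ^ j * X \<le> N}" using Max_in[OF fin False] .
      then have "j \<in> {j. 2 ^ j * X \<le> N} \<longleftrightarrow> j < Suc ?m" for j
        using down[of ?m j] Max_ge[OF fin, of j] by (simp only: less_Suc_eq_le) blast
      then have "{j. 2 ^ j * X \<le> N} = {..<Suc ?m}" by blast
      then show ?thesis by blast
    qed
  qed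
  then show ?thesis unfolding halvings_def by fastforce
qed

lemma halvings_exceeds: "0 < X \<Longrightarrow> N < 2 ^ halvings N X * X"
  using halvings_set[of X N] by (metis lessThan_iff less_irrefl mem_Collect_eq not_le)

text \<open>Count the pairs of \<open>X\<close> and \<open>j\<close> with
  \<open>2 ^ j * X \<le> N\<close>: each \<open>j < m\<close> occurs with at most \<open>k\<close>
  values of \<open>X\<close>, each \<open>j \<ge> m\<close> with at most \<open>N / 2 ^ j\<close>,
  which is a geometric series. The cut-off \<open>m\<close> is free; over \<open>2 ^ m\<close> time
  steps the second terms add up to \<open>2 * N\<close>.\<close>

lemma sum_halvings:
  "real (\<Sum>X=1..k. halvings N X) \<le> real m * real k + 2 * real N / 2 ^ m"
proof -
  have "(\<Sum>X=1..k. halvings N X) = card (SIGMA X:{1..k}. {..<halvings N X})"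
    by (simp add: card_SigmaI)
  \<comment> \<open>The finite range up to \<open>m + N\<close> is enough, because
    \<open>2 ^ j \<le> N\<close> forces \<open>j < N\<close>.\<close>
  also have "(SIGMA X:{1..k}. {..<halvings N X}) \<subseteq>
      {1..k} \<times> {..<m} \<union> (\<Union>j\<in>{m..<m + N}. {1..N div 2 ^ j} \<times> {j})"
  proof
    fix p assume "p \<in> (SIGMA X:{1..k}. {..<halvings N X})"
    then obtain X j where p: "p = (X, j)" "X \<in> {1..k}" "j < halvings N X" by auto
    then have le: "2 ^ j * X \<le> N" using halvings_set[of X N] by auto
    have "j < 2 ^ j" by simp
    also have "(2::nat) ^ j * 1 \<le> 2 ^ j * X" using p by (intro mult_left_mono) auto
    finally have "j < N" using le by simp
    moreover have "X \<le> N div 2 ^ j" using le by (simp add: less_eq_div_iff_mult_less_eq mult.commute)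
    ultimately show "p \<in> {1..k} \<times> {..<m} \<union> (\<Union>j\<in>{m..<m + N}. {1..N div 2 ^ j} \<times> {j})"
      using p by (cases "j < m") auto
  qed
  then have "card (SIGMA X:{1..k}. {..<halvings N X}) \<le>
      card ({1..k} \<times> {..<m} \<union> (\<Union>j\<in>{m..<m + N}. {1..N div 2 ^ j} \<times> {j}))"
    by (intro card_mono) auto
  also have "\<dots> \<le> card ({1..k} \<times> {..<m}) + card (\<Union>j\<in>{m..<m + N}. {1..N div 2 ^ j} \<times> {j})"
    by (rule card_Un_le)
  also have "card (\<Union>j\<in>{m..<m + N}. {1..N div 2 ^ j} \<times> {j}) \<le> (\<Sum>j\<in>{m..<m + N}. card ({1..N div 2 ^ j} \<times> {j}))"
    by (intro card_UN_le) auto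
  finally have "(\<Sum>X=1..k. halvings N X) \<le> k * m + (\<Sum>j\<in>{m..<m + N}. N div 2 ^ j)"
    by (simp add: card_cartesian_product)
  then have "real (\<Sum>X=1..k. halvings N X) \<le> real (k * m + (\<Sum>j\<in>{m..<m + N}. N div 2 ^ j))"
    by (rule of_nat_mono)
  also have "\<dots> = real k * real m + (\<Sum>j\<in>{m..<m + N}. real (N div 2 ^ j))" by simp
  also have "(\<Sum>j\<in>{m..<m + N}. real (N div 2 ^ j)) \<le> (\<Sum>j\<in>{m..<m + N}. real N / 2 ^ j)"
    by (intro sum_mono) (metis of_nat_numeral of_nat_power of_nat_div_le_of_nat)
  also have "\<dots> = (\<Sum>j<N. real N / 2 ^ (j + m))"
    by (rule sum.reindex_bij_witness[of _ "\<lambda>j. j + m" "\<lambda>j. j - m"]) auto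
  also have "\<dots> = real N / 2 ^ m * (\<Sum>j<N. (1/2) ^ j)"
    by (simp add: sum_distrib_left power_add field_simps power_divide)
  also have "\<dots> \<le> real N / 2 ^ m * 2"
    by (intro mult_left_mono) (auto simp: sum_gp_strict)
  finally show ?thesis by (simp add: mult.commute)
qed

text \<open>Each augmenting path lowers the excess by exactly one, so the excess runs down through
  all values, and the path used at excess \<open>X\<close> has length at most
  \<open>halvings N X\<close>.\<close>

lemma reorient_bounded:
  assumes fin: "finite A" "finite H"
    and e: "\<And>i. i \<in> A \<Longrightarrow> card (e i) = 2 \<and> e i \<subseteq> H"
    and dens: "\<And>U. U \<subseteq> H \<Longrightarrow> card {i\<in>A. e i \<subseteq> U} \<le> a * card U"
    and H: "a * card H \<le> N"
    and own: "\<forall>i\<in>A. own i \<in> e i"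
  shows "\<exists>own'. (\<forall>i\<in>A. own' i \<in> e i) \<and> (\<forall>i. i \<notin> A \<longrightarrow> own' i = own i) \<and>
           (\<forall>v\<in>H. outdeg own' A v \<le> 2 * a) \<and>
           card {i\<in>A. own' i \<noteq> own i} \<le> (\<Sum>X=1..excess (2 * a) own A H. halvings N X)"
  using own
proof (induction "excess (2 * a) own A H" arbitrary: own)
  case 0
  then have "\<forall>v\<in>H. outdeg own A v \<le> 2 * a" using fin(2) by (simp add: excess_def)
  with 0 show ?case by (intro exI[of _ own]) auto
next
  case (Suc k)
  have "N < 2 ^ halvings N (Suc k) * excess (2 * a) own A H"
    using halvings_exceeds[of "Suc k" N] Suc.hyps(2) by simp
  from augmenting_path_exists[OF fin e Suc.prems dens H this]
  obtain v vs where p: "v \<in> H" "last (v # vs) \<in> H" "2 * a < outdeg own A v"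
      "outdeg own A (last (v # vs)) < 2 * a" "length vs \<le> halvings N (Suc k)"
      "distinct (v # vs)" "successively (own_step A e own) (v # vs)" by blast
  from augment_path[OF fin(1) p(7,6) Suc.prems]
  obtain own1 where o1: "\<forall>i\<in>A. own1 i \<in> e i" "\<forall>i. i \<notin> A \<longrightarrow> own1 i = own i"
      "card {i\<in>A. own1 i \<noteq> own i} \<le> length vs"
      "\<forall>u. outdeg own1 A u + (if u = v then 1 else 0)
         = outdeg own A u + (if u = last (v # vs) then 1 else 0)" by blast
  have ne: "v \<noteq> last (v # vs)" using p(3,4) by auto
  \<comment> \<open>The overfull start loses one unit of excess; the underfull end has room for one
    more edge and creates none.\<close>
  have "(outdeg own1 A u - 2 * a) + (if u = v then 1 else 0) = outdeg own A u - 2 * a" for u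
    using o1(4)[rule_format, of u] p(3,4) ne by (auto split: if_splits)
  then have "(\<Sum>u\<in>H. (outdeg own1 A u - 2 * a) + (if u = v then 1 else 0)) = excess (2 * a) own A H"
    unfolding excess_def by simp
  then have "excess (2 * a) own1 A H + 1 = Suc k"
    using p(1) fin(2) Suc.hyps(2) by (simp add: sum.distrib excess_def)
  then have k: "k = excess (2 * a) own1 A H" by simp
  from Suc.hyps(1)[OF k o1(1)] obtain own2 where o2: "\<forall>i\<in>A. own2 i \<in> e i"
      "\<forall>i. i \<notin> A \<longrightarrow> own2 i = own1 i" "\<forall>v\<in>H. outdeg own2 A v \<le> 2 * a"
      "card {i\<in>A. own2 i \<noteq> own1 i} \<le> (\<Sum>X=1..k. halvings N X)" using k by auto
  have "card {i\<in>A. own2 i \<noteq> own i} \<le> card ({i\<in>A. own2 i \<noteq> own1 i} \<union> {i\<in>A. own1 i \<noteq> own i})"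
    using fin(1) by (intro card_mono) auto
  also have "\<dots> \<le> card {i\<in>A. own2 i \<noteq> own1 i} + card {i\<in>A. own1 i \<noteq> own i}"
    by (rule card_Un_le)
  also have "\<dots> \<le> (\<Sum>X=1..k. halvings N X) + halvings N (Suc k)"
    using o2(4) o1(3) p(5) by linarith
  also have "\<dots> = (\<Sum>X=1..excess (2 * a) own A H. halvings N X)"
    by (simp flip: Suc.hyps(2))
  finally show ?case using o2 o1(2) by (intro exI[of _ own2]) auto
qed

text \<open>An index \<open>i\<close> stands for an edge \<open>e i\<close> present at the times from \<open>fs i\<close> to \<open>ls i\<close>, and
  \<open>own i t\<close> is its tail at time \<open>t\<close>.\<close>

definition alive :: "('i \<Rightarrow> nat) \<Rightarrow> ('i \<Rightarrow> nat) \<Rightarrow> 'i \<Rightarrow> nat \<Rightarrow> bool" where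
  "alive fs ls i t \<longleftrightarrow> fs i \<le> t \<and> t \<le> ls i"

definition switches :: "'i set \<Rightarrow> ('i \<Rightarrow> nat) \<Rightarrow> ('i \<Rightarrow> nat) \<Rightarrow> ('i \<Rightarrow> nat \<Rightarrow> nat) \<Rightarrow> ('i \<times> nat) set" where
  "switches I fs ls own = {(i, t). i \<in> I \<and> fs i \<le> t \<and> t < ls i \<and> own i t \<noteq> own i (Suc t)}"

definition orientable ::
    "'i set \<Rightarrow> ('i \<Rightarrow> nat set) \<Rightarrow> ('i \<Rightarrow> nat) \<Rightarrow> ('i \<Rightarrow> nat) \<Rightarrow> nat \<Rightarrow> nat \<Rightarrow> bool" where
  "orientable I e s f c b \<longleftrightarrow> (\<exists>own. (\<forall>i\<in>I. \<forall>t. own i t \<in> e i) \<and>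
     (\<forall>t v. card {i\<in>I. alive s f i t \<and> own i t = v} \<le> c) \<and>
     card (switches I s f own) \<le> b * card I)"

lemma finite_switches: "finite I \<Longrightarrow> finite (switches I fs ls own)"
  by (rule finite_subset[of _ "SIGMA i:I. {..<ls i}"]) (auto simp: switches_def)

section \<open>Ownership over one level of time steps\<close>

text \<open>Times are treated in order, each starting from the ownership at the time before. All
  out-degrees were at most \<open>2 * a\<close> then, and edges that end only lower them, so the
  excess is at most the number of edges that start now.\<close>

lemma dense_edges_ownership:
  fixes e :: "'i \<Rightarrow> nat set"
  assumes fin: "finite I" "finite H"
    and e: "\<And>i. i \<in> I \<Longrightarrow> card (e i) = 2 \<and> e i \<subseteq> H"
    and dens: "\<And>t U. U \<subseteq> H \<Longrightarrow> card {i\<in>I. alive fs ls i t \<and> e i \<subseteq> U} \<le> a * card U"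
    and H: "a * card H \<le> N"
  shows "\<exists>own. (\<forall>i\<in>I. \<forall>t. own i t \<in> e i) \<and>
     (\<forall>t<m. \<forall>v\<in>H. card {i\<in>I. alive fs ls i t \<and> own i t = v} \<le> 2 * a) \<and>
     (\<Sum>t<m. card {i\<in>I. fs i < t \<and> t \<le> ls i \<and> own i (t - 1) \<noteq> own i t})
       \<le> (\<Sum>t<m. \<Sum>X=1..card {i\<in>I. fs i = t}. halvings N X)"
proof (induction m)
  case 0
  have "\<forall>i\<in>I. \<exists>v. v \<in> e i"
    using e by (metis card.empty ex_in_conv zero_neq_numeral)
  then obtain o0 where "\<forall>i\<in>I. o0 i \<in> e i" by metis
  then show ?case by (intro exI[of _ "\<lambda>i _. o0 i"]) auto
next
  case (Suc m)
  then obtain own where o: "\<forall>i\<in>I. \<forall>t. own i t \<in> e i"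
     "\<forall>t<m. \<forall>v\<in>H. card {i\<in>I. alive fs ls i t \<and> own i t = v} \<le> 2 * a"
     "(\<Sum>t<m. card {i\<in>I. fs i < t \<and> t \<le> ls i \<and> own i (t - 1) \<noteq> own i t})
       \<le> (\<Sum>t<m. \<Sum>X=1..card {i\<in>I. fs i = t}. halvings N X)" by blast
  let ?A = "{i\<in>I. alive fs ls i m}"
  \<comment> \<open>At \<open>m = 0\<close> truncated subtraction yields the still arbitrary
    ownership at time 0; there every living edge has just started, so the excess is bounded all the
    same.\<close>
  let ?p = "\<lambda>i. own i (m - 1)"
  have finA: "finite ?A" using fin by auto
  have eA: "card (e i) = 2 \<and> e i \<subseteq> H" if "i \<in> ?A" for i using e that by auto
  have dA: "card {i\<in>?A. e i \<subseteq> U} \<le> a * card U" if "U \<subseteq> H" for U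
    using dens[OF that, of m] by (simp add: conj_assoc)
  have pA: "\<forall>i\<in>?A. ?p i \<in> e i" using o(1) by auto
  from reorient_bounded[OF finA fin(2) eA dA H pA]
  obtain q where q: "\<forall>i\<in>?A. q i \<in> e i" "\<forall>i. i \<notin> ?A \<longrightarrow> q i = ?p i"
     "\<forall>v\<in>H. outdeg q ?A v \<le> 2 * a"
     "card {i\<in>?A. q i \<noteq> ?p i} \<le> (\<Sum>X=1..excess (2 * a) ?p ?A H. halvings N X)" by blast
  have "excess (2 * a) ?p ?A H \<le> card {i\<in>I. fs i = m}"
  proof -
    have "outdeg ?p ?A v - 2 * a \<le> card {i\<in>I. fs i = m \<and> ?p i = v}" if "v \<in> H" for v
    proof (cases "m = 0")
      case True
      have "{i\<in>?A. ?p i = v} \<subseteq> {i\<in>I. fs i = m \<and> ?p i = v}" using True by (auto simp: alive_def)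
      then have "card {i\<in>?A. ?p i = v} \<le> card {i\<in>I. fs i = m \<and> ?p i = v}"
        using fin(1) by (intro card_mono) auto
      then show ?thesis unfolding outdeg_def by linarith
    next
      case False
      have "{i\<in>?A. ?p i = v} \<subseteq> {i\<in>I. alive fs ls i (m - 1) \<and> ?p i = v} \<union> {i\<in>I. fs i = m \<and> ?p i = v}"
        using False by (auto simp: alive_def)
      then have "card {i\<in>?A. ?p i = v} \<le>
          card ({i\<in>I. alive fs ls i (m - 1) \<and> ?p i = v} \<union> {i\<in>I. fs i = m \<and> ?p i = v})"
        using fin(1) by (intro card_mono) auto
      also have "\<dots> \<le> card {i\<in>I. alive fs ls i (m - 1) \<and> ?p i = v} + card {i\<in>I. fs i = m \<and> ?p i = v}"
        by (rule card_Un_le)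
      also have "card {i\<in>I. alive fs ls i (m - 1) \<and> ?p i = v} \<le> 2 * a"
        using o(2) False that by simp
      finally show ?thesis unfolding outdeg_def by linarith
    qed
    then have "excess (2 * a) ?p ?A H \<le> (\<Sum>v\<in>H. outdeg ?p {i\<in>I. fs i = m} v)"
      unfolding excess_def by (intro sum_mono) (simp add: outdeg_def)
    also have "\<dots> \<le> card {i\<in>I. fs i = m}"
      using fin by (subst outdeg_sum) (auto intro: card_mono)
    finally show ?thesis .
  qed
  then have "(\<Sum>X=1..excess (2 * a) ?p ?A H. halvings N X) \<le> (\<Sum>X=1..card {i\<in>I. fs i = m}. halvings N X)"
    by (intro sum_mono2) auto
  with q(4) have c: "card {i\<in>?A. q i \<noteq> ?p i} \<le> (\<Sum>X=1..card {i\<in>I. fs i = m}. halvings N X)"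
    by linarith
  let ?own = "\<lambda>i t. if t = m then q i else own i t"
  have 1: "\<forall>i\<in>I. \<forall>t. ?own i t \<in> e i"
  proof (intro ballI allI)
    fix i t assume "i \<in> I"
    then have "q i \<in> e i" using q(1,2) o(1) by (cases "i \<in> ?A") auto
    then show "?own i t \<in> e i" using o(1) \<open>i \<in> I\<close> by auto
  qed
  have 2: "\<forall>t<Suc m. \<forall>v\<in>H. card {i\<in>I. alive fs ls i t \<and> ?own i t = v} \<le> 2 * a"
    using o(2) q(3) by (auto simp: less_Suc_eq outdeg_def conj_assoc)
  have "{i\<in>I. fs i < m \<and> m \<le> ls i \<and> ?own i (m - 1) \<noteq> ?own i m} \<subseteq> {i\<in>?A. q i \<noteq> ?p i}"
    by (cases m) (auto simp: alive_def)
  then have "card {i\<in>I. fs i < m \<and> m \<le> ls i \<and> ?own i (m - 1) \<noteq> ?own i m} \<le> card {i\<in>?A. q i \<noteq> ?p i}"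
    using fin(1) by (intro card_mono) auto
  moreover have "(\<Sum>t<m. card {i\<in>I. fs i < t \<and> t \<le> ls i \<and> ?own i (t - 1) \<noteq> ?own i t})
      = (\<Sum>t<m. card {i\<in>I. fs i < t \<and> t \<le> ls i \<and> own i (t - 1) \<noteq> own i t})"
    by (intro sum.cong refl arg_cong[where f=card]) auto
  ultimately have "(\<Sum>t<Suc m. card {i\<in>I. fs i < t \<and> t \<le> ls i \<and> ?own i (t - 1) \<noteq> ?own i t})
       \<le> (\<Sum>t<Suc m. \<Sum>X=1..card {i\<in>I. fs i = t}. halvings N X)"
    using o(3) c by (simp only: sum.lessThan_Suc)
  with 1 2 show ?case by (intro exI[of _ ?own]) blast
qed

text \<open>Double counting of incidences: the degrees sum to at most
  \<open>2 * card I\<close>.\<close>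

lemma card_high_degree:
  fixes e :: "'i \<Rightarrow> nat set"
  assumes "finite I" "\<And>i. i \<in> I \<Longrightarrow> card (e i) = 2"
  shows "finite {v. c < card {i\<in>I. v \<in> e i}}" "c * card {v. c < card {i\<in>I. v \<in> e i}} \<le> 2 * card I"
proof -
  let ?H = "{v. c < card {i\<in>I. v \<in> e i}}"
  have fe: "finite (e i)" if "i \<in> I" for i using assms(2)[OF that] card.infinite by fastforce
  have "?H \<subseteq> (\<Union>i\<in>I. e i)"
  proof
    fix v assume "v \<in> ?H"
    then have "{i\<in>I. v \<in> e i} \<noteq> {}" by (metis (mono_tags, lifting) card.empty mem_Collect_eq not_less0)
    then show "v \<in> (\<Union>i\<in>I. e i)" by blast
  qed
  then show f: "finite ?H" using assms(1) fe finite_subset by blast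
  have "c * card ?H = (\<Sum>v\<in>?H. c)" by simp
  also have "\<dots> \<le> (\<Sum>v\<in>?H. card {i\<in>I. v \<in> e i})" by (intro sum_mono) auto
  also have "\<dots> = (\<Sum>i\<in>I. card {v\<in>?H. v \<in> e i})"
    using sum.swap_restrict[OF f assms(1), of "\<lambda>_ _. 1::nat" "\<lambda>v i. v \<in> e i"] by simp
  also have "\<dots> \<le> (\<Sum>i\<in>I. 2)"
    using assms(2) fe by (intro sum_mono) (metis (no_types, lifting) Collect_subset card_mono mem_Collect_eq subsetI)
  finally show "c * card ?H \<le> 2 * card I" by simp
qed

lemma bounded_ownership_one_level:
  fixes e :: "'i \<Rightarrow> nat set"
  assumes fin: "finite I"
    and e: "\<And>i. i \<in> I \<Longrightarrow> card (e i) = 2"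
    and dens: "\<And>t U. finite U \<Longrightarrow> card {i\<in>I. alive fs ls i t \<and> e i \<subseteq> U} \<le> a * card U"
    and ls: "\<And>i. i \<in> I \<Longrightarrow> ls i < 2 ^ m"
  shows "\<exists>own. (\<forall>i\<in>I. \<forall>t. own i t \<in> e i) \<and>
     (\<forall>t v. card {i\<in>I. alive fs ls i t \<and> own i t = v} \<le> 2 * a) \<and>
     card (switches I fs ls own) \<le> (m + 2) * card I"
proof -
  let ?N = "card I"
  \<comment> \<open>The threshold \<open>2 * a\<close> serves twice: a vertex not above it may own
    all its edges at once, and the vertices above it are few enough for
    \<open>a * card H \<le> card I\<close>.\<close>
  define H where "H = {v. 2 * a < card {i\<in>I. v \<in> e i}}"
  have finH: "finite H" and H: "a * card H \<le> ?N"
    using card_high_degree[OF fin e, where c = "2 * a"] by (auto simp: H_def)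
  define I' where "I' = {i\<in>I. e i \<subseteq> H}"
  have finI': "finite I'" and sub: "I' \<subseteq> I" using fin by (auto simp: I'_def)
  have eI': "card (e i) = 2 \<and> e i \<subseteq> H" if "i \<in> I'" for i using that e by (auto simp: I'_def)
  have dI': "card {i\<in>I'. alive fs ls i t \<and> e i \<subseteq> U} \<le> a * card U" if "U \<subseteq> H" for t U
  proof -
    have "card {i\<in>I'. alive fs ls i t \<and> e i \<subseteq> U} \<le> card {i\<in>I. alive fs ls i t \<and> e i \<subseteq> U}"
      using fin by (intro card_mono) (auto simp: I'_def)
    also have "\<dots> \<le> a * card U" using dens finite_subset[OF that finH] by blast
    finally show ?thesis .
  qed
  from dense_edges_ownership[OF finI' finH eI' dI' H, of "2 ^ m"]
  obtain own where o: "\<forall>i\<in>I'. \<forall>t. own i t \<in> e i"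
     "\<forall>t<2 ^ m. \<forall>v\<in>H. card {i\<in>I'. alive fs ls i t \<and> own i t = v} \<le> 2 * a"
     "(\<Sum>t<2 ^ m. card {i\<in>I'. fs i < t \<and> t \<le> ls i \<and> own i (t - 1) \<noteq> own i t})
       \<le> (\<Sum>t<2 ^ m. \<Sum>X=1..card {i\<in>I'. fs i = t}. halvings ?N X)" by blast
  \<comment> \<open>Edges that leave \<open>H\<close> get a fixed owner outside \<open>H\<close> and
    are never reversed.\<close>
  have "\<forall>i\<in>I - I'. \<exists>v. v \<in> e i \<and> v \<notin> H" by (auto simp: I'_def)
  then obtain l where l: "\<forall>i\<in>I - I'. l i \<in> e i \<and> l i \<notin> H" by metis
  then have l': "l i \<notin> H" if "i \<in> I" "i \<notin> I'" for i using that by blast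
  let ?own = "\<lambda>i t. if i \<in> I' then own i t else l i"
  have 1: "\<forall>i\<in>I. \<forall>t. ?own i t \<in> e i" using o(1) l by auto
  have 2: "card {i\<in>I. alive fs ls i t \<and> ?own i t = v} \<le> 2 * a" for t v
  proof (cases "v \<in> H")
    case True
    have "i \<in> I \<and> alive fs ls i t \<and> ?own i t = v \<longleftrightarrow> i \<in> I' \<and> alive fs ls i t \<and> own i t = v" for i
      using l'[of i] True sub by (cases "i \<in> I'") auto
    then have eq: "{i\<in>I. alive fs ls i t \<and> ?own i t = v} = {i\<in>I'. alive fs ls i t \<and> own i t = v}"
      by blast
    show ?thesis
    proof (cases "t < 2 ^ m")
      case True
      then show ?thesis using o(2) \<open>v \<in> H\<close> eq by auto
    next
      case False
      then have "{i\<in>I'. alive fs ls i t \<and> own i t = v} = {}"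
        using ls by (fastforce simp: I'_def alive_def)
      then show ?thesis by (metis card.empty eq le0)
    qed
  next
    case False
    have "i \<in> {i\<in>I. v \<in> e i}" if "i \<in> {i\<in>I. alive fs ls i t \<and> ?own i t = v}" for i
    proof -
      have "i \<in> I" "?own i t = v" using that by auto
      moreover have "?own i t \<in> e i" using 1 \<open>i \<in> I\<close> by blast
      ultimately show ?thesis by (metis (mono_tags) mem_Collect_eq)
    qed
    then have "card {i\<in>I. alive fs ls i t \<and> ?own i t = v} \<le> card {i\<in>I. v \<in> e i}"
      using fin by (intro card_mono subsetI) simp_all
    then show ?thesis using False by (simp add: H_def)
  qed
  \<comment> \<open>A switch between \<open>t\<close> and \<open>Suc t\<close> is charged to the
    later time, where the reorientation takes place.\<close>
  have "switches I fs ls ?own \<subseteq>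
      (\<lambda>(t, i). (i, t - 1)) ` (SIGMA t:{..<2 ^ m}. {i\<in>I'. fs i < t \<and> t \<le> ls i \<and> own i (t - 1) \<noteq> own i t})"
  proof
    fix p assume "p \<in> switches I fs ls ?own"
    then obtain i t where p: "p = (i, t)" "i \<in> I" "fs i \<le> t" "t < ls i" "?own i t \<noteq> ?own i (Suc t)"
      by (auto simp: switches_def)
    then have "i \<in> I'" by (auto split: if_splits)
    moreover have "Suc t < 2 ^ m" using p ls[of i] by linarith
    ultimately show "p \<in> (\<lambda>(t, i). (i, t - 1)) ` (SIGMA t:{..<2 ^ m}. {i\<in>I'. fs i < t \<and> t \<le> ls i \<and> own i (t - 1) \<noteq> own i t})"
      using p by (intro image_eqI[of _ _ "(Suc t, i)"]) auto
  qed
  then have "card (switches I fs ls ?own) \<le>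
      card (SIGMA t:{..<2 ^ m}. {i\<in>I'. fs i < t \<and> t \<le> ls i \<and> own i (t - 1) \<noteq> own i t})"
    using finI' by (intro surj_card_le) (auto intro!: finite_SigmaI)
  also have "\<dots> = (\<Sum>t<2 ^ m. card {i\<in>I'. fs i < t \<and> t \<le> ls i \<and> own i (t - 1) \<noteq> own i t})"
    using finI' by (simp add: card_SigmaI)
  also note o(3)
  finally have "real (card (switches I fs ls ?own))
      \<le> real (\<Sum>t<2 ^ m. \<Sum>X=1..card {i\<in>I'. fs i = t}. halvings ?N X)"
    by (rule of_nat_mono)
  also have "\<dots> = (\<Sum>t<2 ^ m. real (\<Sum>X=1..card {i\<in>I'. fs i = t}. halvings ?N X))"
    by (rule of_nat_sum)
  \<comment> \<open>Every edge starts only once, so the first terms sum to at most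
    \<open>m * card I\<close>; the second terms, one for each of the \<open>2 ^ m\<close> times, sum
    to \<open>2 * card I\<close>. This is the origin of \<open>m + 2\<close>.\<close>
  also have "\<dots> \<le> (\<Sum>t<2 ^ m. real m * real (card {i\<in>I'. fs i = t}) + 2 * real ?N / 2 ^ m)"
    by (intro sum_mono sum_halvings)
  also have "\<dots> = real m * real (\<Sum>t<2 ^ m. card {i\<in>I'. fs i = t}) + 2 * real ?N"
    by (simp add: sum.distrib sum_distrib_left)
  also have "(\<Sum>t<2 ^ m. card {i\<in>I'. fs i = t}) \<le> ?N"
  proof -
    have "(\<Sum>t<2 ^ m. card {i\<in>I'. fs i = t}) = card (\<Union>t<2 ^ m. {i\<in>I'. fs i = t})"
      using finI' by (subst card_UN_disjoint) auto
    also have "\<dots> \<le> ?N" using fin by (intro card_mono) (auto simp: I'_def)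
    finally show ?thesis .
  qed
  then have "real m * real (\<Sum>t<2 ^ m. card {i\<in>I'. fs i = t}) + 2 * real ?N \<le> real ((m + 2) * ?N)"
    by (simp only: of_nat_mult of_nat_add distrib_right) (intro add_mono mult_left_mono of_nat_mono, auto)
  finally have "card (switches I fs ls ?own) \<le> (m + 2) * ?N" by linarith
  with 1 2 show ?thesis by (intro exI[of _ ?own]) blast
qed

text \<open>An edge whose lifetime reaches over the border of a child of \<open>J\<close> is present at the first or
  at the last moment of that child; hence the factor \<open>2\<close> in the density.\<close>

lemma bounded_ownership_crossing:
  fixes e :: "'i \<Rightarrow> nat set"
  assumes fin: "finite I"
    and e: "\<And>i. i \<in> I \<Longrightarrow> card (e i) = 2"
    and dens: "\<And>t U. finite U \<Longrightarrow> card {i\<in>I. alive s f i t \<and> e i \<subseteq> U} \<le> a * card U"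
    and block: "\<And>i. i \<in> I \<Longrightarrow> s i \<le> f i \<and> s i div (B * 2 ^ m) = q \<and> f i div (B * 2 ^ m) = q"
    and cross: "\<And>i. i \<in> I \<Longrightarrow> s i div B \<noteq> f i div B" and B: "0 < B"
  shows "\<exists>own. (\<forall>i\<in>I. \<forall>t. own i t \<in> e i) \<and>
     (\<forall>t v. card {i\<in>I. alive s f i t \<and> own i t = v} \<le> 4 * a) \<and>
     card (switches I s f own) \<le> (m + 2) * card I"
proof -
  define M :: nat where "M = 2 ^ m"
  have M: "0 < M" by (simp add: M_def)
  \<comment> \<open>\<open>?c t\<close> numbers the child of length \<open>B\<close> that contains
    \<open>t\<close> within its block of length \<open>B * M\<close>.\<close>
  let ?c = "\<lambda>t. t div B mod M"
  have dm: "t div B = q * M + ?c t" if "t div (B * M) = q" for t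
    using that by (metis div_mult2_eq div_mult_mod_eq)
  let ?fs = "\<lambda>i. ?c (s i)" and ?ls = "\<lambda>i. ?c (f i)"
  have lt: "?fs i < ?ls i" if "i \<in> I" for i
  proof -
    have "s i div B \<le> f i div B" using block[OF that] by (intro div_le_mono) auto
    with cross[OF that] show ?thesis using dm block[OF that] unfolding M_def by (metis add_less_cancel_left le_neq_implies_less)
  qed
  have D: "card {i\<in>I. alive ?fs ?ls i k \<and> e i \<subseteq> U} \<le> (2 * a) * card U" if U: "finite U" for k U
  proof -
    let ?t0 = "(q * M + k) * B" and ?t1 = "(q * M + k) * B + (B - 1)"
    have "{i\<in>I. alive ?fs ?ls i k \<and> e i \<subseteq> U} \<subseteq>
       {i\<in>I. alive s f i ?t0 \<and> e i \<subseteq> U} \<union> {i\<in>I. alive s f i ?t1 \<and> e i \<subseteq> U}"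
    proof
      fix i assume i: "i \<in> {i\<in>I. alive ?fs ?ls i k \<and> e i \<subseteq> U}"
      then have iI: "i \<in> I" and k: "?fs i \<le> k" "k \<le> ?ls i" by (auto simp: alive_def)
      have sd: "s i div B = q * M + ?fs i" and fd: "f i div B = q * M + ?ls i"
        using dm block[OF iI] unfolding M_def by blast+
      have "alive s f i ?t0 \<or> alive s f i ?t1"
      proof (cases "?fs i < k")
        case True
        then have "s i div B < q * M + k" using sd by simp
        then have "s i < ?t0" using B by (simp add: div_less_iff_less_mult)
        moreover have "q * M + k \<le> f i div B" using fd k by simp
        then have "?t0 \<le> f i" using B by (simp add: less_eq_div_iff_mult_less_eq)
        ultimately show ?thesis by (simp add: alive_def)
      next
        case False
        then have k': "k = ?fs i" using k by simp
        then have "q * M + k < f i div B" using fd lt[OF iI] by simp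
        then have "Suc (q * M + k) \<le> f i div B" by simp
        then have "Suc (q * M + k) * B \<le> f i" using B by (simp only: less_eq_div_iff_mult_less_eq)
        then have "?t1 \<le> f i" using B by simp
        moreover have "s i div B \<le> q * M + k" using sd k' by simp
        then have "s i div B < Suc (q * M + k)" by simp
        then have "s i < Suc (q * M + k) * B" using B by (simp only: div_less_iff_less_mult)
        then have "s i \<le> ?t1" using B by simp
        ultimately show ?thesis by (simp add: alive_def)
      qed
      with i show "i \<in> {i\<in>I. alive s f i ?t0 \<and> e i \<subseteq> U} \<union> {i\<in>I. alive s f i ?t1 \<and> e i \<subseteq> U}" by auto
    qed
    then have "card {i\<in>I. alive ?fs ?ls i k \<and> e i \<subseteq> U} \<le>
       card ({i\<in>I. alive s f i ?t0 \<and> e i \<subseteq> U} \<union> {i\<in>I. alive s f i ?t1 \<and> e i \<subseteq> U})"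
      using fin by (intro card_mono) auto
    also have "\<dots> \<le> card {i\<in>I. alive s f i ?t0 \<and> e i \<subseteq> U} + card {i\<in>I. alive s f i ?t1 \<and> e i \<subseteq> U}"
      by (rule card_Un_le)
    also have "\<dots> \<le> a * card U + a * card U" using dens[OF U] by (intro add_mono) auto
    finally show ?thesis by simp
  qed
  have L: "?ls i < 2 ^ m" if "i \<in> I" for i using M by (simp add: M_def)
  from bounded_ownership_one_level[OF fin e D L]
  obtain own where o: "\<forall>i\<in>I. \<forall>t. own i t \<in> e i"
     "\<forall>t v. card {i\<in>I. alive ?fs ?ls i t \<and> own i t = v} \<le> 2 * (2 * a)"
     "card (switches I ?fs ?ls own) \<le> (m + 2) * card I" by blast
  \<comment> \<open>The owner stays fixed inside a child, so reversals happen only at borders of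
    children.\<close>
  let ?own = "\<lambda>i t. own i (?c t)"
  have al: "t div (B * M) = q \<and> ?fs i \<le> ?c t \<and> ?c t \<le> ?ls i" if "i \<in> I" "s i \<le> t" "t \<le> f i" for i t
  proof -
    have "s i div (B * M) \<le> t div (B * M)" "t div (B * M) \<le> f i div (B * M)"
      using that by (auto intro: div_le_mono)
    then have tq: "t div (B * M) = q" using block[OF that(1)] by (simp add: M_def)
    have "s i div B \<le> t div B" "t div B \<le> f i div B" using that by (auto intro: div_le_mono)
    moreover have "s i div (B * M) = q" "f i div (B * M) = q" using block[OF that(1)] by (auto simp: M_def)
    ultimately show ?thesis using dm[of t] dm[of "s i"] dm[of "f i"] tq by (metis nat_add_left_cancel_le)
  qed
  have 2: "card {i\<in>I. alive s f i t \<and> ?own i t = v} \<le> 4 * a" for t v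
  proof -
    have "{i\<in>I. alive s f i t \<and> ?own i t = v} \<subseteq> {i\<in>I. alive ?fs ?ls i (?c t) \<and> own i (?c t) = v}"
      using al by (auto simp: alive_def)
    then have "card {i\<in>I. alive s f i t \<and> ?own i t = v} \<le>
        card {i\<in>I. alive ?fs ?ls i (?c t) \<and> own i (?c t) = v}"
      using fin by (intro card_mono) auto
    also have "\<dots> \<le> 2 * (2 * a)" using o(2) by blast
    finally show ?thesis by simp
  qed
  have "card (switches I s f ?own) \<le> card (switches I ?fs ?ls own)"
  proof (rule card_inj_on_le[where f = "\<lambda>(i, t). (i, ?c t)"])
    \<comment> \<open>A switch occurs only if \<open>Suc t\<close> is the first moment of a child.
      The number of the child then determines \<open>t\<close>, which makes the map to the switches
      on the level of children injective.\<close>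
    have sw: "t div (B * M) = q \<and> Suc t div (B * M) = q \<and> ?fs i \<le> ?c t \<and> ?c (Suc t) \<le> ?ls i
        \<and> ?c (Suc t) = Suc (?c t) \<and> Suc t = (q * M + Suc (?c t)) * B \<and> i \<in> I \<and> own i (?c t) \<noteq> own i (Suc (?c t))"
      if "(i, t) \<in> switches I s f ?own" for i t
    proof -
      from that have i: "i \<in> I" "s i \<le> t" "t < f i" "own i (?c t) \<noteq> own i (?c (Suc t))"
        by (auto simp: switches_def)
      have a1: "t div (B * M) = q" "?fs i \<le> ?c t" and a2: "Suc t div (B * M) = q" "?c (Suc t) \<le> ?ls i"
        using al[OF i(1), of t] al[OF i(1), of "Suc t"] i by auto
      have "t div B \<noteq> Suc t div B" using i(4) by auto
      then have "Suc t div B = Suc (t div B)" and z: "Suc t mod B = 0"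
        by (auto simp: div_Suc split: if_splits)
      then have c: "?c (Suc t) = Suc (?c t)" using dm[OF a1(1)] dm[OF a2(1)] by linarith
      have "Suc t = Suc t div B * B" using z by (metis add.right_neutral div_mult_mod_eq)
      then have "Suc t = (q * M + Suc (?c t)) * B" using dm[OF a2(1)] c by simp
      with a1 a2 c i show ?thesis by auto
    qed
    show "inj_on (\<lambda>(i, t). (i, ?c t)) (switches I s f ?own)"
    proof (rule inj_onI)
      fix x y
      assume x: "x \<in> switches I s f ?own" and y: "y \<in> switches I s f ?own"
        and eq: "(\<lambda>(i, t). (i, ?c t)) x = (\<lambda>(i, t). (i, ?c t)) y"
      obtain i t j u where xy: "x = (i, t)" "y = (j, u)" by (meson surj_pair)
      then have ij: "i = j" "?c t = ?c u" using eq by auto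
      have "Suc t = Suc u" using sw[of i t] sw[of j u] x y xy ij(2) by metis
      then show "x = y" using xy ij by simp
    qed
    show "(\<lambda>(i, t). (i, ?c t)) ` switches I s f ?own \<subseteq> switches I ?fs ?ls own"
    proof
      fix y assume "y \<in> (\<lambda>(i, t). (i, ?c t)) ` switches I s f ?own"
      then obtain i t where it: "(i, t) \<in> switches I s f ?own" "y = (i, ?c t)" by auto
      from sw[OF it(1)] show "y \<in> switches I ?fs ?ls own"
        unfolding it(2) by (auto simp: switches_def)
    qed
    show "finite (switches I ?fs ?ls own)" by (rule finite_switches[OF fin])
  qed
  with o(3) have 3: "card (switches I s f ?own) \<le> (m + 2) * card I" by linarith
  have 1: "\<forall>i\<in>I. \<forall>t. ?own i t \<in> e i" using o(1) by blast
  show ?thesis by (intro exI[of _ ?own] conjI allI 1 2 3)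
qed

section \<open>Assembling the levels of the tree over time\<close>

text \<open>This joins different levels of the tree. They may be alive at the same times, so their
  out-degrees add, whereas the budget \<open>b\<close> is per piece and stays.\<close>

lemma orientable_Un:
  assumes fin: "finite J" "finite K" and disj: "J \<inter> K = {}"
    and J: "orientable J e s f c b" and K: "orientable K e s f d b"
  shows "orientable (J \<union> K) e s f (c + d) b"
proof -
  from J obtain p where p: "\<forall>i\<in>J. \<forall>t. p i t \<in> e i"
     "\<forall>t v. card {i\<in>J. alive s f i t \<and> p i t = v} \<le> c" "card (switches J s f p) \<le> b * card J"
    unfolding orientable_def by blast
  from K obtain r where r: "\<forall>i\<in>K. \<forall>t. r i t \<in> e i"
     "\<forall>t v. card {i\<in>K. alive s f i t \<and> r i t = v} \<le> d" "card (switches K s f r) \<le> b * card K"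
    unfolding orientable_def by blast
  let ?o = "\<lambda>i. if i \<in> J then p i else r i"
  have 1: "\<forall>i\<in>J \<union> K. \<forall>t. ?o i t \<in> e i" using p(1) r(1) by auto
  have 2: "card {i\<in>J \<union> K. alive s f i t \<and> ?o i t = v} \<le> c + d" for t v
  proof -
    have "{i\<in>J \<union> K. alive s f i t \<and> ?o i t = v} \<subseteq>
       {i\<in>J. alive s f i t \<and> p i t = v} \<union> {i\<in>K. alive s f i t \<and> r i t = v}"
      by (auto split: if_splits)
    then have "card {i\<in>J \<union> K. alive s f i t \<and> ?o i t = v} \<le>
       card ({i\<in>J. alive s f i t \<and> p i t = v} \<union> {i\<in>K. alive s f i t \<and> r i t = v})"
      using fin by (intro card_mono) auto
    also have "\<dots> \<le> card {i\<in>J. alive s f i t \<and> p i t = v} + card {i\<in>K. alive s f i t \<and> r i t = v}"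
      by (rule card_Un_le)
    also have "\<dots> \<le> c + d" using p(2) r(2) by (intro add_mono) auto
    finally show ?thesis .
  qed
  have "switches (J \<union> K) s f ?o \<subseteq> switches J s f p \<union> switches K s f r"
    by (auto simp: switches_def split: if_splits)
  then have "card (switches (J \<union> K) s f ?o) \<le> card (switches J s f p \<union> switches K s f r)"
    using fin by (intro card_mono) (auto intro: finite_switches)
  also have "\<dots> \<le> card (switches J s f p) + card (switches K s f r)" by (rule card_Un_le)
  also have "\<dots> \<le> b * card (J \<union> K)"
    using p(3) r(3) fin disj by (simp add: card_Un_disjoint distrib_left)
  finally have 3: "card (switches (J \<union> K) s f ?o) \<le> b * card (J \<union> K)" .
  show ?thesis unfolding orientable_def by (intro exI[of _ ?o] conjI allI 1 2 3)
qed

text \<open>At time \<open>t\<close> only the class with key \<open>g t\<close> is alive. Classes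
  are separated in time and their out-degrees do not add; this joins the intervals of one
  level.\<close>

lemma orientable_UN:
  assumes fin: "finite I"
    and key: "\<And>i t. i \<in> I \<Longrightarrow> alive s f i t \<Longrightarrow> key i = g t"
    and part: "\<And>q. orientable {i\<in>I. key i = q} e s f c b"
  shows "orientable I e s f c b"
proof -
  have "\<exists>p. \<forall>q. (\<forall>i\<in>{i\<in>I. key i = q}. \<forall>t. p q i t \<in> e i) \<and>
     (\<forall>t v. card {i\<in>{i\<in>I. key i = q}. alive s f i t \<and> p q i t = v} \<le> c) \<and>
     card (switches {i\<in>I. key i = q} s f (p q)) \<le> b * card {i\<in>I. key i = q}"
    using part unfolding orientable_def by (intro choice allI)
  then obtain p where p0: "\<forall>q. (\<forall>i\<in>{i\<in>I. key i = q}. \<forall>t. p q i t \<in> e i) \<and>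
     (\<forall>t v. card {i\<in>{i\<in>I. key i = q}. alive s f i t \<and> p q i t = v} \<le> c) \<and>
     card (switches {i\<in>I. key i = q} s f (p q)) \<le> b * card {i\<in>I. key i = q}"
    by (elim exE)
  have p: "\<forall>i\<in>{i\<in>I. key i = q}. \<forall>t. p q i t \<in> e i"
     "\<forall>t v. card {i\<in>{i\<in>I. key i = q}. alive s f i t \<and> p q i t = v} \<le> c"
     "card (switches {i\<in>I. key i = q} s f (p q)) \<le> b * card {i\<in>I. key i = q}" for q
    using spec[OF p0, of q] by - (elim conjE, assumption)+
  let ?o = "\<lambda>i. p (key i) i"
  have 1: "\<forall>i\<in>I. \<forall>t. ?o i t \<in> e i" using p(1) by auto
  have 2: "card {i\<in>I. alive s f i t \<and> ?o i t = v} \<le> c" for t v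
  proof -
    have "{i\<in>I. alive s f i t \<and> ?o i t = v} = {i\<in>{i\<in>I. key i = g t}. alive s f i t \<and> p (g t) i t = v}"
      using key by auto
    then show ?thesis using p(2)[of "g t"] by simp
  qed
  have "switches I s f ?o \<subseteq> (\<Union>q\<in>key ` I. switches {i\<in>I. key i = q} s f (p q))"
    by (auto simp: switches_def)
  then have "card (switches I s f ?o) \<le> card (\<Union>q\<in>key ` I. switches {i\<in>I. key i = q} s f (p q))"
    using fin by (intro card_mono) (auto intro!: finite_switches)
  also have "\<dots> \<le> (\<Sum>q\<in>key ` I. card (switches {i\<in>I. key i = q} s f (p q)))"
    using fin by (intro card_UN_le) auto
  also have "\<dots> \<le> (\<Sum>q\<in>key ` I. b * card {i\<in>I. key i = q})" by (intro sum_mono p(3))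
  also have "\<dots> = b * card I"
    using sum.group[of I "key ` I" key "\<lambda>_. 1::nat"] fin by (simp flip: sum_distrib_left)
  finally have 3: "card (switches I s f ?o) \<le> b * card I" .
  show ?thesis unfolding orientable_def by (intro exI[of _ ?o] conjI allI 1 2 3)
qed

lemma alive_div:
  assumes "alive s f i t" "s i div B = f i div (B::nat)"
  shows "s i div B = t div B"
  using assms div_le_mono[of "s i" t B] div_le_mono[of t "f i" B] by (simp add: alive_def)

lemma orientable_hierarchy:
  fixes e :: "'i \<Rightarrow> nat set"
  assumes "finite I" and "\<And>i. i \<in> I \<Longrightarrow> card (e i) = 2"
    and "\<And>t U. finite U \<Longrightarrow> card {i\<in>I. alive s f i t \<and> e i \<subseteq> U} \<le> a * card U"
    and "\<And>i. i \<in> I \<Longrightarrow> s i \<le> f i \<and> s i div 2 ^ (m * h) = f i div 2 ^ (m * h)"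
  shows "orientable I e s f (4 * a * (h + 1)) (m + 2)"
  using assms
proof (induction h arbitrary: I)
  case 0
  \<comment> \<open>At the bottom the intervals have length 1: each piece lives at a single moment,
    and a static orientation of the pieces of that moment is enough.\<close>
  have sf: "s i = f i" if "i \<in> I" for i using 0(4)[OF that] by simp
  show ?case
  proof (rule orientable_UN[where key = s and g = "\<lambda>t. t"])
    show "finite I" by fact
    show "s i = t" if "i \<in> I" "alive s f i t" for i t using that sf by (force simp: alive_def)
    fix q
    let ?I = "{i\<in>I. s i = q}"
    have d: "card {i\<in>?I. alive (\<lambda>_. 0) (\<lambda>_. 0) i t \<and> e i \<subseteq> U} \<le> a * card U" if "finite U" for t U
    proof -
      have "card {i\<in>?I. alive (\<lambda>_. 0) (\<lambda>_. 0) i t \<and> e i \<subseteq> U} \<le> card {i\<in>I. alive s f i q \<and> e i \<subseteq> U}"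
        using 0(1) sf by (intro card_mono) (auto simp: alive_def)
      also have "\<dots> \<le> a * card U" using 0(3)[OF that] .
      finally show ?thesis .
    qed
    have fin: "finite ?I" using 0(1) by simp
    have e2: "card (e i) = 2" if "i \<in> ?I" for i using 0(2) that by simp
    \<comment> \<open>Giving all pieces the dummy lifetime from 0 to 0 turns the one-level lemma,
      with a single time step, into the existence of a static orientation.\<close>
    have "\<exists>own. (\<forall>i\<in>?I. \<forall>t. own i t \<in> e i) \<and>
        (\<forall>t v. card {i\<in>?I. alive (\<lambda>_. 0) (\<lambda>_. 0) i t \<and> own i t = v} \<le> 2 * a) \<and>
        card (switches ?I (\<lambda>_. 0) (\<lambda>_. 0) own) \<le> (0 + 2) * card ?I"
      by (rule bounded_ownership_one_level[OF fin e2 d]) auto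
    then
    obtain own where o: "\<forall>i\<in>?I. \<forall>t. own i t \<in> e i"
     "\<forall>t v. card {i\<in>?I. alive (\<lambda>_. 0) (\<lambda>_. 0) i t \<and> own i t = v} \<le> 2 * a" by blast
    let ?o = "\<lambda>i t. own i 0"
    have "card {i\<in>?I. alive s f i t \<and> ?o i t = v} \<le> 4 * a * (0 + 1)" for t v
    proof -
      have "card {i\<in>?I. alive s f i t \<and> ?o i t = v} \<le> card {i\<in>?I. alive (\<lambda>_. 0) (\<lambda>_. 0) i 0 \<and> own i 0 = v}"
        using 0(1) by (intro card_mono) (auto simp: alive_def)
      also have "\<dots> \<le> 2 * a" using o(2) by blast
      finally show ?thesis by simp
    qed
    moreover have "switches ?I s f ?o = {}" by (auto simp: switches_def)
    ultimately show "orientable ?I e s f (4 * a * (0 + 1)) (m + 2)"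
      unfolding orientable_def using o(1) by (intro exI[of _ ?o]) auto
  qed
next
  case (Suc h)
  define B :: nat where "B = 2 ^ (m * h)"
  have B: "0 < B" by (simp add: B_def)
  have BM: "(2::nat) ^ (m * Suc h) = B * 2 ^ m" by (simp add: B_def power_add mult.commute)
  \<comment> \<open>\<open>?J\<close> collects the pieces that cross a border between children of
    this level; \<open>?K\<close> those that fit into a child and are left to the lower
    levels.\<close>
  let ?J = "{i\<in>I. s i div B \<noteq> f i div B}" and ?K = "{i\<in>I. s i div B = f i div B}"
  have d: "card {i\<in>{i\<in>I. P i}. alive s f i t \<and> e i \<subseteq> U} \<le> a * card U" if "finite U" for t U P
  proof -
    have "card {i\<in>{i\<in>I. P i}. alive s f i t \<and> e i \<subseteq> U} \<le> card {i\<in>I. alive s f i t \<and> e i \<subseteq> U}"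
      using Suc.prems(1) by (intro card_mono) auto
    also have "\<dots> \<le> a * card U" using Suc.prems(3)[OF that] .
    finally show ?thesis .
  qed
  have J: "orientable ?J e s f (4 * a) (m + 2)"
  proof (rule orientable_UN[where key = "\<lambda>i. s i div (B * 2 ^ m)" and g = "\<lambda>t. t div (B * 2 ^ m)"])
    show "finite ?J" using Suc.prems(1) by simp
    show "s i div (B * 2 ^ m) = t div (B * 2 ^ m)" if "i \<in> ?J" "alive s f i t" for i t
      using alive_div[OF that(2)] that(1) Suc.prems(4) BM by simp
    fix q
    let ?L = "{i\<in>?J. s i div (B * 2 ^ m) = q}"
    have L: "?L = {i\<in>I. s i div B \<noteq> f i div B \<and> s i div (B * 2 ^ m) = q}" by auto
    show "orientable ?L e s f (4 * a) (m + 2)"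
      unfolding orientable_def
    proof (rule bounded_ownership_crossing)
      show "finite ?L" using Suc.prems(1) by simp
      show "card (e i) = 2" if "i \<in> ?L" for i using that Suc.prems(2) by simp
      show "card {i\<in>?L. alive s f i t \<and> e i \<subseteq> U} \<le> a * card U" if "finite U" for t U
        unfolding L using d[OF that] .
      show "s i \<le> f i \<and> s i div (B * 2 ^ m) = q \<and> f i div (B * 2 ^ m) = q" if "i \<in> ?L" for i
        using that Suc.prems(4)[of i] unfolding BM by auto
      show "s i div B \<noteq> f i div B" if "i \<in> ?L" for i using that by simp
      show "0 < B" by (rule B)
    qed
  qed
  have K: "orientable ?K e s f (4 * a * (h + 1)) (m + 2)"
  proof (rule Suc.IH)
    show "finite ?K" using Suc.prems(1) by simp
    show "card (e i) = 2" if "i \<in> ?K" for i using that Suc.prems(2) by simp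
    show "card {i\<in>?K. alive s f i t \<and> e i \<subseteq> U} \<le> a * card U" if "finite U" for t U
      using d[OF that] .
    show "s i \<le> f i \<and> s i div 2 ^ (m * h) = f i div 2 ^ (m * h)" if "i \<in> ?K" for i
      using that Suc.prems(4)[of i] by (simp add: B_def)
  qed
  have "?J \<union> ?K = I" by auto
  with orientable_Un[OF _ _ _ J K] Suc.prems(1)
  have "orientable I e s f (4 * a + 4 * a * (h + 1)) (m + 2)" by fastforce
  then show ?case by (simp add: algebra_simps)
qed

section \<open>Dynamic graphs, density and runs of edges\<close>

abbreviation graph_at :: "update list \<Rightarrow> nat \<Rightarrow> graph" where
  "graph_at us i \<equiv> graph_after (take i us)"

definition proper_graph :: "nat \<Rightarrow> graph \<Rightarrow> bool" where
  "proper_graph n E \<longleftrightarrow> (\<forall>e\<in>E. \<exists>u v. u < n \<and> v < n \<and> u \<noteq> v \<and> e = {u, v})"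

lemma proper_graphD:
  assumes "proper_graph n E" "{u, v} \<in> E"
  shows "u < n" "v < n" "u \<noteq> v"
  using assms unfolding proper_graph_def by (metis doubleton_eq_iff)+

lemma proper_graph_card2: "proper_graph n E \<Longrightarrow> e \<in> E \<Longrightarrow> card e = 2"
  unfolding proper_graph_def by fastforce

lemma proper_graph_finite:
  assumes "proper_graph n E"
  shows "finite E" "card E \<le> n * n"
proof -
  have sub: "E \<subseteq> (\<lambda>(u, v). {u, v}) ` ({..<n} \<times> {..<n})"
    using assms unfolding proper_graph_def by fastforce
  then show "finite E" by (rule finite_subset) simp
  have "card E \<le> card ({..<n} \<times> {..<n})" using sub by (intro surj_card_le) auto
  then show "card E \<le> n * n" by simp
qed

lemma graph_after_Nil [simp]: "graph_after [] = {}"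
  by (simp add: graph_after_def)

lemma graph_at_Suc: "i < length us \<Longrightarrow> graph_at us (Suc i) = apply_update (graph_at us i) (us ! i)"
  by (simp add: graph_after_def take_Suc_conv_app_nth)

lemma proper_graph_at:
  assumes "arboricity_preserving n \<alpha> us"
  shows "i \<le> length us \<Longrightarrow> proper_graph n (graph_at us i)"
proof (induction i)
  case (Suc i)
  then have "valid_update n (graph_at us i) (us ! i)" "proper_graph n (graph_at us i)"
    using assms by (auto simp: arboricity_preserving_def)
  then show ?case using Suc.prems
    by (cases "us ! i") (auto simp: graph_at_Suc proper_graph_def)
qed (simp add: proper_graph_def)

text \<open>Weakening \<open>card U - 1\<close> to \<open>card U\<close> gives a bound for every
  finite \<open>U\<close>, also for those with fewer than two vertices, which the arboricity leaves
  out.\<close>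

lemma arboricity_density:
  assumes E: "proper_graph n E" and a: "arboricity n E \<le> \<alpha>" and fin: "finite U"
  shows "card {e\<in>E. e \<subseteq> U} \<le> \<alpha> * card U"
proof -
  let ?W = "U \<inter> {..<n}"
  have eq: "{e\<in>E. e \<subseteq> U} = induced_edges E ?W"
    using E unfolding induced_edges_def proper_graph_def by fastforce
  have "card (induced_edges E ?W) \<le> \<alpha> * card ?W"
  proof (cases "2 \<le> card ?W")
    case True
    let ?f = "\<lambda>U. nat \<lceil>real (card (induced_edges E U)) / (real (card U) - 1)\<rceil>"
    have "finite {U. U \<subseteq> {..<n} \<and> 2 \<le> card U}" by (rule finite_subset[of _ "Pow {..<n}"]) auto
    then have "bdd_above (?f ` {U. U \<subseteq> {..<n} \<and> 2 \<le> card U})"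
      by (intro bdd_above_finite finite_imageI)
    then have "?f ?W \<le> arboricity n E"
      unfolding arboricity_def using True by (intro cSUP_upper) auto
    then have "?f ?W \<le> \<alpha>" using a by simp
    then have "real (card (induced_edges E ?W)) / (real (card ?W) - 1) \<le> real \<alpha>" by linarith
    then have "real (card (induced_edges E ?W)) \<le> real \<alpha> * (real (card ?W) - 1)"
      using True by (simp add: divide_le_eq)
    also have "\<dots> \<le> real \<alpha> * real (card ?W)" by (intro mult_left_mono) auto
    finally show ?thesis by (metis of_nat_le_iff of_nat_mult)
  next
    case False
    have "induced_edges E ?W = {}"
    proof (rule ccontr)
      assume "induced_edges E ?W \<noteq> {}"
      then obtain e where e: "e \<in> E" "e \<subseteq> ?W" by (auto simp: induced_edges_def)
      have "card e \<le> card ?W" using e(2) by (intro card_mono) auto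
      then show False using proper_graph_card2[OF E e(1)] False by simp
    qed
    then show ?thesis by simp
  qed
  also have "\<dots> \<le> \<alpha> * card U" using fin by (intro mult_left_mono card_mono) auto
  finally show ?thesis by (simp add: eq)
qed

text \<open>Maximal runs of presence of an edge, cut at the multiples of \<open>B\<close>; a run is named by its
  edge and its first moment.\<close>

definition runs :: "(nat \<Rightarrow> 'e set) \<Rightarrow> nat \<Rightarrow> nat \<Rightarrow> ('e \<times> nat) set" where
  "runs G T B = {(e, s). s \<le> T \<and> e \<in> G s \<and> (B dvd s \<or> e \<notin> G (s - 1))}"

definition run_end :: "(nat \<Rightarrow> 'e set) \<Rightarrow> nat \<Rightarrow> nat \<Rightarrow> 'e \<times> nat \<Rightarrow> nat" where
  "run_end G T B i = Max {f. snd i \<le> f \<and> f \<le> T \<and> f div B = snd i div B \<and> (\<forall>t\<in>{snd i..f}. fst i \<in> G t)}"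

lemma run_end:
  assumes "i \<in> runs G T B"
  shows "snd i \<le> run_end G T B i" "run_end G T B i \<le> T" "run_end G T B i div B = snd i div B"
    "\<And>t. alive snd (run_end G T B) i t \<Longrightarrow> fst i \<in> G t"
    "\<And>f. snd i \<le> f \<Longrightarrow> f \<le> T \<Longrightarrow> f div B = snd i div B \<Longrightarrow> (\<forall>t\<in>{snd i..f}. fst i \<in> G t)
       \<Longrightarrow> f \<le> run_end G T B i"
proof -
  let ?F = "{f. snd i \<le> f \<and> f \<le> T \<and> f div B = snd i div B \<and> (\<forall>t\<in>{snd i..f}. fst i \<in> G t)}"
  have fin: "finite ?F" by (rule finite_subset[of _ "{..T}"]) auto
  moreover have "snd i \<in> ?F" using assms by (auto simp: runs_def)
  ultimately have "Max ?F \<in> ?F" using Max_in by blast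
  then have m: "run_end G T B i \<in> ?F" by (simp only: run_end_def)
  then show "snd i \<le> run_end G T B i" "run_end G T B i \<le> T" "run_end G T B i div B = snd i div B"
    by auto
  show "\<And>t. alive snd (run_end G T B) i t \<Longrightarrow> fst i \<in> G t" using m by (auto simp: alive_def)
  show "\<And>f. snd i \<le> f \<Longrightarrow> f \<le> T \<Longrightarrow> f div B = snd i div B \<Longrightarrow> (\<forall>t\<in>{snd i..f}. fst i \<in> G t)
       \<Longrightarrow> f \<le> run_end G T B i"
    unfolding run_end_def using fin by (intro Max_ge) auto
qed

text \<open>Going back from \<open>t\<close> as long as the edge stays present inside the block of
  \<open>t\<close> leads to the start of a run.\<close>

lemma run_exists:
  assumes "e \<in> G t" "t \<le> T"
  shows "\<exists>s. (e, s) \<in> runs G T B \<and> alive snd (run_end G T B) (e, s) t"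
proof -
  define P where "P s \<longleftrightarrow> s \<le> t \<and> s div B = t div B \<and> (\<forall>r\<in>{s..t}. e \<in> G r)" for s
  define s where "s = (LEAST s. P s)"
  have "P t" using assms by (simp add: P_def)
  then have Ps: "P s" unfolding s_def by (rule LeastI)
  have "B dvd s \<or> e \<notin> G (s - 1)"
  proof (rule ccontr)
    assume c: "\<not> ?thesis"
    \<comment> \<open>Time 0 is a multiple of \<open>B\<close>, so a start that is no multiple has a
      predecessor.\<close>
    then have "s \<noteq> 0" by (auto intro: ccontr)
    then obtain r where r: "s = Suc r" by (cases s) auto
    have "r div B = s div B" using c unfolding r by (metis div_Suc dvd_eq_mod_eq_0)
    moreover have "e \<in> G x" if "x \<in> {r..t}" for x
      using that Ps c r by (cases "x = r") (auto simp: P_def)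
    ultimately have "P r" using Ps r by (auto simp: P_def)
    then have "s \<le> r" unfolding s_def by (rule Least_le)
    then show False using r by simp
  qed
  then have i: "(e, s) \<in> runs G T B" using Ps assms by (auto simp: runs_def P_def)
  moreover have "t \<le> run_end G T B (e, s)"
    using run_end(5)[OF i, of t] Ps assms(2) by (auto simp: P_def)
  ultimately show ?thesis using Ps by (auto simp: alive_def P_def)
qed

text \<open>Of two different runs the later would start strictly inside the earlier one, but there
  the edge was present a moment before and no border of a block is passed.\<close>

lemma run_unique:
  assumes i: "(e, s) \<in> runs G T B" "alive snd (run_end G T B) (e, s) t"
    and j: "(e, s') \<in> runs G T B" "alive snd (run_end G T B) (e, s') t"
  shows "s = s'"
proof -
  have le: "\<not> s < s'" if a: "(e, s) \<in> runs G T B" "alive snd (run_end G T B) (e, s) t"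
    "(e, s') \<in> runs G T B" "alive snd (run_end G T B) (e, s') t" for s s'
  proof
    assume lt: "s < s'"
    have al: "alive snd (run_end G T B) (e, s) r" if "s \<le> r" "r \<le> s'" for r
      using that a(2,4) by (auto simp: alive_def)
    have d: "r div B = s div B" if "s \<le> r" "r \<le> s'" for r
      using alive_div[OF al[OF that], of B] run_end(3)[OF a(1)] by simp
    have "s' div B = (s' - 1) div B" using d[of s'] d[of "s' - 1"] lt by simp
    then have "\<not> B dvd s'"
      using lt div_Suc[of "s' - 1" B] by (auto simp: dvd_eq_mod_eq_0 split: if_splits)
    moreover have "e \<in> G (s' - 1)" using run_end(4)[OF a(1) al, of "s' - 1"] lt by simp
    ultimately show False using a(3) by (auto simp: runs_def)
  qed
  show ?thesis using le[OF i j] le[OF j i] by simp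
qed

lemma card_multiples_le:
  assumes "0 < B" shows "card {s\<in>{1..T}. B dvd s} \<le> T div B"
proof -
  have "{s\<in>{1..T}. B dvd s} \<subseteq> (\<lambda>k. B * k) ` {1..T div B}"
  proof
    fix s assume "s \<in> {s\<in>{1..T}. B dvd s}"
    then obtain k where k: "s = B * k" "1 \<le> s" "s \<le> T" by auto
    then have "k \<le> T div B" using assms by (simp add: less_eq_div_iff_mult_less_eq mult.commute)
    moreover have "1 \<le> k" using k by (cases k) auto
    ultimately show "s \<in> (\<lambda>k. B * k) ` {1..T div B}" using k by auto
  qed
  then have "card {s\<in>{1..T}. B dvd s} \<le> card {1..T div B}" by (intro surj_card_le) auto
  then show ?thesis by simp
qed

text \<open>A start is either a restart at a border or an insertion. At most \<open>B\<close> edges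
  restart at each of at most \<open>T div B\<close> borders, so each kind occurs at most
  \<open>T\<close> times.\<close>

lemma card_runs_le:
  assumes B: "0 < B" and G0: "G 0 = {}" and fin: "\<And>s. s \<le> T \<Longrightarrow> finite (G s) \<and> card (G s) \<le> B"
    and step: "\<And>s. s < T \<Longrightarrow> card (G (Suc s) - G s) \<le> 1"
  shows "finite (runs G T B)" "card (runs G T B) \<le> 2 * T"
proof -
  let ?R = "\<lambda>s. {e\<in>G s. B dvd s \<or> e \<notin> G (s - 1)}"
  have sub: "runs G T B = (\<lambda>(s, e). (e, s)) ` (SIGMA s:{1..T}. ?R s)"
  proof (intro set_eqI iffI)
    fix i assume "i \<in> runs G T B"
    then obtain e s where i: "i = (e, s)" "s \<le> T" "e \<in> ?R s" by (auto simp: runs_def)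
    moreover have "s \<noteq> 0" using i G0 by (auto intro: ccontr)
    ultimately show "i \<in> (\<lambda>(s, e). (e, s)) ` (SIGMA s:{1..T}. ?R s)" by (auto intro!: image_eqI[of _ _ "(s, e)"])
  qed (auto simp: runs_def)
  have f: "finite (SIGMA s:{1..T}. ?R s)" using fin by auto
  then show "finite (runs G T B)" unfolding sub by (rule finite_imageI)
  have "card (?R s) \<le> (if B dvd s then B else 0) + 1" if "s \<in> {1..T}" for s
  proof (cases "B dvd s")
    case True
    then show ?thesis using fin[of s] that by simp
  next
    case False
    then have "?R s = G s - G (s - 1)" by auto
    then have "card (?R s) \<le> 1" using step[of "s - 1"] that
      by (metis One_nat_def Suc_le_lessD Suc_pred atLeastAtMost_iff less_eq_Suc_le)
    then show ?thesis by simp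
  qed
  then have "(\<Sum>s=1..T. card (?R s)) \<le> (\<Sum>s=1..T. (if B dvd s then B else 0) + 1)"
    by (rule sum_mono)
  also have "\<dots> = (\<Sum>s=1..T. if B dvd s then B else 0) + T"
    by (subst sum.distrib) simp
  also have "(\<Sum>s=1..T. if B dvd s then B else 0) = B * card {s\<in>{1..T}. B dvd s}"
    using sum.inter_filter[of "{1..T}" "\<lambda>_. B" "\<lambda>s. B dvd s"] by (simp add: mult.commute)
  also have "B * card {s\<in>{1..T}. B dvd s} + T \<le> B * (T div B) + T"
    by (intro add_mono mult_left_mono card_multiples_le[OF B]) auto
  also have "\<dots> \<le> 2 * T" by simp
  finally have "(\<Sum>s=1..T. card (?R s)) \<le> 2 * T" .
  moreover have "card (runs G T B) \<le> card (SIGMA s:{1..T}. ?R s)"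
    unfolding sub by (rule card_image_le[OF f])
  ultimately show "card (runs G T B) \<le> 2 * T" using fin by (simp add: card_SigmaI)
qed

section \<open>The slowly changing reference orientation\<close>

definition orients :: "graph \<Rightarrow> (nat \<times> nat) set \<Rightarrow> bool" where
  "orients E D \<longleftrightarrow> (\<forall>v w. (v, w) \<in> D \<longrightarrow> {v, w} \<in> E) \<and>
     (\<forall>v w. {v, w} \<in> E \<longrightarrow> ((v, w) \<in> D) \<noteq> ((w, v) \<in> D))"

text \<open>A directed edge disappears from \<open>R\<close> when its run ends or when its owner
  switches. With at most \<open>2 * T\<close> runs and on average at most \<open>m + 2\<close>
  switches per run, this gives \<open>(m + 3) * (2 * T)\<close>.\<close>

lemma slow_orientation:
  assumes ap: "arboricity_preserving n \<alpha> us" and B: "n * n \<le> 2 ^ (m * h)"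
  defines "T \<equiv> length us" and "G \<equiv> graph_at us"
  shows "\<exists>R. (\<forall>t\<le>T. orients (G t) (R t)) \<and> (\<forall>t\<le>T. \<forall>v. card {w. (v, w) \<in> R t} \<le> 4 * \<alpha> * (h + 1)) \<and>
     (\<Sum>t<T. card (R t - R (Suc t))) \<le> (m + 3) * (2 * T)"
proof -
  define B :: nat where "B = 2 ^ (m * h)"
  have pg: "proper_graph n (G t)" if "t \<le> T" for t
    using proper_graph_at[OF ap] that by (simp add: T_def G_def)
  have finG: "finite (G t) \<and> card (G t) \<le> B" if "t \<le> T" for t
    using proper_graph_finite[OF pg[OF that]] B by (simp add: B_def)
  have step: "card (G (Suc t) - G t) \<le> 1" if "t < T" for t
  proof -
    have "G (Suc t) = apply_update (G t) (us ! t)" using that by (simp add: G_def T_def graph_at_Suc)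
    then have "\<exists>e. G (Suc t) - G t \<subseteq> {e}" by (cases "us ! t") auto
    then obtain e where "G (Suc t) - G t \<subseteq> {e}" by blast
    then have "card (G (Suc t) - G t) \<le> card {e}" by (intro card_mono) auto
    then show ?thesis by simp
  qed
  let ?I = "runs G T B" and ?f = "run_end G T B"
  have "0 < B" "G 0 = {}" by (simp_all add: B_def G_def)
  note card_runs = card_runs_le[OF this finG step]
  have fin: "finite ?I" and N: "card ?I \<le> 2 * T" using card_runs by blast+
  have al: "fst i \<in> G t \<and> t \<le> T" if "i \<in> ?I" "alive snd ?f i t" for i t
    using run_end[OF that(1)] that(2) by (auto simp: alive_def)
  have e2: "card (fst i) = 2" if "i \<in> ?I" for i
    using al[OF that, of "snd i"] run_end(1)[OF that] proper_graph_card2[OF pg] by (auto simp: alive_def)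
  \<comment> \<open>Runs alive at the same time belong to different edges, so the density of the
    current graph carries over to them.\<close>
  have dens: "card {i\<in>?I. alive snd ?f i t \<and> fst i \<subseteq> U} \<le> \<alpha> * card U" if U: "finite U" for t U
  proof (cases "t \<le> T")
    case True
    have "inj_on fst {i\<in>?I. alive snd ?f i t \<and> fst i \<subseteq> U}"
    proof (rule inj_onI)
      fix x y assume "x \<in> {i\<in>?I. alive snd ?f i t \<and> fst i \<subseteq> U}" "y \<in> {i\<in>?I. alive snd ?f i t \<and> fst i \<subseteq> U}"
        "fst x = fst y"
      then show "x = y" using run_unique[of "fst x" "snd x" G T B t "snd y"]
        by (cases x; cases y) auto
    qed
    then have "card {i\<in>?I. alive snd ?f i t \<and> fst i \<subseteq> U} = card (fst ` {i\<in>?I. alive snd ?f i t \<and> fst i \<subseteq> U})"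
      by (simp add: card_image)
    also have "\<dots> \<le> card {e\<in>G t. e \<subseteq> U}" using al finG[OF True] by (intro card_mono) auto
    also have "\<dots> \<le> \<alpha> * card U"
      using ap True by (intro arboricity_density[OF pg[OF True] _ U]) (auto simp: arboricity_preserving_def G_def T_def)
    finally show ?thesis .
  next
    case False
    then have "{i\<in>?I. alive snd ?f i t \<and> fst i \<subseteq> U} = {}" using al by blast
    then show ?thesis by (metis card.empty le0)
  qed
  have sf: "snd i \<le> ?f i \<and> snd i div 2 ^ (m * h) = ?f i div 2 ^ (m * h)" if "i \<in> ?I" for i
    using run_end[OF that] by (simp add: B_def)
  from orientable_hierarchy[OF fin e2 dens sf]
  obtain own where own: "\<forall>i\<in>?I. \<forall>t. own i t \<in> fst i"
     "\<forall>t v. card {i\<in>?I. alive snd ?f i t \<and> own i t = v} \<le> 4 * \<alpha> * (h + 1)"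
     "card (switches ?I snd ?f own) \<le> (m + 2) * card ?I"
    unfolding orientable_def by blast
  define R where "R t = {(v, w). \<exists>i\<in>?I. alive snd ?f i t \<and> fst i = {v, w} \<and> own i t = v}" for t
  have two: "v \<noteq> w" if "i \<in> ?I" "fst i = {v, w}" for i v w using e2[OF that(1)] that(2) by auto
  have R1: "orients (G t) (R t)" if "t \<le> T" for t
    unfolding orients_def
  proof (intro conjI allI impI)
    fix v w
    show "{v, w} \<in> G t" if "(v, w) \<in> R t" using that al by (fastforce simp: R_def)
    assume e: "{v, w} \<in> G t"
    then obtain s where s: "({v, w}, s) \<in> ?I" "alive snd ?f ({v, w}, s) t"
      using run_exists[of "{v, w}" G t T B] \<open>t \<le> T\<close> by blast
    have u: "i = ({v, w}, s)" if "i \<in> ?I" "alive snd ?f i t" "fst i = {v, w}" for i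
      using run_unique[of "{v, w}" "snd i" G T B t s] that s by (metis prod.collapse)
    have mem: "(x, y) \<in> R t \<longleftrightarrow> own ({v, w}, s) t = x" if "{x, y} = {v, w}" for x y
    proof
      assume "(x, y) \<in> R t"
      then obtain i where i: "i \<in> ?I" "alive snd ?f i t" "fst i = {x, y}" "own i t = x" by (auto simp: R_def)
      then have "i = ({v, w}, s)" using u that by simp
      then show "own ({v, w}, s) t = x" using i(4) by simp
    next
      assume "own ({v, w}, s) t = x"
      then show "(x, y) \<in> R t" unfolding R_def mem_Collect_eq case_prod_conv
        by (intro bexI[OF _ s(1)] conjI s(2)) (simp_all add: that)
    qed
    have "(v, w) \<in> R t \<longleftrightarrow> own ({v, w}, s) t = v" "(w, v) \<in> R t \<longleftrightarrow> own ({v, w}, s) t = w"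
      by (rule mem, simp add: insert_commute)+
    moreover have "own ({v, w}, s) t \<in> {v, w}" using own(1) s by fastforce
    ultimately show "((v, w) \<in> R t) \<noteq> ((w, v) \<in> R t)" using two[OF s(1)] by auto
  qed
  have R2: "card {w. (v, w) \<in> R t} \<le> 4 * \<alpha> * (h + 1)" for t v
  proof -
    have "{w. (v, w) \<in> R t} \<subseteq> (\<lambda>i. the_elem (fst i - {v})) ` {i\<in>?I. alive snd ?f i t \<and> own i t = v}"
    proof
      fix w assume "w \<in> {w. (v, w) \<in> R t}"
      then obtain i where i: "i \<in> ?I" "alive snd ?f i t" "fst i = {v, w}" "own i t = v" by (auto simp: R_def)
      have "fst i - {v} = {w}" using i(3) two[OF i(1,3)] by auto
      then show "w \<in> (\<lambda>i. the_elem (fst i - {v})) ` {i\<in>?I. alive snd ?f i t \<and> own i t = v}"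
        using i by (intro image_eqI[of _ _ i]) auto
    qed
    then have "card {w. (v, w) \<in> R t} \<le> card {i\<in>?I. alive snd ?f i t \<and> own i t = v}"
      using fin by (intro surj_card_le) auto
    then show ?thesis using own(2) order_trans by blast
  qed
  have R3: "(\<Sum>t<T. card (R t - R (Suc t))) \<le> (m + 3) * (2 * T)"
  proof -
    let ?sw = "switches ?I snd ?f own"
    let ?E = "\<lambda>t. {i\<in>?I. ?f i = t}" and ?S = "\<lambda>t. {i. (i, t) \<in> ?sw}"
    have finsw: "finite ?sw" by (rule finite_switches[OF fin])
    have finS: "finite (?S t)" for t
      by (rule finite_subset[of _ "fst ` ?sw"]) (use finsw in force)+
    have "card (R t - R (Suc t)) \<le> card (?E t) + card (?S t)" for t
    proof -
      have "R t - R (Suc t) \<subseteq> (\<lambda>i. (own i t, the_elem (fst i - {own i t}))) ` (?E t \<union> ?S t)"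
      proof
        fix x assume x: "x \<in> R t - R (Suc t)"
        then have "x \<in> R t" by simp
        then obtain i v w where i: "i \<in> ?I" "alive snd ?f i t" "fst i = {v, w}" "own i t = v" "x = (v, w)"
          unfolding R_def by blast
        have "fst i - {v} = {w}" using i(3) two[OF i(1,3)] by auto
        moreover have "i \<in> ?E t \<union> ?S t"
        proof (cases "?f i = t")
          case False
          then have a: "alive snd ?f i (Suc t)" "t < ?f i" using i(2) by (auto simp: alive_def)
          have "own i (Suc t) \<noteq> v"
          proof
            assume "own i (Suc t) = v"
            then have "x \<in> R (Suc t)" unfolding R_def using i(1,3,5) a(1) by blast
            then show False using x by simp
          qed
          then show ?thesis using a i by (auto simp: switches_def alive_def)
        qed (use i in auto)
        ultimately show "x \<in> (\<lambda>i. (own i t, the_elem (fst i - {own i t}))) ` (?E t \<union> ?S t)"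
          using i by (intro image_eqI[of _ _ i]) auto
      qed
      then have "card (R t - R (Suc t)) \<le> card (?E t \<union> ?S t)"
        using fin finS by (intro surj_card_le) auto
      also have "\<dots> \<le> card (?E t) + card (?S t)" by (rule card_Un_le)
      finally show ?thesis .
    qed
    then have "(\<Sum>t<T. card (R t - R (Suc t))) \<le> (\<Sum>t<T. card (?E t) + card (?S t))"
      by (rule sum_mono)
    also have "\<dots> = (\<Sum>t<T. card (?E t)) + (\<Sum>t<T. card (?S t))" by (rule sum.distrib)
    also have "(\<Sum>t<T. card (?E t)) = card (\<Union>t<T. ?E t)"
      using fin by (subst card_UN_disjoint) auto
    also have "\<dots> \<le> card ?I" using fin by (intro card_mono) auto
    also have "(\<Sum>t<T. card (?S t)) = card (SIGMA t:{..<T}. ?S t)" using finS by (simp add: card_SigmaI)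
    also have "\<dots> \<le> card ?sw"
      by (rule card_inj_on_le[where f = "\<lambda>(t, i). (i, t)"]) (auto simp: finsw inj_on_def)
    finally have "(\<Sum>t<T. card (R t - R (Suc t))) \<le> card ?I + card ?sw" by simp
    also have "\<dots> \<le> card ?I + (m + 2) * card ?I" using own(3) by simp
    also have "\<dots> = (m + 3) * card ?I" by (simp add: algebra_simps)
    also have "\<dots> \<le> (m + 3) * (2 * T)" using N by (rule mult_left_mono) simp
    finally show ?thesis .
  qed
  show ?thesis using R1 R2 R3 by (intro exI[of _ R] conjI allI impI)
qed

section \<open>Flushing and its amortised cost\<close>

definition outs :: "(nat \<times> nat) set \<Rightarrow> nat \<Rightarrow> nat set" where
  "outs D v = {w. (v, w) \<in> D}"

definition flush :: "nat \<Rightarrow> (nat \<times> nat) set \<Rightarrow> (nat \<times> nat) set" where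
  "flush z D = {(v, w). (v, w) \<in> D \<and> v \<noteq> z \<or> w = z \<and> (z, v) \<in> D}"

lemma orients_edge: "orients E D \<Longrightarrow> (v, w) \<in> D \<Longrightarrow> {v, w} \<in> E"
  by (auto simp: orients_def)

lemma orients_asym: "orients E D \<Longrightarrow> (v, w) \<in> D \<Longrightarrow> (w, v) \<notin> D"
  by (auto simp: orients_def)

lemma orients_cases: "orients E D \<Longrightarrow> {v, w} \<in> E \<Longrightarrow> (v, w) \<in> D \<or> (w, v) \<in> D"
  by (auto simp: orients_def)

lemma orients_irrefl: "orients E D \<Longrightarrow> (v, v) \<notin> D"
  using orients_asym by blast

lemma mem_flush:
  assumes "orients E D"
  shows "(v, w) \<in> flush z D \<longleftrightarrow> (if w = z then (v, z) \<in> D \<or> (z, v) \<in> D else v \<noteq> z \<and> (v, w) \<in> D)"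
  using orients_irrefl[OF assms, of z] by (auto simp: flush_def)

lemma orients_flush:
  assumes D: "orients E D"
  shows "orients E (flush z D)"
  unfolding orients_def
proof (intro conjI allI impI)
  fix v w
  show "{v, w} \<in> E" if "(v, w) \<in> flush z D"
    using that orients_edge[OF D] unfolding mem_flush[OF D]
    by (metis insert_commute)
  assume "{v, w} \<in> E"
  then have "((v, w) \<in> D) \<noteq> ((w, v) \<in> D)" using D by (simp add: orients_def)
  moreover have "v \<noteq> w" using calculation by auto
  ultimately show "((v, w) \<in> flush z D) \<noteq> ((w, v) \<in> flush z D)"
    unfolding mem_flush[OF D] by metis
qed

lemma outs_flush: "orients E D \<Longrightarrow> outs (flush z D) z = {}"
  using orients_irrefl[of E D z] by (simp add: outs_def mem_flush)

lemma orients_finite: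
  assumes "proper_graph n E" "orients E D"
  shows "finite D" "D \<subseteq> {..<n} \<times> {..<n}"
proof -
  show "D \<subseteq> {..<n} \<times> {..<n}"
    using orients_edge[OF assms(2)] proper_graphD[OF assms(1)] by fastforce
  then show "finite D" by (rule finite_subset) simp
qed

text \<open>Of the out-edges of \<open>z\<close>, those on which \<open>D\<close> agrees with
  \<open>R\<close>, at most \<open>d\<close>, become disagreements; all others become agreements. So
  the disagreements drop by at least the out-degree minus \<open>2 * d\<close>.\<close>

lemma flush_potential:
  assumes "finite D" "orients E D" "orients E R" "finite R" "card (outs R z) \<le> d"
  shows "card (flush z D - R) + card (outs D z) \<le> card (D - R) + 2 * d"
proof -
  let ?O = "outs D z" and ?rest = "{(v, w). (v, w) \<in> D \<and> v \<noteq> z \<and> (v, w) \<notin> R}"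
  let ?A = "{w\<in>?O. (z, w) \<in> R}"
  have fO: "finite ?O"
    by (rule finite_subset[of _ "snd ` D"]) (use assms(1) in \<open>force simp: outs_def\<close>)+
  have fr: "finite ?rest" by (rule finite_subset[OF _ assms(1)]) auto
  have "flush z D - R \<subseteq> ?rest \<union> (\<lambda>w. (w, z)) ` ?A"
  proof
    fix p assume p: "p \<in> flush z D - R"
    obtain v w where vw: "p = (v, w)" by (cases p)
    show "p \<in> ?rest \<union> (\<lambda>w. (w, z)) ` ?A"
    proof (cases "(v, w) \<in> D \<and> v \<noteq> z")
      case True
      then show ?thesis using p vw by auto
    next
      case False
      then have w: "w = z" "(z, v) \<in> D" using p vw by (auto simp: flush_def)
      \<comment> \<open>A reversed edge that disagrees with \<open>R\<close> must have agreed
        before.\<close>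
      then have "(z, v) \<in> R" using p vw orients_edge[OF assms(2) w(2)] orients_cases[OF assms(3)] by blast
      then show ?thesis using w vw by (auto simp: outs_def)
    qed
  qed
  then have "card (flush z D - R) \<le> card (?rest \<union> (\<lambda>w. (w, z)) ` ?A)"
    using fr fO by (intro card_mono) auto
  also have "\<dots> \<le> card ?rest + card ((\<lambda>w. (w, z)) ` ?A)" by (rule card_Un_le)
  also have "\<dots> \<le> card ?rest + card ?A" using fO by (intro add_mono card_image_le) auto
  finally have 1: "card (flush z D - R) \<le> card ?rest + card ?A" .
  have "D - R = ?rest \<union> Pair z ` (?O - ?A)" by (auto simp: outs_def)
  moreover have "?rest \<inter> Pair z ` (?O - ?A) = {}" by auto
  ultimately have 2: "card (D - R) = card ?rest + card (?O - ?A)"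
    using fr fO by (simp add: card_Un_disjoint card_image inj_on_def)
  have "?A \<subseteq> ?O" "finite ?A" using fO by auto
  then have "card ?O = card ?A + card (?O - ?A)"
    using card_Diff_subset[of ?A ?O] card_mono[OF fO, of ?A] by linarith
  moreover have "card ?A \<le> d"
  proof -
    have "finite (outs R z)"
      by (rule finite_subset[of _ "snd ` R"]) (use assms(4) in \<open>force simp: outs_def\<close>)+
    then have "card ?A \<le> card (outs R z)" by (intro card_mono) (auto simp: outs_def)
    with assms(5) show ?thesis by simp
  qed
  ultimately show ?thesis using 1 2 by linarith
qed

section \<open>Amortisation against a reference orientation\<close>

text \<open>The cost of one update with potential \<open>K * card (D - R)\<close>; the change of the
  reference is charged to \<open>card (R - R')\<close>. The algorithm does not know
  \<open>R\<close>, hence the quantification. The term \<open>16 * (d + 1)\<close> leaves room for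
  six flushes at \<open>2 * d\<close> each and for the changed edge.\<close>

definition amortised :: "nat \<Rightarrow> graph \<Rightarrow> graph \<Rightarrow> (nat \<times> nat) set \<Rightarrow> (nat \<times> nat) set \<Rightarrow> nat \<Rightarrow> bool" where
  "amortised K E E' D D' c \<longleftrightarrow> (\<forall>R R' d. orients E R \<longrightarrow> orients E' R' \<longrightarrow>
     (\<forall>v. card (outs R v) \<le> d) \<longrightarrow> (\<forall>v. card (outs R' v) \<le> d) \<longrightarrow>
     c + K * card (D' - R') \<le> K * (card (D - R) + card (R - R') + 16 * (d + 1)))"

lemma amortised_total:
  assumes ap: "arboricity_preserving n \<alpha> us"
    and D: "\<And>i. i \<le> length us \<Longrightarrow> orients (graph_at us i) (D i)"
    and am: "\<And>i. i < length us \<Longrightarrow>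
      amortised K (graph_at us i) (graph_at us (Suc i)) (D i) (D (Suc i)) (c i)"
  shows "real (\<Sum>i<length us. c i)
    \<le> real (200 * K) * (real \<alpha> + sqrt (real \<alpha> * log 2 (real n))) * real (length us)"
proof (cases "length us = 0")
  case False
  let ?T = "length us" and ?G = "graph_at us"
  define L where "L = log 2 (real n)"
  define S where "S = sqrt (real \<alpha> * L)"
  \<comment> \<open>A nonempty sequence starts with an insertion, so \<open>n \<ge> 2\<close> and
    \<open>\<alpha> \<ge> 1\<close>. This allows additive constants to be absorbed by
    \<open>\<alpha> + S\<close>.\<close>
  have "valid_update n (?G 0) (us ! 0)"
    using ap False by (auto simp: arboricity_preserving_def)
  then obtain u v where uv: "us ! 0 = Insert u v" "u < n" "v < n" "u \<noteq> v"
    by (cases "us ! 0") auto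
  have n: "2 \<le> n" using uv by linarith
  have "?G 1 = {{u, v}}" using graph_at_Suc[of 0 us] False uv by simp
  moreover have T1: "1 \<le> ?T" using False by linarith
  then have "arboricity n (?G 1) \<le> \<alpha>" using ap unfolding arboricity_preserving_def by blast
  ultimately have "card {e\<in>{{u, v}}. e \<subseteq> {u, v}} \<le> \<alpha> * card {u, v}"
    using arboricity_density[OF proper_graph_at[OF ap T1], of \<alpha> "{u, v}"] by (simp del: One_nat_def)
  moreover have "{e\<in>{{u, v}}. e \<subseteq> {u, v}} = {{u, v}}" by auto
  ultimately have \<alpha>: "1 \<le> \<alpha>" by (cases \<alpha>) auto
  have L: "1 \<le> L" using n by (simp add: L_def le_log_iff)
  have S: "1 \<le> S" using \<alpha> L unfolding S_def
    by (metis mult_mono' mult_1 of_nat_1 of_nat_le_iff real_sqrt_ge_1_iff zero_le_one)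
  have SS: "S * S = real \<alpha> * L" using L unfolding S_def by simp
  \<comment> \<open>With \<open>m * h\<close> at least \<open>2 * L\<close>, the block length
    \<open>2 ^ (m * h)\<close> reaches \<open>n * n\<close>. As \<open>m\<close> is about
    \<open>S\<close>, the product \<open>\<alpha> * h\<close> is at most
    \<open>2 * S * S / m + \<alpha>\<close> and hence at most
    \<open>2 * S + \<alpha>\<close>.\<close>
  define m where "m = nat \<lceil>S\<rceil>"
  define h where "h = nat \<lceil>2 * L / m\<rceil>"
  have m: "S \<le> real m" "real m \<le> S + 1" using S unfolding m_def by linarith+
  have m0: "0 < real m" using m S by linarith
  have h: "2 * L / m \<le> real h" "real h \<le> 2 * L / m + 1"
    using L m0 unfolding h_def by (simp_all add: of_nat_ceiling)
  have "2 * L \<le> real m * real h" using h(1) m0 by (simp add: field_simps)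
  have "2 powr L = real n" using n unfolding L_def by (intro powr_log_cancel) auto
  then have "real (n * n) = 2 powr (2 * L)"
    by (simp only: mult_2 powr_add of_nat_mult)
  also have "\<dots> \<le> 2 powr (real m * real h)" using \<open>2 * L \<le> real m * real h\<close> by simp
  also have "\<dots> = real (2 ^ (m * h))" using powr_realpow[of 2 "m * h"] by simp
  finally have "n * n \<le> 2 ^ (m * h)" by linarith
  from slow_orientation[OF ap this]
  obtain R where R: "\<forall>t\<le>?T. orients (?G t) (R t)"
     "\<forall>t\<le>?T. \<forall>v. card {w. (v, w) \<in> R t} \<le> 4 * \<alpha> * (h + 1)"
     "(\<Sum>t<?T. card (R t - R (Suc t))) \<le> (m + 3) * (2 * ?T)" by blast
  let ?d = "4 * \<alpha> * (h + 1)"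
  have step: "c i + K * card (D (Suc i) - R (Suc i)) \<le> K * (card (D i - R i) + card (R i - R (Suc i)) + 16 * (?d + 1))"
    if "i < ?T" for i
    by (rule am[OF that, unfolded amortised_def outs_def, rule_format]) (use R(1,2) that in auto)
  \<comment> \<open>The potential telescopes; it is 0 at the beginning because the graph is
    empty.\<close>
  have "j \<le> ?T \<Longrightarrow> (\<Sum>i<j. c i) + K * card (D j - R j)
      \<le> K * (card (D 0 - R 0) + (\<Sum>i<j. card (R i - R (Suc i))) + j * (16 * (?d + 1)))" for j
  proof (induction j)
    case (Suc j)
    have "(\<Sum>i<j. c i) + K * card (D j - R j)
      \<le> K * (card (D 0 - R 0) + (\<Sum>i<j. card (R i - R (Suc i))) + j * (16 * (?d + 1)))"
      using Suc by simp
    moreover have "c j + K * card (D (Suc j) - R (Suc j))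
      \<le> K * card (D j - R j) + K * (card (R j - R (Suc j)) + 16 * (?d + 1))"
      using step[of j] Suc.prems by (simp only: distrib_left) linarith
    ultimately have "(\<Sum>i<Suc j. c i) + K * card (D (Suc j) - R (Suc j))
      \<le> K * (card (D 0 - R 0) + (\<Sum>i<j. card (R i - R (Suc i))) + j * (16 * (?d + 1)))
        + K * (card (R j - R (Suc j)) + 16 * (?d + 1))" by simp
    also have "\<dots> = K * (card (D 0 - R 0) + (\<Sum>i<Suc j. card (R i - R (Suc i))) + Suc j * (16 * (?d + 1)))"
      by (simp add: algebra_simps)
    finally show ?case .
  qed simp
  from this[of ?T] have "(\<Sum>i<?T. c i)
      \<le> K * (card (D 0 - R 0) + (\<Sum>i<?T. card (R i - R (Suc i))) + ?T * (16 * (?d + 1)))" by simp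
  also have "D 0 = {}" using D[of 0] by (auto simp: orients_def)
  then have "card (D 0 - R 0) = 0" by simp
  also have "K * (0 + (\<Sum>i<?T. card (R i - R (Suc i))) + ?T * (16 * (?d + 1)))
      \<le> K * (0 + (m + 3) * (2 * ?T) + ?T * (16 * (?d + 1)))"
    using R(3) by (intro mult_left_mono add_mono) auto
  also have "\<dots> = K * (2 * m + 64 * (\<alpha> * h) + 64 * \<alpha> + 22) * ?T" by (simp add: algebra_simps)
  finally have "real (\<Sum>i<?T. c i) \<le> real (K * (2 * m + 64 * (\<alpha> * h) + 64 * \<alpha> + 22) * ?T)"
    by (rule of_nat_mono)
  also have "\<dots> = real K * (2 * real m + 64 * (real \<alpha> * real h) + 64 * real \<alpha> + 22) * real ?T" by simp
  also have "\<dots> \<le> real K * (200 * (real \<alpha> + S)) * real ?T"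
  proof (intro mult_left_mono mult_right_mono)
    have "real \<alpha> * real h \<le> real \<alpha> * (2 * L / m + 1)" using h(2) by (intro mult_left_mono) auto
    also have "\<dots> = 2 * (S * S) / m + real \<alpha>" by (simp add: SS algebra_simps)
    also have "\<dots> \<le> 2 * S + real \<alpha>"
    proof -
      have "S * S \<le> S * real m" using m(1) S by (intro mult_left_mono) auto
      then show ?thesis using m0 by (simp add: divide_le_eq)
    qed
    finally show "2 * real m + 64 * (real \<alpha> * real h) + 64 * real \<alpha> + 22 \<le> 200 * (real \<alpha> + S)"
      using m(2) S \<alpha> by simp
  qed auto
  finally show ?thesis by (simp add: S_def L_def algebra_simps)
qed simp

section \<open>Matchings given by mate pointers\<close>

definition mutual :: "nat \<Rightarrow> graph \<Rightarrow> (nat \<Rightarrow> nat) \<Rightarrow> bool" where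
  "mutual n E m \<longleftrightarrow> (\<forall>v<n. \<forall>w. m v = Suc w \<longrightarrow> {v, w} \<in> E \<and> m w = Suc v)"

text \<open>Edges at \<open>S\<close>, the vertices still to be settled, are exempt; with
  \<open>S\<close> empty this is maximality.\<close>

definition saturated :: "graph \<Rightarrow> nat set \<Rightarrow> (nat \<Rightarrow> nat) \<Rightarrow> bool" where
  "saturated E S m \<longleftrightarrow> (\<forall>x y. {x, y} \<in> E \<longrightarrow> x \<in> S \<or> y \<in> S \<or> m x \<noteq> 0 \<or> m y \<noteq> 0)"

lemma outputs_maximal_matching_mutual:
  assumes E: "proper_graph n E" and m: "mutual n E m" and s: "saturated E {} m"
  shows "outputs_maximal_matching n E (\<lambda>v. case m v of 0 \<Rightarrow> None | Suc w \<Rightarrow> Some w)"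
proof -
  define M where "M = {{v, w} | v w. v < n \<and> m v = Suc w}"
  have memI: "{v, w} \<in> M" if "v < n" "m v = Suc w" for v w using that unfolding M_def by blast
  have memE: "\<exists>a b. e = {a, b} \<and> a < n \<and> m a = Suc b" if "e \<in> M" for e
    using that unfolding M_def by blast
  have iff: "{v, w} \<in> M \<longleftrightarrow> m v = Suc w" if "v < n" for v w
  proof
    assume "{v, w} \<in> M"
    then obtain a b where ab: "{v, w} = {a, b}" "a < n" "m a = Suc b" using memE by blast
    then have "m b = Suc a" using m unfolding mutual_def by blast
    then show "m v = Suc w" using ab unfolding doubleton_eq_iff by blast
  qed (rule memI[OF that])
  have sub: "M \<subseteq> E"
  proof
    fix e assume "e \<in> M"
    then obtain a b where "e = {a, b}" "a < n" "m a = Suc b" using memE by blast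
    then show "e \<in> E" using m unfolding mutual_def by blast
  qed
  have cover: "\<exists>f\<in>M. x \<in> f" if x: "m x \<noteq> 0" "x < n" for x
  proof -
    obtain w where "m x = Suc w" using not0_implies_Suc[OF x(1)] by (elim exE)
    then have "{x, w} \<in> M" using x(2) by (intro memI)
    then show ?thesis by (rule bexI[rotated]) simp
  qed
  have mate: "e = {x, m x - 1}" if "e \<in> M" "x \<in> e" for e x
  proof -
    obtain a b where ab: "e = {a, b}" "a < n" "m a = Suc b" using memE[OF \<open>e \<in> M\<close>] by blast
    then have "m b = Suc a" using m unfolding mutual_def by blast
    then show ?thesis using ab(1,3) that(2) by (cases "x = a") (simp_all add: insert_commute)
  qed
  have "disjoint M"
  proof (rule disjointI)
    fix e f assume ef: "e \<in> M" "f \<in> M" "e \<noteq> f"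
    show "e \<inter> f = {}"
    proof (rule ccontr)
      assume "e \<inter> f \<noteq> {}"
      then obtain x where "x \<in> e" "x \<in> f" by blast
      then have "e = f" using mate[OF ef(1)] mate[OF ef(2)] by metis
      then show False using ef(3) by simp
    qed
  qed
  then have M: "matching E M" unfolding matching_def using sub by simp
  have "\<not> matching E (insert e M)" if e: "e \<in> E" "e \<notin> M" for e
  proof
    assume c: "matching E (insert e M)"
    obtain x y where xy: "e = {x, y}" "x < n" "y < n" using E e(1) unfolding proper_graph_def by blast
    then have "m x \<noteq> 0 \<or> m y \<noteq> 0" using s e(1) unfolding saturated_def by blast
    then obtain z where z: "z \<in> e" "z < n" "m z \<noteq> 0" using xy by (metis insertI1 insertI2)
    then obtain f where "f \<in> M" "z \<in> f" using cover by blast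
    note z(1) this
    then have "e \<inter> f \<noteq> {}" "e \<noteq> f" using e(2) by blast+
    then show False using c \<open>f \<in> M\<close> unfolding matching_def disjoint_def by blast
  qed
  then have mm: "maximal_matching E M" using M unfolding maximal_matching_def by blast
  show ?thesis
    unfolding outputs_maximal_matching_def
  proof (intro exI[of _ M] conjI mm allI impI)
    fix v w assume "v < n"
    then show "(case m v of 0 \<Rightarrow> None | Suc w \<Rightarrow> Some w) = Some w \<longleftrightarrow> {v, w} \<in> M"
      unfolding iff[OF \<open>v < n\<close>] by (simp split: nat.splits)
  qed
qed

text \<open>The effect on orientation and mates of trying to match \<open>z\<close>; \<open>X\<close> collects the new mate and
  \<open>c\<close> counts the reversed edges.\<close>

definition settle_rel :: "graph \<Rightarrow> nat \<Rightarrow> (nat \<times> nat) set \<Rightarrow> (nat \<Rightarrow> nat) \<Rightarrow>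
    (nat \<times> nat) set \<Rightarrow> (nat \<Rightarrow> nat) \<Rightarrow> nat set \<Rightarrow> nat \<Rightarrow> bool" where
  "settle_rel E z D m D' m' X c \<longleftrightarrow>
     X = {} \<and> m' = m \<and> D' = flush z D \<and> c = card (outs D z) \<and> (m z \<noteq> 0 \<or> (\<forall>w. {z, w} \<in> E \<longrightarrow> m w \<noteq> 0)) \<or>
     (\<exists>x. X = {x} \<and> {z, x} \<in> E \<and> m z = 0 \<and> m x = 0 \<and> m' = m(z := Suc x, x := Suc z) \<and>
        D' = flush x (flush z D) \<and> c = card (outs D z) + card (outs (flush z D) x))"

lemma settle_rel_orients: "settle_rel E z D m D' m' X c \<Longrightarrow> orients E D \<Longrightarrow> orients E D'"
  by (auto simp: settle_rel_def intro: orients_flush)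

text \<open>Settling consists of at most two flushes at \<open>2 * d\<close> each.\<close>

lemma settle_rel_potential:
  assumes E: "proper_graph n E" and D: "orients E D" and R: "orients E R" "\<forall>v. card (outs R v) \<le> d"
    and st: "settle_rel E z D m D' m' X c"
  shows "c + card (D' - R) \<le> card (D - R) + 4 * d"
proof -
  have f: "card (flush z D - R) + card (outs D z) \<le> card (D - R) + 2 * d" if "orients E D" for D z
    by (rule flush_potential) (use that R orients_finite[OF E] in auto)
  show ?thesis
    using st unfolding settle_rel_def
  proof (elim disjE exE conjE)
    fix x assume "D' = flush x (flush z D)" "c = card (outs D z) + card (outs (flush z D) x)"
    then show ?thesis using f[OF D, of z] f[OF orients_flush[OF D, of z], of x] by simp
  qed (use f[OF D, of z] in simp_all)
qed

text \<open>Settling takes nobody's mate away, so no covered edge becomes uncovered. It repairs all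
  edges at \<open>z\<close>: afterwards \<open>z\<close> is matched or all its neighbours
  are.\<close>

lemma settle_rel_mates:
  assumes E: "proper_graph n E" and m: "mutual n E m" "saturated E S m"
    and st: "settle_rel E z D m D' m' X c" and z: "z < n"
  shows "mutual n E m'" "saturated E (S - {z}) m'" "\<And>x. m x \<noteq> 0 \<Longrightarrow> m' x = m x"
    "\<And>x. m' x \<noteq> m x \<Longrightarrow> x = z \<or> x \<in> X" "\<And>x. x \<in> X \<Longrightarrow> m x = 0 \<and> m' x \<noteq> 0 \<and> {z, x} \<in> E"
proof -
  show mono: "m' x = m x" if "m x \<noteq> 0" for x
    using st that unfolding settle_rel_def by (elim disjE exE conjE) auto
  show "x = z \<or> x \<in> X" if "m' x \<noteq> m x" for x
    using st that unfolding settle_rel_def by (elim disjE exE conjE) (auto split: if_splits)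
  show "m x = 0 \<and> m' x \<noteq> 0 \<and> {z, x} \<in> E" if "x \<in> X" for x
    using st that unfolding settle_rel_def by (elim disjE exE conjE) auto
  show "mutual n E m'"
    using st unfolding settle_rel_def
  proof (elim disjE exE conjE)
    fix x assume x: "{z, x} \<in> E" "m z = 0" "m x = 0" "m' = m(z := Suc x, x := Suc z)"
    have zx: "z \<noteq> x" using proper_graphD(3)[OF E x(1)] .
    show ?thesis unfolding mutual_def
    proof (intro allI impI)
      fix v w assume v: "v < n" "m' v = Suc w"
      consider "v = z" | "v = x" "v \<noteq> z" | "v \<noteq> z" "v \<noteq> x" by blast
      then show "{v, w} \<in> E \<and> m' w = Suc v"
      proof cases
        case 1
        then have "w = x" using v x(4) zx by simp
        then show ?thesis using 1 x by simp
      next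
        case 2
        then have "w = z" using v x(4) by simp
        then show ?thesis using 2 x zx by (simp add: insert_commute)
      next
        case 3
        then have "m v = Suc w" using v x(4) by simp
        then have e: "{v, w} \<in> E" "m w = Suc v" using m(1) v(1) unfolding mutual_def by blast+
        then have "w \<noteq> z" "w \<noteq> x" using x(2,3) by auto
        then show ?thesis using e x(4) by simp
      qed
    qed
  qed (simp_all only: m(1))
  show "saturated E (S - {z}) m'"
    unfolding saturated_def
  proof (intro allI impI)
    fix x y assume xy: "{x, y} \<in> E"
    have zc: "m' z \<noteq> 0 \<or> (\<forall>w. {z, w} \<in> E \<longrightarrow> m' w \<noteq> 0)"
      using st unfolding settle_rel_def by (elim disjE exE conjE) auto
    from xy m(2) have "x \<in> S \<or> y \<in> S \<or> m x \<noteq> 0 \<or> m y \<noteq> 0" unfolding saturated_def by blast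
    moreover have "m x \<noteq> 0 \<Longrightarrow> m' x \<noteq> 0" "m y \<noteq> 0 \<Longrightarrow> m' y \<noteq> 0" using mono by simp_all
    moreover have "x = z \<Longrightarrow> m' x \<noteq> 0 \<or> m' y \<noteq> 0" "y = z \<Longrightarrow> m' x \<noteq> 0 \<or> m' y \<noteq> 0"
      using zc xy by (auto simp: insert_commute)
    ultimately show "x \<in> S - {z} \<or> y \<in> S - {z} \<or> m' x \<noteq> 0 \<or> m' y \<noteq> 0" by blast
  qed
qed

section \<open>Execution of programs\<close>

definition accessible :: "nat set \<Rightarrow> state \<Rightarrow> nat \<Rightarrow> bool" where
  "accessible L s p \<longleftrightarrow> (\<exists>v\<in>L. owner s p = Some v)"

text \<open>One derivation carries the running time \<open>k\<close>, the invariant \<open>B\<close>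
  at every state and the restriction of all accesses to records owned by \<open>L\<close>. Thus
  time, word size, space and locality are composed together.\<close>

inductive exec :: "(state \<Rightarrow> bool) \<Rightarrow> nat set \<Rightarrow> com \<Rightarrow> state \<Rightarrow> nat \<Rightarrow> state \<Rightarrow> bool" for B L where
  exec_Skip: "B s \<Longrightarrow> exec B L Skip s 0 s"
| exec_step: "c \<noteq> Skip \<Longrightarrow> B s \<Longrightarrow> \<forall>p\<in>accessed c s. accessible L s p \<Longrightarrow> step c s = (c', s1) \<Longrightarrow>
    exec B L c' s1 k s' \<Longrightarrow> exec B L c s (Suc k) s'"

lemma exec_mono: "exec B L c s k s' \<Longrightarrow> L \<subseteq> L' \<Longrightarrow> exec B L' c s k s'"
proof (induction rule: exec.induct)
  case (exec_step c s c' s1 k s')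
  then show ?case by (intro exec.exec_step) (auto simp: accessible_def)
qed (rule exec.exec_Skip)

lemma exec_bound: "exec B L c s k s' \<Longrightarrow> B s \<and> B s'"
  by (induction rule: exec.induct) auto

text \<open>The extra step is the one that discards the finished \<open>Skip\<close>.\<close>

lemma exec_Seq:
  assumes "exec B L c s k s1" "exec B L d s1 k' s2"
  shows "exec B L (Seq c d) s (k + 1 + k') s2"
  using assms
proof (induction rule: exec.induct)
  case (exec_Skip s)
  then show ?case by (auto intro!: exec.exec_step)
next
  case (exec_step c s c' s1 k s')
  have "exec B L (Seq c d) s (Suc (k + 1 + k')) s2"
    by (rule exec.exec_step[OF _ _ _ _ exec_step.IH[OF exec_step.prems]])
      (use exec_step.hyps in auto)
  then show ?case by simp
qed

lemma exec_While_True: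
  assumes "reg s x < reg s y" "B s" "exec B L c s k s1" "exec B L (WhileLess x y c) s1 k' s'"
  shows "exec B L (WhileLess x y c) s (Suc (k + 1 + k')) s'"
  using assms by (intro exec_step[OF _ _ _ _ exec_Seq]) auto

lemma exec_While_False:
  assumes "\<not> reg s x < reg s y" "B s"
  shows "exec B L (WhileLess x y c) s 1 s"
proof -
  have "exec B L (WhileLess x y c) s (Suc 0) s" using assms by (intro exec_step[OF _ _ _ _ exec_Skip]) auto
  then show ?thesis by simp
qed

lemma exec_config_aux:
  "exec B L c s k s' \<Longrightarrow>
     ((\<lambda>(c, t). step c t) ^^ k) (c, s) = (Skip, s') \<and>
     (\<forall>j<k. fst (((\<lambda>(c, t). step c t) ^^ j) (c, s)) \<noteq> Skip \<and>
        (case ((\<lambda>(c, t). step c t) ^^ j) (c, s) of (c, t) \<Rightarrow> \<forall>p\<in>accessed c t. \<exists>v\<in>L. owner t p = Some v)) \<and>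
     (\<forall>j\<le>k. B (snd (((\<lambda>(c, t). step c t) ^^ j) (c, s))))"
proof (induction rule: exec.induct)
  case (exec_step c s c' s1 k s')
  have sh: "((\<lambda>(c, t). step c t) ^^ Suc j) (c, s) = ((\<lambda>(c, t). step c t) ^^ j) (c', s1)" for j
    using exec_step(4) by (simp add: funpow_Suc_right del: funpow.simps)
  show ?case
  proof (intro conjI allI impI)
    show "((\<lambda>(c, t). step c t) ^^ Suc k) (c, s) = (Skip, s')" using exec_step.IH unfolding sh by blast
    fix j
    show "fst (((\<lambda>(c, t). step c t) ^^ j) (c, s)) \<noteq> Skip" if "j < Suc k"
      using that exec_step by (cases j) (auto simp only: sh, auto)
    show "case ((\<lambda>(c, t). step c t) ^^ j) (c, s) of (c, t) \<Rightarrow> \<forall>p\<in>accessed c t. \<exists>v\<in>L. owner t p = Some v"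
      if "j < Suc k"
    proof (cases j)
      case 0
      then show ?thesis using exec_step(3) by (simp add: accessible_def)
    next
      case (Suc i)
      then show ?thesis using that exec_step.IH unfolding Suc sh by simp
    qed
    show "B (snd (((\<lambda>(c, t). step c t) ^^ j) (c, s)))" if "j \<le> Suc k"
    proof (cases j)
      case (Suc i)
      then show ?thesis using that exec_step.IH unfolding Suc sh by simp
    qed (use exec_step(2) in simp)
  qed
qed simp

text \<open>The bridge from derivations to the machine: no command before the end of a derivation is
  \<open>Skip\<close>, so its length is the running time.\<close>

lemma exec_config:
  assumes "exec B L P (s\<lparr>reg := input u\<rparr>) k s'"
  shows "terminates P u s" "time P u s = k" "process P s u = s'"
    "\<forall>j<k. case config P u s j of (c, t) \<Rightarrow> \<forall>p\<in>accessed c t. \<exists>v\<in>L. owner t p = Some v"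
    "\<forall>j\<le>k. B (snd (config P u s j))"
proof -
  note a = exec_config_aux[OF assms, folded config_def]
  then show "terminates P u s" unfolding terminates_def by (intro exI[of _ k]) simp
  show t: "time P u s = k" unfolding time_def
  proof (rule Least_equality)
    show "fst (config P u s k) = Skip" using a by simp
    show "k \<le> j" if "fst (config P u s j) = Skip" for j using a that by (metis not_le)
  qed
  show "process P s u = s'" unfolding process_def t using a by simp
  show "\<forall>j<k. case config P u s j of (c, t) \<Rightarrow> \<forall>p\<in>accessed c t. \<exists>v\<in>L. owner t p = Some v"
  proof (intro allI impI)
    fix j assume "j < k"
    with spec[OF conjunct1[OF conjunct2[OF a]], of j]
    show "case config P u s j of (c, t) \<Rightarrow> \<forall>p\<in>accessed c t. \<exists>v\<in>L. owner t p = Some v"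
      by (elim impE) (assumption, erule conjunct2)
  qed
  show "\<forall>j\<le>k. B (snd (config P u s j))" by (rule conjunct2[OF conjunct2[OF a]])
qed

text \<open>Loop-free commands: final state, time bound, and a condition for the execution to be
  local and within the word and space bounds.\<close>

definition bounded :: "nat \<Rightarrow> nat \<Rightarrow> state \<Rightarrow> bool" where
  "bounded W N s \<longleftrightarrow> (\<forall>x. reg s x \<le> W) \<and> (\<forall>p f. cell s p f \<le> W) \<and>
     finite (dom (owner s)) \<and> card (dom (owner s)) \<le> N"

fun result :: "com \<Rightarrow> state \<Rightarrow> state" where
  "result (Seq c d) s = result d (result c s)"
| "result (IfLess x y c d) s = (if reg s x < reg s y then result c s else result d s)"
| "result c s = snd (step c s)"

fun loop_free :: "com \<Rightarrow> bool" where
  "loop_free (Seq c d) \<longleftrightarrow> loop_free c \<and> loop_free d"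
| "loop_free (IfLess x y c d) \<longleftrightarrow> loop_free c \<and> loop_free d"
| "loop_free (WhileLess x y c) \<longleftrightarrow> False"
| "loop_free _ \<longleftrightarrow> True"

fun max_time :: "com \<Rightarrow> nat" where
  "max_time (Seq c d) = max_time c + 1 + max_time d"
| "max_time (IfLess x y c d) = 1 + max_time c + max_time d"
| "max_time _ = 1"

fun safe :: "nat \<Rightarrow> nat \<Rightarrow> nat set \<Rightarrow> com \<Rightarrow> state \<Rightarrow> bool" where
  "safe W N L (Seq c d) s \<longleftrightarrow> safe W N L c s \<and> safe W N L d (result c s)"
| "safe W N L (IfLess x y c d) s \<longleftrightarrow> (if reg s x < reg s y then safe W N L c s else safe W N L d s)"
| "safe W N L (Const x k) s \<longleftrightarrow> k \<le> W"
| "safe W N L (Add x y z) s \<longleftrightarrow> reg s y + reg s z \<le> W"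
| "safe W N L (Load x p f) s \<longleftrightarrow> accessible L s (reg s p)"
| "safe W N L (Store p f x) s \<longleftrightarrow> accessible L s (reg s p)"
| "safe W N L (Alloc x p) s \<longleftrightarrow> accessible L s (reg s p) \<and> card (dom (owner s)) < N \<and> N \<le> W"
| "safe W N L (Free p) s \<longleftrightarrow> accessible L s (reg s p)"
| "safe W N L _ s \<longleftrightarrow> True"

text \<open>Among the first \<open>card (dom own) + 1\<close> addresses one is free. Hence a bound
  on the number of records also bounds the addresses, and with them the words that hold
  addresses.\<close>

lemma least_free:
  assumes "finite (dom own)"
  shows "own (LEAST a. own a = None) = None" "(LEAST a. own a = None) \<le> card (dom own)"
proof -
  have "\<exists>a\<le>card (dom own). own a = None"
  proof (rule ccontr)
    assume "\<not> ?thesis"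
    then have "{..card (dom own)} \<subseteq> dom own" by auto
    then have "card {..card (dom own)} \<le> card (dom own)" using assms by (rule card_mono[rotated])
    then show False by simp
  qed
  then obtain a where a: "a \<le> card (dom own)" "own a = None" by blast
  show "own (LEAST a. own a = None) = None" by (rule LeastI[of _ a]) (rule a(2))
  show "(LEAST a. own a = None) \<le> card (dom own)"
    using Least_le[of "\<lambda>a. own a = None" a] a by simp
qed

lemma bounded_Alloc:
  assumes "bounded W N s" "card (dom (owner s)) < N" "N \<le> W"
  shows "bounded W N (snd (step (Alloc x p) s))"
proof -
  let ?a = "LEAST a. owner s a = None"
  have fin: "finite (dom (owner s))" using assms by (simp add: bounded_def)
  have a: "?a \<le> W" using least_free[OF fin] assms(2,3) by linarith
  have sub: "dom ((owner s)(?a := owner s (reg s p))) \<subseteq> insert ?a (dom (owner s))"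
    by (auto split: if_splits)
  then have "card (dom ((owner s)(?a := owner s (reg s p)))) \<le> card (insert ?a (dom (owner s)))"
    using fin by (intro card_mono) auto
  also have "\<dots> \<le> Suc (card (dom (owner s)))" using fin by (simp add: card_insert_if)
  finally have c: "card (dom ((owner s)(?a := owner s (reg s p)))) \<le> N" using assms(2) by linarith
  have f: "finite (dom ((owner s)(?a := owner s (reg s p))))"
    using sub fin by (meson finite_insert finite_subset)
  have "snd (step (Alloc x p) s) = s\<lparr>reg := (reg s)(x := ?a), owner := (owner s)(?a := owner s (reg s p)),
      cell := (cell s)(?a := (\<lambda>_. 0))\<rparr>" by (simp add: Let_def)
  then show ?thesis using assms(1) a c f by (simp add: bounded_def)
qed

lemma bounded_Free:
  assumes "bounded W N s"
  shows "bounded W N (snd (step (Free p) s))"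
proof -
  have sub: "dom ((owner s)(reg s p := None)) \<subseteq> dom (owner s)" by auto
  have fin: "finite (dom (owner s))" using assms by (simp add: bounded_def)
  have "card (dom ((owner s)(reg s p := None))) \<le> card (dom (owner s))" by (intro card_mono fin sub)
  then show ?thesis using assms finite_subset[OF sub fin] by (auto simp: bounded_def simp del: dom_fun_upd)
qed

text \<open>Only constants, sums and fresh addresses can exceed the word bound, so only these carry
  a word condition in \<open>safe\<close>; the other commands copy or decrease words.\<close>

lemma exec_result:
  "loop_free c \<Longrightarrow> safe W N L c s \<Longrightarrow> bounded W N s \<Longrightarrow>
     \<exists>k\<le>max_time c. exec (bounded W N) L c s k (result c s)"
proof (induction c arbitrary: s)
  case Skip
  then show ?case by (intro exI[of _ 0]) (auto intro: exec_Skip)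
next
  case (Seq c d)
  then obtain k where k: "k \<le> max_time c" "exec (bounded W N) L c s k (result c s)" by auto
  moreover obtain k' where "k' \<le> max_time d" "exec (bounded W N) L d (result c s) k' (result d (result c s))"
    using Seq exec_bound[OF k(2)] by auto
  ultimately show ?case using exec_Seq[OF k(2)] by (intro exI[of _ "k + 1 + k'"]) simp
next
  case (IfLess x y c d)
  let ?b = "if reg s x < reg s y then c else d"
  obtain k where k: "k \<le> max_time ?b" "exec (bounded W N) L ?b s k (result ?b s)"
    using IfLess by (cases "reg s x < reg s y") auto
  have "exec (bounded W N) L (IfLess x y c d) s (Suc k) (result ?b s)"
    by (rule exec_step[where c' = ?b and ?s1.0 = s]) (use k(2) IfLess.prems in auto)
  then show ?case using k(1) by (intro exI[of _ "Suc k"]) (auto split: if_splits)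
next
  case (WhileLess x y c)
  then show ?case by simp
next
  case (Alloc x p)
  then have b: "bounded W N (snd (step (Alloc x p) s))" by (intro bounded_Alloc) auto
  have "exec (bounded W N) L (Alloc x p) s (Suc 0) (snd (step (Alloc x p) s))"
    by (rule exec_step[OF _ _ _ _ exec_Skip]) (use Alloc b in \<open>auto simp: Let_def\<close>)
  then show ?case by (intro exI[of _ "Suc 0"]) auto
next
  case (Free p)
  then have b: "bounded W N (snd (step (Free p) s))" by (intro bounded_Free) auto
  have "exec (bounded W N) L (Free p) s (Suc 0) (snd (step (Free p) s))"
    by (rule exec_step[OF _ _ _ _ exec_Skip]) (use Free b in auto)
  then show ?case by (intro exI[of _ "Suc 0"]) auto
next
  case (Const x k)
  have "exec (bounded W N) L (Const x k) s (Suc 0) (result (Const x k) s)"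
    by (rule exec_step[OF _ _ _ _ exec_Skip]) (use Const in \<open>auto simp: bounded_def\<close>)
  then show ?case by (intro exI[of _ "Suc 0"]) auto
next
  case (Add x y z)
  have "exec (bounded W N) L (Add x y z) s (Suc 0) (result (Add x y z) s)"
    by (rule exec_step[OF _ _ _ _ exec_Skip]) (use Add in \<open>auto simp: bounded_def\<close>)
  then show ?case by (intro exI[of _ "Suc 0"]) auto
next
  case (Sub x y z)
  have "reg s y - reg s z \<le> W" using Sub.prems(3) by (simp add: bounded_def le_diff_conv trans_le_add1)
  then have "exec (bounded W N) L (Sub x y z) s (Suc 0) (result (Sub x y z) s)"
    by (intro exec_step[OF _ _ _ _ exec_Skip]) (use Sub in \<open>auto simp: bounded_def\<close>)
  then show ?case by (intro exI[of _ "Suc 0"]) auto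
next
  case (Load x p f)
  have "exec (bounded W N) L (Load x p f) s (Suc 0) (result (Load x p f) s)"
    by (rule exec_step[OF _ _ _ _ exec_Skip]) (use Load in \<open>auto simp: bounded_def\<close>)
  then show ?case by (intro exI[of _ "Suc 0"]) auto
next
  case (Store p f x)
  have "exec (bounded W N) L (Store p f x) s (Suc 0) (result (Store p f x) s)"
    by (rule exec_step[OF _ _ _ _ exec_Skip]) (use Store in \<open>auto simp: bounded_def\<close>)
  then show ?case by (intro exI[of _ "Suc 0"]) auto
qed

section \<open>Records and linked lists\<close>

text \<open>The node \<open>a\<close> stands in front of the list and is no entry of it. With a root
  record as this header, changes at the front write to a record like changes elsewhere.\<close>

fun lseg :: "(nat \<Rightarrow> nat) \<Rightarrow> nat \<Rightarrow> nat list \<Rightarrow> bool" where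
  "lseg nx a [] \<longleftrightarrow> nx a = 0"
| "lseg nx a (x # xs) \<longleftrightarrow> nx a = x \<and> lseg nx x xs"

fun dseg :: "(nat \<Rightarrow> nat) \<Rightarrow> (nat \<Rightarrow> nat) \<Rightarrow> nat \<Rightarrow> nat list \<Rightarrow> bool" where
  "dseg nx pv a [] \<longleftrightarrow> nx a = 0"
| "dseg nx pv a (x # xs) \<longleftrightarrow> nx a = x \<and> pv x = a \<and> dseg nx pv x xs"

lemma lseg_frame:
  "lseg nx a xs \<Longrightarrow> nx' b = nx a \<Longrightarrow> (\<And>x. x \<in> set xs \<Longrightarrow> nx' x = nx x) \<Longrightarrow> lseg nx' b xs"
  by (induction xs arbitrary: a b) auto

lemma dseg_frame:
  "dseg nx pv a xs \<Longrightarrow> nx' a = nx a \<Longrightarrow> (\<And>x. x \<in> set xs \<Longrightarrow> nx' x = nx x \<and> pv' x = pv x)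
    \<Longrightarrow> dseg nx' pv' a xs"
  by (induction xs arbitrary: a) auto

lemma dseg_link:
  assumes "dseg nx pv a xs" "r \<notin> set (a # xs)" "a \<notin> set xs" "distinct xs" "0 \<notin> set xs"
  shows "dseg (nx(r := nx a, a := r)) ((if 0 < nx a then pv(nx a := r) else pv)(r := a)) a (r # xs)"
proof (cases xs)
  case Nil
  then show ?thesis using assms by auto
next
  case (Cons x ys)
  then have x: "nx a = x" "0 < x" "dseg nx pv x ys" using assms by auto
  have "dseg (nx(r := nx a, a := r)) ((if 0 < nx a then pv(nx a := r) else pv)(r := a)) x ys"
    by (rule dseg_frame[OF x(3)]) (use assms Cons x in auto)
  then show ?thesis using assms Cons x by auto
qed

text \<open>The predecessor of \<open>t\<close> may be the header, hence \<open>insert a\<close>. In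
  the induction the update cannot touch the link out of \<open>a\<close>, because the predecessor of
  \<open>t\<close> lies further down the list.\<close>

lemma dseg_unlink:
  assumes "dseg nx pv a (xs @ t # ys)" "distinct (a # xs @ t # ys)" "0 \<notin> set ys"
  shows "dseg (nx(pv t := nx t)) (if 0 < nx t then pv(nx t := pv t) else pv) a (xs @ ys) \<and>
    pv t \<in> insert a (set xs) \<and> (nx t = 0 \<or> nx t \<in> set ys)"
  using assms
proof (induction xs arbitrary: a)
  case Nil
  show ?case
  proof (cases ys)
    case Nil
    then show ?thesis using Nil.prems by auto
  next
    case (Cons y zs)
    then have y: "nx t = y" "0 < y" "pv t = a" "dseg nx pv y zs" using Nil.prems by auto
    have "dseg (nx(pv t := nx t)) (if 0 < nx t then pv(nx t := pv t) else pv) y zs"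
      by (rule dseg_frame[OF y(4)]) (use Nil.prems Cons y in auto)
    then show ?thesis using Nil.prems Cons y by (auto simp: fun_upd_def)
  qed
next
  case (Cons x xs)
  let ?nx = "nx(pv t := nx t)" and ?pv = "if 0 < nx t then pv(nx t := pv t) else pv"
  have ih: "dseg ?nx ?pv x (xs @ ys) \<and> pv t \<in> insert x (set xs) \<and> (nx t = 0 \<or> nx t \<in> set ys)"
    by (rule Cons.IH) (use Cons.prems in auto)
  have "pv t \<noteq> a" using ih Cons.prems(2) by auto
  then have 1: "?nx a = x" using Cons.prems(1) by simp
  have "\<not> (0 < nx t \<and> nx t = x)" using ih Cons.prems(2) by auto
  then have 2: "?pv x = a" using Cons.prems(1) by (cases "0 < nx t") simp_all
  have "dseg ?nx ?pv a ((x # xs) @ ys)"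
    unfolding append_Cons dseg.simps by (intro conjI 1 2 conjunct1[OF ih])
  moreover have "pv t \<in> insert a (set (x # xs))" using ih by simp
  ultimately show ?case using ih by (intro conjI) (assumption | simp)+
qed

text \<open>Field \<open>0\<close> of a root record is the output. The records of the out-edges of \<open>v\<close> form a list
  that starts at the root record \<open>v\<close> and is linked by field \<open>1\<close>; those of the edges from free
  in-neighbours form a list starting there, linked by field \<open>2\<close> and backwards by field \<open>3\<close>. The
  record of the edge \<open>{v, u}\<close> at \<open>v\<close> has address \<open>\<rho> v u\<close>; its fields \<open>4\<close> and \<open>5\<close> hold \<open>\<rho> u v\<close>
  and \<open>u\<close>. Address \<open>0\<close> is never that of an edge and ends the lists.\<close>

definition records_of :: "graph \<Rightarrow> (nat \<Rightarrow> nat \<Rightarrow> nat) \<Rightarrow> nat \<Rightarrow> nat set" where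
  "records_of E \<rho> v = insert v (\<rho> v ` {u. {v, u} \<in> E})"

text \<open>The last conjunct excludes leaked records; it turns the number of edges into a space
  bound.\<close>

definition layout :: "nat \<Rightarrow> graph \<Rightarrow> (nat \<Rightarrow> nat \<Rightarrow> nat) \<Rightarrow> (nat \<Rightarrow> nat option) \<Rightarrow> bool" where
  "layout n E \<rho> own \<longleftrightarrow> (\<forall>p<n. own p = Some p) \<and>
     (\<forall>u v. {u, v} \<in> E \<longrightarrow> n \<le> \<rho> u v \<and> own (\<rho> u v) = Some u) \<and>
     (\<forall>u v v'. {u, v} \<in> E \<longrightarrow> {u, v'} \<in> E \<longrightarrow> \<rho> u v = \<rho> u v' \<longrightarrow> v = v') \<and>
     dom own \<subseteq> {..<n} \<union> {\<rho> u v | u v. {u, v} \<in> E}"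

definition twins :: "graph \<Rightarrow> (nat \<Rightarrow> nat \<Rightarrow> nat) \<Rightarrow> (nat \<Rightarrow> nat \<Rightarrow> nat) \<Rightarrow> bool" where
  "twins E \<rho> c \<longleftrightarrow> (\<forall>u v. {u, v} \<in> E \<longrightarrow> c (\<rho> u v) 4 = \<rho> v u \<and> c (\<rho> u v) 5 = v)"

definition olist :: "nat \<Rightarrow> (nat \<Rightarrow> nat \<Rightarrow> nat) \<Rightarrow> (nat \<Rightarrow> nat \<Rightarrow> nat) \<Rightarrow> (nat \<Rightarrow> nat set) \<Rightarrow> bool" where
  "olist n \<rho> c S \<longleftrightarrow> (\<forall>v<n. \<exists>xs. distinct xs \<and> set xs = S v \<and> lseg (\<lambda>p. c p 1) v (map (\<rho> v) xs))"

definition flist :: "nat \<Rightarrow> (nat \<Rightarrow> nat \<Rightarrow> nat) \<Rightarrow> (nat \<Rightarrow> nat \<Rightarrow> nat) \<Rightarrow> (nat \<Rightarrow> nat set) \<Rightarrow> bool" where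
  "flist n \<rho> c S \<longleftrightarrow> (\<forall>v<n. \<exists>xs. distinct xs \<and> set xs = S v \<and>
     dseg (\<lambda>p. c p 2) (\<lambda>p. c p 3) v (map (\<rho> v) xs))"

definition upd :: "(nat \<Rightarrow> nat \<Rightarrow> nat) \<Rightarrow> nat \<Rightarrow> nat \<Rightarrow> nat \<Rightarrow> nat \<Rightarrow> nat \<Rightarrow> nat" where
  "upd c p f x = c(p := (c p)(f := x))"

lemma upd_apply: "upd c p f x q g = (if q = p \<and> g = f then x else c q g)"
  by (simp add: upd_def)

text \<open>This and the next two definitions repeat the writes of the corresponding commands in
  order, so that lists can be reasoned about without the program.\<close>

definition unlink_cells :: "(nat \<Rightarrow> nat \<Rightarrow> nat) \<Rightarrow> nat \<Rightarrow> nat \<Rightarrow> nat \<Rightarrow> nat" where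
  "unlink_cells c t = (let c1 = upd c (c t 3) 2 (c t 2) in if 0 < c t 2 then upd c1 (c t 2) 3 (c t 3) else c1)"

definition link_cells :: "(nat \<Rightarrow> nat \<Rightarrow> nat) \<Rightarrow> nat \<Rightarrow> nat \<Rightarrow> nat \<Rightarrow> nat \<Rightarrow> nat" where
  "link_cells c v r = (let c1 = upd c r 2 (c v 2); c2 = (if 0 < c v 2 then upd c1 (c v 2) 3 r else c1)
     in upd (upd c2 r 3 v) v 2 r)"

definition push_cells :: "(nat \<Rightarrow> nat \<Rightarrow> nat) \<Rightarrow> nat \<Rightarrow> nat \<Rightarrow> nat \<Rightarrow> nat \<Rightarrow> nat" where
  "push_cells c v r = upd (upd c r 1 (c v 1)) v 1 r"

lemma unlink_fields:
  "(\<lambda>p. unlink_cells c t p 2) = (\<lambda>p. c p 2)(c t 3 := c t 2)"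
  "(\<lambda>p. unlink_cells c t p 3) = (if 0 < c t 2 then (\<lambda>p. c p 3)(c t 2 := c t 3) else (\<lambda>p. c p 3))"
  "g \<noteq> 2 \<Longrightarrow> g \<noteq> 3 \<Longrightarrow> unlink_cells c t p g = c p g"
  by (auto simp: unlink_cells_def Let_def upd_apply fun_eq_iff)

lemma link_fields:
  "(\<lambda>p. link_cells c v r p 2) = (\<lambda>p. c p 2)(r := c v 2, v := r)"
  "(\<lambda>p. link_cells c v r p 3) = (if 0 < c v 2 then (\<lambda>p. c p 3)(c v 2 := r) else (\<lambda>p. c p 3))(r := v)"
  "g \<noteq> 2 \<Longrightarrow> g \<noteq> 3 \<Longrightarrow> link_cells c v r p g = c p g"
  by (auto simp: link_cells_def Let_def upd_apply fun_eq_iff)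

lemma push_fields:
  "(\<lambda>p. push_cells c v r p 1) = (\<lambda>p. c p 1)(r := c v 1, v := r)"
  "g \<noteq> 1 \<Longrightarrow> push_cells c v r p g = c p g"
  by (auto simp: push_cells_def upd_apply fun_eq_iff)

lemma layout_owner:
  assumes "layout n E \<rho> own" "v < n" "x \<in> records_of E \<rho> v"
  shows "own x = Some v"
  using assms by (auto simp: layout_def records_of_def)

lemma layout_disjoint:
  assumes "layout n E \<rho> own" "v < n" "v' < n" "v \<noteq> v'" "x \<in> records_of E \<rho> v"
  shows "x \<notin> records_of E \<rho> v'"
proof
  assume "x \<in> records_of E \<rho> v'"
  from layout_owner[OF assms(1,3) this] layout_owner[OF assms(1,2,5)] assms(4) show False by simp
qed

lemma record_in [simp]: "{v, u} \<in> E \<Longrightarrow> \<rho> v u \<in> records_of E \<rho> v" "v \<in> records_of E \<rho> v"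
  by (auto simp: records_of_def)

lemma layout_pos: "layout n E \<rho> own \<Longrightarrow> v < n \<Longrightarrow> {v, u} \<in> E \<Longrightarrow> v < \<rho> v u"
  by (fastforce simp: layout_def)

lemma layout_inj:
  assumes "layout n E \<rho> own" "{u, v} \<in> E" "{u, v'} \<in> E" "\<rho> u v = \<rho> u v'"
  shows "v = v'"
proof -
  have "\<forall>u v v'. {u, v} \<in> E \<longrightarrow> {u, v'} \<in> E \<longrightarrow> \<rho> u v = \<rho> u v' \<longrightarrow> v = v'"
    using assms(1) unfolding layout_def by (elim conjE)
  then show ?thesis using assms(2-4) by simp
qed

lemma layout_distinct:
  assumes "layout n E \<rho> own" "v < n" "\<And>u. u \<in> set xs \<Longrightarrow> {v, u} \<in> E" "distinct xs"
  shows "distinct (v # map (\<rho> v) xs)" "0 \<notin> set (map (\<rho> v) xs)" "set (map (\<rho> v) xs) \<subseteq> records_of E \<rho> v"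
proof -
  have "inj_on (\<rho> v) (set xs)" 
    by (rule inj_onI) (rule layout_inj[OF assms(1) assms(3) assms(3)])
  moreover have lt: "v < \<rho> v u" if "u \<in> set xs" for u
    by (rule layout_pos[OF assms(1,2) assms(3)[OF that]])
  ultimately show "distinct (v # map (\<rho> v) xs)" using assms(4) by (auto simp: distinct_map dest: lt)
  show "0 \<notin> set (map (\<rho> v) xs)" by (auto dest: lt)
  show "set (map (\<rho> v) xs) \<subseteq> records_of E \<rho> v" using assms(3) by auto
qed

section \<open>Lists stored at the vertices\<close>

context
  fixes n E \<rho> own
  assumes lay: "layout n E \<rho> own"
begin

text \<open>A frame rule: records of different vertices have different owners, so writes at
  \<open>v\<close> leave all other lists alone.\<close>

lemma olist_modify:
  assumes S: "olist n \<rho> c S" "\<And>v u. u \<in> S v \<Longrightarrow> {v, u} \<in> E" and v: "v < n"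
    and c': "\<And>p. p \<notin> records_of E \<rho> v \<Longrightarrow> c' p 1 = c p 1"
    and xs: "distinct xs" "set xs = A" "lseg (\<lambda>p. c' p 1) v (map (\<rho> v) xs)"
  shows "olist n \<rho> c' (S(v := A))"
  unfolding olist_def
proof (intro allI impI)
  fix x assume x: "x < n"
  show "\<exists>xs. distinct xs \<and> set xs = (S(v := A)) x \<and> lseg (\<lambda>p. c' p 1) x (map (\<rho> x) xs)"
  proof (cases "x = v")
    case True
    then show ?thesis using xs by (intro exI[of _ xs]) auto
  next
    case False
    from S(1) x obtain ys where ys: "distinct ys" "set ys = S x" "lseg (\<lambda>p. c p 1) x (map (\<rho> x) ys)"
      by (auto simp: olist_def)
    have r: "p \<notin> records_of E \<rho> v" if "p \<in> records_of E \<rho> x" for p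
      using layout_disjoint[OF lay x v False that] .
    have "lseg (\<lambda>p. c' p 1) x (map (\<rho> x) ys)"
      by (rule lseg_frame[OF ys(3)]) (use ys(2) S(2) r c' in auto)
    then show ?thesis using ys False by (intro exI[of _ ys]) auto
  qed
qed

lemma flist_modify:
  assumes S: "flist n \<rho> c S" "\<And>v u. u \<in> S v \<Longrightarrow> {v, u} \<in> E" and v: "v < n"
    and c': "\<And>p. p \<notin> records_of E \<rho> v \<Longrightarrow> c' p 2 = c p 2 \<and> c' p 3 = c p 3"
    and xs: "distinct xs" "set xs = A" "dseg (\<lambda>p. c' p 2) (\<lambda>p. c' p 3) v (map (\<rho> v) xs)"
  shows "flist n \<rho> c' (S(v := A))"
  unfolding flist_def
proof (intro allI impI)
  fix x assume x: "x < n"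
  show "\<exists>xs. distinct xs \<and> set xs = (S(v := A)) x \<and> dseg (\<lambda>p. c' p 2) (\<lambda>p. c' p 3) x (map (\<rho> x) xs)"
  proof (cases "x = v")
    case True
    then show ?thesis using xs by (intro exI[of _ xs]) auto
  next
    case False
    from S(1) x obtain ys where ys: "distinct ys" "set ys = S x"
      "dseg (\<lambda>p. c p 2) (\<lambda>p. c p 3) x (map (\<rho> x) ys)"
      by (auto simp: flist_def)
    have r: "p \<notin> records_of E \<rho> v" if "p \<in> records_of E \<rho> x" for p
      using layout_disjoint[OF lay x v False that] .
    have "dseg (\<lambda>p. c' p 2) (\<lambda>p. c' p 3) x (map (\<rho> x) ys)"
      by (rule dseg_frame[OF ys(3)]) (use ys(2) S(2) r c' in auto)
    then show ?thesis using ys False by (intro exI[of _ ys]) auto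
  qed
qed

lemma olist_empty_iff:
  assumes S: "olist n \<rho> c S" "\<And>v u. u \<in> S v \<Longrightarrow> {v, u} \<in> E" and v: "v < n"
  shows "c v 1 = 0 \<longleftrightarrow> S v = {}"
proof -
  from S(1) v obtain xs where xs: "distinct xs" "set xs = S v" "lseg (\<lambda>p. c p 1) v (map (\<rho> v) xs)"
    by (auto simp: olist_def)
  have "\<And>u. u \<in> set xs \<Longrightarrow> {v, u} \<in> E" using xs(2) S(2) by auto
  note d = layout_distinct[OF lay v this xs(1)]
  show ?thesis using xs d(2) by (cases xs) auto
qed

lemma olist_pop:
  assumes S: "olist n \<rho> c S" "\<And>v u. u \<in> S v \<Longrightarrow> {v, u} \<in> E" and v: "v < n" and ne: "S v \<noteq> {}"
  shows "\<exists>u\<in>S v. c v 1 = \<rho> v u \<and> olist n \<rho> (upd c v 1 (c (\<rho> v u) 1)) (S(v := S v - {u}))"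
proof -
  from S(1) v obtain xs where xs: "distinct xs" "set xs = S v" "lseg (\<lambda>p. c p 1) v (map (\<rho> v) xs)"
    by (auto simp: olist_def)
  have E: "\<And>u. u \<in> set xs \<Longrightarrow> {v, u} \<in> E" using xs(2) S(2) by auto
  note d = layout_distinct[OF lay v this xs(1)]
  from ne xs(2) obtain u ys where u: "xs = u # ys" by (cases xs) auto
  have "olist n \<rho> (upd c v 1 (c (\<rho> v u) 1)) (S(v := S v - {u}))"
  proof (rule olist_modify[OF S v])
    show "distinct ys" "set ys = S v - {u}" using xs u by auto
    have l: "lseg (\<lambda>p. c p 1) (\<rho> v u) (map (\<rho> v) ys)" using xs(3) u by simp
    show "lseg (\<lambda>p. upd c v 1 (c (\<rho> v u) 1) p 1) v (map (\<rho> v) ys)"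
    proof (rule lseg_frame[OF l])
      fix x assume "x \<in> set (map (\<rho> v) ys)"
      then have "x \<noteq> v" using d(1) unfolding u by (auto simp del: set_map)
      then show "upd c v 1 (c (\<rho> v u) 1) x 1 = c x 1" by (simp add: upd_apply)
    qed (simp add: upd_apply)
  qed (auto simp: upd_apply)
  moreover have "u \<in> S v" "c v 1 = \<rho> v u" using xs u by auto
  ultimately show ?thesis by (intro bexI[of _ u]) auto
qed

lemma olist_push:
  assumes S: "olist n \<rho> c S" "\<And>v u. u \<in> S v \<Longrightarrow> {v, u} \<in> E" and v: "v < n"
    and u: "{v, u} \<in> E" "u \<notin> S v"
  shows "olist n \<rho> (push_cells c v (\<rho> v u)) (S(v := insert u (S v)))"
proof -
  from S(1) v obtain xs where xs: "distinct xs" "set xs = S v" "lseg (\<lambda>p. c p 1) v (map (\<rho> v) xs)"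
    by (auto simp: olist_def)
  have E: "\<And>w. w \<in> set (u # xs) \<Longrightarrow> {v, w} \<in> E" using xs(2) S(2) u by auto
  have dx: "distinct (u # xs)" using xs u by auto
  note d = layout_distinct[OF lay v E dx]
  show ?thesis
  proof (rule olist_modify[OF S v _ dx])
    show "set (u # xs) = insert u (S v)" using xs by auto
    have "lseg (\<lambda>p. push_cells c v (\<rho> v u) p 1) (\<rho> v u) (map (\<rho> v) xs)"
    proof (rule lseg_frame[OF xs(3)])
      fix x assume "x \<in> set (map (\<rho> v) xs)"
      then have "x \<noteq> v" "x \<noteq> \<rho> v u" using d(1) by (auto simp del: set_map)
      then show "push_cells c v (\<rho> v u) x 1 = c x 1" by (simp add: push_cells_def upd_apply)
    qed (use d(1) in \<open>simp add: push_cells_def upd_apply\<close>)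
    then show "lseg (\<lambda>p. push_cells c v (\<rho> v u) p 1) v (map (\<rho> v) (u # xs))"
      by (simp add: push_cells_def upd_apply)
    show "push_cells c v (\<rho> v u) p 1 = c p 1" if "p \<notin> records_of E \<rho> v" for p
      using that u(1) by (auto simp: push_cells_def upd_apply records_of_def)
  qed
qed

lemma flist_head:
  assumes S: "flist n \<rho> c S" "\<And>v u. u \<in> S v \<Longrightarrow> {v, u} \<in> E" and v: "v < n"
  shows "if S v = {} then c v 2 = 0 else 0 < c v 2 \<and> (\<exists>u\<in>S v. c v 2 = \<rho> v u)"
proof -
  from S(1) v obtain xs where xs: "distinct xs" "set xs = S v"
    "dseg (\<lambda>p. c p 2) (\<lambda>p. c p 3) v (map (\<rho> v) xs)" by (auto simp: flist_def)
  have E: "\<And>w. w \<in> set xs \<Longrightarrow> {v, w} \<in> E" using xs(2) S(2) by auto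
  note d = layout_distinct[OF lay v E xs(1)]
  show ?thesis using xs d(2) by (cases xs) auto
qed

lemma flist_link:
  assumes S: "flist n \<rho> c S" "\<And>v u. u \<in> S v \<Longrightarrow> {v, u} \<in> E" and v: "v < n"
    and u: "{v, u} \<in> E" "u \<notin> S v"
  shows "flist n \<rho> (link_cells c v (\<rho> v u)) (S(v := insert u (S v)))"
proof -
  from S(1) v obtain xs where xs: "distinct xs" "set xs = S v"
    "dseg (\<lambda>p. c p 2) (\<lambda>p. c p 3) v (map (\<rho> v) xs)" by (auto simp: flist_def)
  have E: "\<And>w. w \<in> set (u # xs) \<Longrightarrow> {v, w} \<in> E" using xs(2) S(2) u by auto
  have dx: "distinct (u # xs)" using xs u by auto
  note d = layout_distinct[OF lay v E dx]
  show ?thesis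
  proof (rule flist_modify[OF S v _ dx])
    show "set (u # xs) = insert u (S v)" using xs by auto
    show "dseg (\<lambda>p. link_cells c v (\<rho> v u) p 2) (\<lambda>p. link_cells c v (\<rho> v u) p 3) v (map (\<rho> v) (u # xs))"
      unfolding link_fields list.map
      by (rule dseg_link[OF xs(3)]) (use d in auto)
    show "link_cells c v (\<rho> v u) p 2 = c p 2 \<and> link_cells c v (\<rho> v u) p 3 = c p 3"
      if "p \<notin> records_of E \<rho> v" for p
    proof -
      have "p \<noteq> v" "p \<noteq> \<rho> v u" using that u(1) by auto
      moreover have "0 < c v 2 \<Longrightarrow> p \<noteq> c v 2"
        using flist_head[OF S v] that S(2) by (auto split: if_splits)
      ultimately show ?thesis by (auto simp: link_cells_def Let_def upd_apply)
    qed
  qed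
qed

text \<open>Besides the new list, the list neighbours of the removed entry are located at
  \<open>v\<close>; the locality of the program rests on this.\<close>

lemma flist_unlink:
  assumes S: "flist n \<rho> c S" "\<And>v u. u \<in> S v \<Longrightarrow> {v, u} \<in> E" and v: "v < n" and u: "u \<in> S v"
  defines "t \<equiv> \<rho> v u"
  shows "flist n \<rho> (unlink_cells c t) (S(v := S v - {u}))"
    "c t 3 \<in> records_of E \<rho> v" "0 < c t 2 \<Longrightarrow> c t 2 \<in> records_of E \<rho> v"
proof -
  from S(1) v obtain xs where xs: "distinct xs" "set xs = S v"
    "dseg (\<lambda>p. c p 2) (\<lambda>p. c p 3) v (map (\<rho> v) xs)" by (auto simp: flist_def)
  have E: "\<And>w. w \<in> set xs \<Longrightarrow> {v, w} \<in> E" using xs(2) S(2) by auto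
  note d = layout_distinct[OF lay v E xs(1)]
  from u xs(2) obtain ys zs where yz: "xs = ys @ u # zs" by (metis split_list)
  have ds: "dseg (\<lambda>p. c p 2) (\<lambda>p. c p 3) v (map (\<rho> v) ys @ t # map (\<rho> v) zs)"
    using xs(3) yz by (simp add: t_def)
  have di: "distinct (v # map (\<rho> v) ys @ t # map (\<rho> v) zs)" using d(1) yz by (simp add: t_def)
  have z: "0 \<notin> set (map (\<rho> v) zs)" using d(2) yz by auto
  note un = dseg_unlink[OF ds di z]
  have sub: "set (map (\<rho> v) ys) \<subseteq> records_of E \<rho> v" "set (map (\<rho> v) zs) \<subseteq> records_of E \<rho> v"
    using d(3) yz by auto
  show p: "c t 3 \<in> records_of E \<rho> v"
    using conjunct1[OF conjunct2[OF un]] sub(1) by (auto simp del: set_map)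
  show q: "c t 2 \<in> records_of E \<rho> v" if "0 < c t 2"
    using conjunct2[OF conjunct2[OF un]] that sub(2) by (auto simp del: set_map)
  show "flist n \<rho> (unlink_cells c t) (S(v := S v - {u}))"
  proof (rule flist_modify[OF S v])
    show "distinct (ys @ zs)" "set (ys @ zs) = S v - {u}" using xs(1,2) yz by auto
    show "dseg (\<lambda>p. unlink_cells c t p 2) (\<lambda>p. unlink_cells c t p 3) v (map (\<rho> v) (ys @ zs))"
      unfolding unlink_fields map_append by (rule conjunct1[OF un])
    show "unlink_cells c t x 2 = c x 2 \<and> unlink_cells c t x 3 = c x 3" if "x \<notin> records_of E \<rho> v" for x
    proof -
      have "x \<noteq> c t 3" "0 < c t 2 \<Longrightarrow> x \<noteq> c t 2" using that p q by auto
      then show ?thesis by (auto simp: unlink_cells_def Let_def upd_apply)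
    qed
  qed
qed

end

section \<open>The heap invariant and the reversal of one edge\<close>

definition frees :: "(nat \<times> nat) set \<Rightarrow> (nat \<Rightarrow> nat) \<Rightarrow> nat \<Rightarrow> nat set" where
  "frees D m v = {w. (w, v) \<in> D \<and> m w = 0}"

definition heap :: "nat \<Rightarrow> graph \<Rightarrow> (nat \<times> nat) set \<Rightarrow> (nat \<Rightarrow> nat) \<Rightarrow> (nat \<Rightarrow> nat \<Rightarrow> nat) \<Rightarrow>
    (nat \<Rightarrow> nat option) \<Rightarrow> (nat \<Rightarrow> nat \<Rightarrow> nat) \<Rightarrow> bool" where
  "heap n E D m \<rho> own c \<longleftrightarrow> proper_graph n E \<and> orients E D \<and> layout n E \<rho> own \<and> twins E \<rho> c \<and>
     olist n \<rho> c (outs D) \<and> flist n \<rho> c (frees D m) \<and> (\<forall>v<n. c v 0 = m v)"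

definition reverse_edge :: "nat \<Rightarrow> nat \<Rightarrow> (nat \<times> nat) set \<Rightarrow> (nat \<times> nat) set" where
  "reverse_edge z w D = insert (w, z) (D - {(z, w)})"

lemma orients_reverse_edge:
  assumes D: "orients E D" and zw: "(z, w) \<in> D"
  shows "orients E (reverse_edge z w D)"
proof -
  have ne: "z \<noteq> w" using zw orients_irrefl[OF D] by auto
  have wz: "(w, z) \<notin> D" by (rule orients_asym[OF D zw])
  have e: "{w, z} \<in> E" using orients_edge[OF D zw] by (simp add: insert_commute)
  show ?thesis unfolding orients_def
  proof (intro conjI allI impI)
    fix v u
    show "{v, u} \<in> E" if "(v, u) \<in> reverse_edge z w D"
      using that e orients_edge[OF D] by (auto simp: reverse_edge_def)
    assume "{v, u} \<in> E"
    then have "((v, u) \<in> D) \<noteq> ((u, v) \<in> D)" using D by (simp add: orients_def)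
    then show "((v, u) \<in> reverse_edge z w D) \<noteq> ((u, v) \<in> reverse_edge z w D)"
      using ne wz zw by (auto simp: reverse_edge_def)
  qed
qed

text \<open>This drives the flush loop: after reversing one out-edge the complete flush still has
  the same result, so the edges can be handled one by one in list order.\<close>

lemma flush_reverse_edge:
  assumes D: "orients E D" and zw: "(z, w) \<in> D"
  shows "flush z (reverse_edge z w D) = flush z D"
  using zw orients_irrefl[OF D, of z] orients_asym[OF D zw]
  by (auto simp: flush_def reverse_edge_def)

lemma flush_no_outs: "outs D z = {} \<Longrightarrow> flush z D = D"
  by (auto simp: flush_def outs_def)

lemma outs_reverse_edge:
  assumes D: "orients E D" and zw: "(z, w) \<in> D"
  shows "outs (reverse_edge z w D) = ((outs D)(z := outs D z - {w}))(w := insert z (outs D w))"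
  using zw orients_irrefl[OF D, of z] by (auto simp: outs_def reverse_edge_def fun_eq_iff)

lemma frees_reverse_edge:
  assumes D: "orients E D" and zw: "(z, w) \<in> D"
  shows "frees (reverse_edge z w D) m =
    (let F = (if m z = 0 then (frees D m)(w := frees D m w - {z}) else frees D m)
     in if m w = 0 then F(z := insert w (F z)) else F)"
  using zw orients_irrefl[OF D, of z] by (auto simp: frees_def reverse_edge_def fun_eq_iff Let_def)

definition flush_cells :: "(nat \<Rightarrow> nat \<Rightarrow> nat) \<Rightarrow> nat \<Rightarrow> nat \<Rightarrow> nat \<Rightarrow> nat \<Rightarrow> nat" where
  "flush_cells c z r = (let t = c r 4; w = c r 5; c1 = upd c z 1 (c r 1); c2 = push_cells c1 w t;
     c3 = (if c2 z 0 = 0 then unlink_cells c2 t else c2)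
     in if c3 w 0 = 0 then link_cells c3 z r else c3)"

text \<open>The additional facts locate the addresses that the loop body dereferences; safety and
  locality are derived from them.\<close>

lemma heap_flush_cells:
  assumes h: "heap n E D m \<rho> own c" and z: "z < n" and ne: "outs D z \<noteq> {}"
  shows "\<exists>w. (z, w) \<in> D \<and> w < n \<and> {z, w} \<in> E \<and> z \<noteq> w \<and> c z 1 = \<rho> z w \<and> c (\<rho> z w) 4 = \<rho> w z \<and> c (\<rho> z w) 5 = w \<and>
    (m z = 0 \<longrightarrow> c (\<rho> w z) 3 \<in> records_of E \<rho> w \<and> (0 < c (\<rho> w z) 2 \<longrightarrow> c (\<rho> w z) 2 \<in> records_of E \<rho> w)) \<and>
    (0 < c z 2 \<longrightarrow> c z 2 \<in> records_of E \<rho> z) \<and>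
    heap n E (reverse_edge z w D) m \<rho> own (flush_cells c z (\<rho> z w))"
proof -
  from h have E: "proper_graph n E" and D: "orients E D" and lay: "layout n E \<rho> own" and tw: "twins E \<rho> c"
    and ol: "olist n \<rho> c (outs D)" and fl: "flist n \<rho> c (frees D m)" and m: "\<forall>v<n. c v 0 = m v"
    unfolding heap_def by blast+
  have oE: "\<And>v u. u \<in> outs D v \<Longrightarrow> {v, u} \<in> E" using orients_edge[OF D] by (simp add: outs_def)
  have fE: "\<And>v u. u \<in> frees D m v \<Longrightarrow> {v, u} \<in> E"
    using orients_edge[OF D] by (fastforce simp: frees_def insert_commute)
  from olist_pop[OF lay ol oE z ne] obtain w where w: "w \<in> outs D z" "c z 1 = \<rho> z w"
    "olist n \<rho> (upd c z 1 (c (\<rho> z w) 1)) ((outs D)(z := outs D z - {w}))" by blast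
  have zw: "(z, w) \<in> D" using w(1) by (simp add: outs_def)
  have e: "{z, w} \<in> E" "{w, z} \<in> E" using orients_edge[OF D zw] by (simp_all add: insert_commute)
  have wn: "w < n" and zne: "z \<noteq> w" using proper_graphD[OF E e(1)] by auto
  let ?t = "\<rho> w z" and ?r = "\<rho> z w"
  have t: "c ?r 4 = ?t" "c ?r 5 = w" using tw e by (auto simp: twins_def)
  let ?c1 = "upd c z 1 (c ?r 1)"
  let ?c2 = "push_cells ?c1 w ?t"
  let ?c3 = "if m z = 0 then unlink_cells ?c2 ?t else ?c2"
  let ?c4 = "if m w = 0 then link_cells ?c3 z ?r else ?c3"
  have c2f: "?c2 p g = c p g" if "g \<noteq> 1" for p g using that by (simp add: push_fields(2) upd_apply)
  have c3f: "?c3 p g = ?c2 p g" if "g \<noteq> 2" "g \<noteq> 3" for p g using that by (simp add: unlink_fields(3))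
  have c4f: "?c4 p g = ?c2 p g" if "g \<noteq> 2" "g \<noteq> 3" for p g using that by (simp add: unlink_fields(3) link_fields(3))
  have mz: "?c2 z 0 = m z" and mw: "?c3 w 0 = m w" using m z wn c2f c3f by simp_all
  have eq: "flush_cells c z ?r = ?c4"
    unfolding flush_cells_def Let_def t using mz mw by simp
  have ol2: "olist n \<rho> ?c2 (outs (reverse_edge z w D))"
  proof -
    have "olist n \<rho> ?c2 (((outs D)(z := outs D z - {w}))(w := insert z (((outs D)(z := outs D z - {w})) w)))"
      by (rule olist_push[OF lay w(3) _ wn e(2)])
        (use oE orients_asym[OF D zw] zne in \<open>auto simp: outs_def split: if_splits\<close>)
    then show ?thesis using zne by (simp add: outs_reverse_edge[OF D zw])
  qed
  have c22: "?c2 p 2 = c p 2" "?c2 p 3 = c p 3" for p by (rule c2f, simp)+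
  have fl2: "flist n \<rho> ?c2 (frees D m)" using fl unfolding flist_def c22 .
  have zin: "z \<in> frees D m w" if "m z = 0" using that zw by (simp add: frees_def)
  \<comment> \<open>A reversal affects two free lists: a free \<open>z\<close> leaves that of
    \<open>w\<close>, and a free \<open>w\<close> enters that of \<open>z\<close>.\<close>
  let ?F3 = "if m z = 0 then (frees D m)(w := frees D m w - {z}) else frees D m"
  have fl3: "flist n \<rho> ?c3 ?F3"
    using flist_unlink(1)[OF lay fl2 fE wn zin] fl2 by simp
  have F3E: "\<And>v u. u \<in> ?F3 v \<Longrightarrow> {v, u} \<in> E" using fE by (auto split: if_splits)
  have "w \<notin> ?F3 z" using orients_asym[OF D zw] by (simp add: frees_def)
  then have fl4: "flist n \<rho> ?c4 (frees (reverse_edge z w D) m)"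
    using flist_link[OF lay fl3 F3E z e(1)] fl3
    by (simp add: frees_reverse_edge[OF D zw] Let_def)
  have ol4: "olist n \<rho> ?c4 (outs (reverse_edge z w D))"
    using ol2 unfolding olist_def by (simp only: c4f)
  have c4: "?c4 p g = c p g" if "g \<notin> {1, 2, 3}" for p g
    using that c4f[of g p] c2f[of g p] by simp
  have c4': "?c4 p 4 = c p 4" "?c4 p 5 = c p 5" "?c4 p 0 = c p 0" for p by (rule c4, simp)+
  have tw4: "twins E \<rho> ?c4" using tw unfolding twins_def c4' .
  have m4: "\<forall>v<n. ?c4 v 0 = m v" using m unfolding c4' .
  have "heap n E (reverse_edge z w D) m \<rho> own ?c4"
    unfolding heap_def by (intro conjI E orients_reverse_edge[OF D zw] lay tw4 ol4 fl4 m4)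
  moreover have "m z = 0 \<longrightarrow> c ?t 3 \<in> records_of E \<rho> w \<and> (0 < c ?t 2 \<longrightarrow> c ?t 2 \<in> records_of E \<rho> w)"
    using flist_unlink(2,3)[OF lay fl fE wn zin] by blast
  moreover have "0 < c z 2 \<longrightarrow> c z 2 \<in> records_of E \<rho> z"
    using flist_head[OF lay fl fE z] fE by (auto split: if_splits)
  ultimately show ?thesis using zw wn e zne w(2) t eq by (intro exI[of _ w]) simp
qed

section \<open>The sequential algorithm\<close>

text \<open>Registers: 0 holds the kind of update, 1 and 2 the endpoints, 3 the constant 0, 4 the
  constant 1. In a flush, 5 is the current edge record, 6 its twin and 7 the neighbour; 8 to 10 are
  scratch. Settling uses 11 for the edge record of the partner, 12 for the partner and 13 for the
  mate to be stored.\<close>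

definition unlink :: "nat \<Rightarrow> com" where
  "unlink T = Seq (Load 8 T 3) (Seq (Load 9 T 2) (Seq (Store 8 2 9) (IfLess 3 9 (Store 9 3 8) Skip)))"

definition link :: "nat \<Rightarrow> nat \<Rightarrow> com" where
  "link Z R = Seq (Load 9 Z 2) (Seq (Store R 2 9) (Seq (IfLess 3 9 (Store 9 3 R) Skip)
     (Seq (Store R 3 Z) (Store Z 2 R))))"

definition if_free :: "nat \<Rightarrow> com \<Rightarrow> com" where
  "if_free Z c = Seq (Load 10 Z 0) (IfLess 3 10 Skip c)"

definition push :: "nat \<Rightarrow> nat \<Rightarrow> com" where
  "push V R = Seq (Load 8 V 1) (Seq (Store R 1 8) (Store V 1 R))"

definition flush_body :: "nat \<Rightarrow> com" where
  "flush_body Z = Seq (Load 6 5 4) (Seq (Load 7 5 5) (Seq (Load 8 5 1) (Seq (Store Z 1 8)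
     (Seq (push 7 6) (Seq (if_free Z (unlink 6)) (Seq (if_free 7 (link Z 5)) (Load 5 Z 1)))))))"

definition flush_com :: "nat \<Rightarrow> com" where
  "flush_com Z = Seq (Load 5 Z 1) (WhileLess 3 5 (flush_body Z))"

text \<open>The mate of \<open>Z\<close> is stored before the partner is flushed: that flush
  reverses the edge between them, after which \<open>Z\<close> has an out-edge again and could not
  change its status silently.\<close>

definition settle_com :: "nat \<Rightarrow> com" where
  "settle_com Z = Seq (flush_com Z) (Seq (Load 10 Z 0) (IfLess 3 10 Skip
     (Seq (Load 11 Z 2) (IfLess 3 11
       (Seq (Load 12 11 5) (Seq (Add 13 12 4) (Seq (Store Z 0 13)
         (Seq (flush_com 12) (Seq (Add 13 Z 4) (Store 12 0 13))))))
       Skip))))"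

section \<open>Effect and safety of the program fragments\<close>

lemma accessible_simps [simp]:
  "accessible L (s\<lparr>reg := r\<rparr>) p = accessible L s p"
  "accessible L (s\<lparr>cell := c\<rparr>) p = accessible L s p"
  by (auto simp: accessible_def)

lemma accessible_owner: "owner s' = owner s \<Longrightarrow> accessible L s' p = accessible L s p"
  by (simp add: accessible_def)

lemma result_unlink:
  assumes "reg s 3 = 0" "T \<notin> {8, 9}"
  shows "cell (result (unlink T) s) = unlink_cells (cell s) (reg s T)"
    "owner (result (unlink T) s) = owner s"
    "x \<notin> {8, 9} \<Longrightarrow> reg (result (unlink T) s) x = reg s x"
  using assms by (auto simp: unlink_def unlink_cells_def upd_def Let_def)

lemma safe_unlink:
  assumes "reg s 3 = 0" "T \<notin> {8, 9}" "accessible L s (reg s T)" "accessible L s (cell s (reg s T) 3)"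
    "0 < cell s (reg s T) 2 \<Longrightarrow> accessible L s (cell s (reg s T) 2)"
  shows "safe W N L (unlink T) s"
  using assms by (auto simp: unlink_def)

lemma result_link:
  assumes "reg s 3 = 0" "Z \<noteq> 9" "R \<noteq> 9"
  shows "cell (result (link Z R) s) = link_cells (cell s) (reg s Z) (reg s R)"
    "owner (result (link Z R) s) = owner s"
    "x \<noteq> 9 \<Longrightarrow> reg (result (link Z R) s) x = reg s x"
  using assms by (auto simp: link_def link_cells_def upd_def Let_def)

lemma safe_link:
  assumes "reg s 3 = 0" "Z \<noteq> 9" "R \<noteq> 9" "accessible L s (reg s Z)" "accessible L s (reg s R)"
    "0 < cell s (reg s Z) 2 \<Longrightarrow> accessible L s (cell s (reg s Z) 2)"
  shows "safe W N L (link Z R) s"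
  using assms by (auto simp: link_def)

lemma result_push:
  assumes "V \<noteq> 8" "R \<noteq> 8"
  shows "cell (result (push V R) s) = push_cells (cell s) (reg s V) (reg s R)"
    "owner (result (push V R) s) = owner s"
    "x \<noteq> 8 \<Longrightarrow> reg (result (push V R) s) x = reg s x"
  using assms by (auto simp: push_def push_cells_def upd_def)

lemma safe_push:
  assumes "V \<noteq> 8" "R \<noteq> 8" "accessible L s (reg s V)" "accessible L s (reg s R)"
  shows "safe W N L (push V R) s"
  using assms by (auto simp: push_def)

lemma result_if_free:
  "result (if_free Z c) s = (if reg s 3 = 0 \<and> cell s (reg s Z) 0 = 0 then result c (s\<lparr>reg := (reg s)(10 := 0)\<rparr>)
     else if reg s 3 < cell s (reg s Z) 0 then s\<lparr>reg := (reg s)(10 := cell s (reg s Z) 0)\<rparr>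
     else result c (s\<lparr>reg := (reg s)(10 := cell s (reg s Z) 0)\<rparr>))"
  by (auto simp: if_free_def)

lemma safe_if_free:
  assumes "reg s 3 = 0" "accessible L s (reg s Z)"
    "cell s (reg s Z) 0 = 0 \<Longrightarrow> safe W N L c (s\<lparr>reg := (reg s)(10 := 0)\<rparr>)"
  shows "safe W N L (if_free Z c) s"
  using assms by (auto simp: if_free_def)

lemma result_flush_body:
  assumes r3: "reg s 3 = 0" and Z: "Z \<notin> {3, 5, 6, 7, 8, 9, 10}"
  defines "s' \<equiv> result (flush_body Z) s"
  shows "cell s' = flush_cells (cell s) (reg s Z) (reg s 5)" "owner s' = owner s"
    "reg s' 5 = cell s' (reg s Z) 1"
    "x \<notin> {5, 6, 7, 8, 9, 10} \<Longrightarrow> reg s' x = reg s x"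
proof -
  let ?z = "reg s Z" and ?r = "reg s 5" and ?c = "cell s"
  let ?t = "?c ?r 4" and ?w = "?c ?r 5"
  define s1 where "s1 = s\<lparr>reg := (reg s)(6 := ?t, 7 := ?w, 8 := ?c ?r 1), cell := upd ?c ?z 1 (?c ?r 1)\<rparr>"
  define s2 where "s2 = result (push 7 6) s1"
  define s3 where "s3 = result (if_free Z (unlink 6)) s2"
  define s4 where "s4 = result (if_free 7 (link Z 5)) s3"
  have s': "s' = s4\<lparr>reg := (reg s4)(5 := cell s4 (reg s4 Z) 1)\<rparr>"
    using Z unfolding s'_def flush_body_def s4_def s3_def s2_def s1_def by (simp add: upd_def)
  have r1: "reg s1 Z = ?z" "reg s1 5 = ?r" "reg s1 6 = ?t" "reg s1 7 = ?w" "reg s1 3 = 0"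
    "owner s1 = owner s" "\<And>x. x \<notin> {6, 7, 8} \<Longrightarrow> reg s1 x = reg s x" "cell s1 = upd ?c ?z 1 (?c ?r 1)"
    using Z r3 by (auto simp: s1_def)
  have r2: "cell s2 = push_cells (cell s1) ?w ?t" "owner s2 = owner s" "\<And>x. x \<noteq> 8 \<Longrightarrow> reg s2 x = reg s1 x"
    using r1 by (auto simp: s2_def result_push)
  have r3': "cell s3 = (if cell s2 ?z 0 = 0 then unlink_cells (cell s2) ?t else cell s2)"
    "owner s3 = owner s" "\<And>x. x \<notin> {8, 9, 10} \<Longrightarrow> reg s3 x = reg s1 x"
    using r1 r2 Z unfolding s3_def by (auto simp: result_if_free result_unlink)
  have r4: "cell s4 = (if cell s3 ?w 0 = 0 then link_cells (cell s3) ?z ?r else cell s3)"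
    "owner s4 = owner s" "\<And>x. x \<notin> {8, 9, 10} \<Longrightarrow> reg s4 x = reg s1 x"
    using r1 r3' Z unfolding s4_def by (auto simp: result_if_free result_link)
  show "cell s' = flush_cells (cell s) (reg s Z) (reg s 5)"
    unfolding s' using r4(1) r3'(1) r2(1) r1(8) by (simp add: flush_cells_def Let_def)
  show "owner s' = owner s" unfolding s' using r4 by simp
  show "reg s' 5 = cell s' (reg s Z) 1" unfolding s' using r4(3)[of Z] Z r1 by simp
  show "x \<notin> {5, 6, 7, 8, 9, 10} \<Longrightarrow> reg s' x = reg s x" unfolding s' using r4(3) r1(7) by simp
qed

text \<open>All assumptions speak about the heap before the body and have to be carried through its
  earlier writes. The last one ensures that unlinking does not overwrite the head of the free list
  of \<open>Z\<close>, which is read afterwards.\<close>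

lemma safe_flush_body:
  assumes r3: "reg s 3 = 0" and Z: "Z \<notin> {3, 5, 6, 7, 8, 9, 10}"
    and t: "t = cell s (reg s 5) 4" and w: "w = cell s (reg s 5) 5"
    and acc: "accessible L s (reg s Z)" "accessible L s (reg s 5)" "accessible L s t" "accessible L s w"
    and un: "cell s (reg s Z) 0 = 0 \<Longrightarrow> accessible L s (cell s t 3)"
      "cell s (reg s Z) 0 = 0 \<Longrightarrow> 0 < cell s t 2 \<Longrightarrow> accessible L s (cell s t 2)"
    and li: "0 < cell s (reg s Z) 2 \<Longrightarrow> accessible L s (cell s (reg s Z) 2)"
    and tz: "cell s (reg s Z) 0 = 0 \<Longrightarrow> cell s t 3 \<noteq> reg s Z"
  shows "safe W N L (flush_body Z) s"
proof -
  let ?z = "reg s Z" and ?r = "reg s 5" and ?c = "cell s"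
  define s1 where "s1 = s\<lparr>reg := (reg s)(6 := t, 7 := w, 8 := ?c ?r 1), cell := upd ?c ?z 1 (?c ?r 1)\<rparr>"
  define s2 where "s2 = result (push 7 6) s1"
  define s3 where "s3 = result (if_free Z (unlink 6)) s2"
  define s4 where "s4 = result (if_free 7 (link Z 5)) s3"
  have r1: "reg s1 Z = ?z" "reg s1 5 = ?r" "reg s1 6 = t" "reg s1 7 = w" "reg s1 3 = 0"
    "owner s1 = owner s" "\<And>x. x \<notin> {6, 7, 8} \<Longrightarrow> reg s1 x = reg s x" "cell s1 = upd ?c ?z 1 (?c ?r 1)"
    using Z r3 by (auto simp: s1_def)
  have r2: "cell s2 = push_cells (cell s1) w t" "owner s2 = owner s" "\<And>x. x \<noteq> 8 \<Longrightarrow> reg s2 x = reg s1 x"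
    using r1 by (auto simp: s2_def result_push)
  have r3': "cell s3 = (if cell s2 ?z 0 = 0 then unlink_cells (cell s2) t else cell s2)"
    "owner s3 = owner s" "\<And>x. x \<notin> {8, 9, 10} \<Longrightarrow> reg s3 x = reg s1 x"
    using r1 r2 Z unfolding s3_def by (auto simp: result_if_free result_unlink)
  have r4: "owner s4 = owner s" "\<And>x. x \<notin> {8, 9, 10} \<Longrightarrow> reg s4 x = reg s1 x"
    using r1 r3' Z unfolding s4_def by (auto simp: result_if_free result_link)
  have c2: "cell s2 p g = ?c p g" if "g \<noteq> 1" for p g
    using that unfolding r2(1) r1(8) by (simp add: push_fields(2) upd_apply)
  have z2: "cell s3 ?z 2 = ?c ?z 2"
  proof (cases "?c ?z 0 = 0")
    case True
    have "unlink_cells (cell s2) t ?z 2 = cell s2 ?z 2"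
      using tz[OF True] c2[of 3 t] fun_cong[OF unlink_fields(1), of "cell s2" t ?z] by simp
    then show ?thesis using c2 unfolding r3'(1) by simp
  qed (simp add: r3'(1) c2)
  have o: "accessible L s' p = accessible L s p" if "owner s' = owner s" for s' p
    using that by (rule accessible_owner)
  have 1: "safe W N L (push 7 6) s1"
    by (rule safe_push) (use r1 o[OF r1(6)] acc in simp_all)
  have 2: "safe W N L (if_free Z (unlink 6)) s2"
  proof (rule safe_if_free)
    show "reg s2 3 = 0" "accessible L s2 (reg s2 Z)" using r1 r2 Z o[OF r2(2)] acc by simp_all
    assume "cell s2 (reg s2 Z) 0 = 0"
    then have z: "?c ?z 0 = 0" using r2(3)[of Z] r1(1) Z c2 by simp
    show "safe W N L (unlink 6) (s2\<lparr>reg := (reg s2)(10 := 0)\<rparr>)"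
      by (rule safe_unlink) (use r1 r2(3) o[OF r2(2)] acc un z c2 in simp_all)
  qed
  have 3: "safe W N L (if_free 7 (link Z 5)) s3"
  proof (rule safe_if_free)
    show "reg s3 3 = 0" "accessible L s3 (reg s3 7)" using r1 r3' Z o[OF r3'(2)] acc by simp_all
    show "safe W N L (link Z 5) (s3\<lparr>reg := (reg s3)(10 := 0)\<rparr>)"
      by (rule safe_link) (use r1 r3'(3)[of Z] r3'(3) o[OF r3'(2)] acc li z2 Z in simp_all)
  qed
  have 4: "accessible L s4 (reg s4 Z)" using r4(2)[of Z] r1(1) Z o[OF r4(1)] acc by simp
  have e1: "result (Store Z 1 8) (result (Load 8 5 1) (result (Load 7 5 5) (result (Load 6 5 4) s))) = s1"
    using Z t w unfolding s1_def by (simp add: upd_def)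
  show ?thesis
    unfolding flush_body_def safe.simps(1) s4_def[symmetric]
    using 1 2 3 4 acc Z t w e1 unfolding s4_def s3_def s2_def
    by (simp del: result.simps add: result.simps(3-))
qed

lemma accessible_record:
  assumes "layout n E \<rho> (owner s)" "v < n" "p \<in> records_of E \<rho> v" "v \<in> L"
  shows "accessible L s p"
  using layout_owner[OF assms(1-3)] assms(4) by (auto simp: accessible_def)

lemma closed_nbhdI: "x \<in> S \<Longrightarrow> x \<in> closed_nbhd E S" "x \<in> S \<Longrightarrow> {x, y} \<in> E \<Longrightarrow> y \<in> closed_nbhd E S"
  by (auto simp: closed_nbhd_def)

lemma closed_nbhd_mono: "S \<subseteq> S' \<Longrightarrow> closed_nbhd E S \<subseteq> closed_nbhd E S'"
  by (auto simp: closed_nbhd_def)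

lemma loop_free_flush_body: "loop_free (flush_body Z)" "max_time (flush_body Z) \<le> 100"
  by (simp_all add: flush_body_def push_def if_free_def unlink_def link_def)

section \<open>Flushing and settling as executions\<close>

definition flush_regs :: "nat set" where "flush_regs = {5, 6, 7, 8, 9, 10}"

lemma flush_iteration:
  assumes h: "heap n E D m \<rho> (owner s) (cell s)" and z: "reg s Z = z" "z < n" and Z: "Z \<notin> insert 3 flush_regs"
    and r: "reg s 3 = 0" "reg s 5 = cell s z 1" and ne: "outs D z \<noteq> {}"
    and b: "bounded W N s" and L: "closed_nbhd E {z} \<subseteq> L"
  shows "\<exists>w k s'. (z, w) \<in> D \<and> k \<le> 100 \<and> exec (bounded W N) L (flush_body Z) s k s' \<and>
    heap n E (reverse_edge z w D) m \<rho> (owner s') (cell s') \<and> owner s' = owner s \<and>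
    reg s' 5 = cell s' z 1 \<and> (\<forall>x. x \<notin> flush_regs \<longrightarrow> reg s' x = reg s x)"
proof -
  have lay: "layout n E \<rho> (owner s)" and cm: "cell s z 0 = m z" using h z by (simp_all add: heap_def)
  from heap_flush_cells[OF h z(2) ne] obtain w where w: "(z, w) \<in> D" "w < n" "{z, w} \<in> E" "z \<noteq> w"
    "cell s z 1 = \<rho> z w" "cell s (\<rho> z w) 4 = \<rho> w z" "cell s (\<rho> z w) 5 = w"
    "m z = 0 \<longrightarrow> cell s (\<rho> w z) 3 \<in> records_of E \<rho> w \<and>
       (0 < cell s (\<rho> w z) 2 \<longrightarrow> cell s (\<rho> w z) 2 \<in> records_of E \<rho> w)"
    "0 < cell s z 2 \<longrightarrow> cell s z 2 \<in> records_of E \<rho> z"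
    "heap n E (reverse_edge z w D) m \<rho> (owner s) (flush_cells (cell s) z (\<rho> z w))"
    by - (elim exE conjE, rule that, assumption+)
  have e: "{w, z} \<in> E" using w(3) by (simp add: insert_commute)
  have zL: "z \<in> L" "w \<in> L" using w(3) L by (auto simp: closed_nbhd_def)
  have az: "accessible L s p" if "p \<in> records_of E \<rho> z" for p
    using accessible_record[OF lay z(2) that zL(1)] .
  have aw: "accessible L s p" if "p \<in> records_of E \<rho> w" for p
    using accessible_record[OF lay w(2) that zL(2)] .
  have r5: "reg s 5 = \<rho> z w" using r(2) w(5) by simp
  have Z': "Z \<notin> {3, 5, 6, 7, 8, 9, 10}" using Z by (auto simp: flush_regs_def)
  have "safe W N L (flush_body Z) s"
  proof (rule safe_flush_body[OF r(1) Z', where t = "\<rho> w z" and w = w])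
    show "\<rho> w z = cell s (reg s 5) 4" "w = cell s (reg s 5) 5" using r5 w(6,7) by simp_all
    show "accessible L s (reg s Z)" "accessible L s (reg s 5)" "accessible L s (\<rho> w z)" "accessible L s w"
      using az aw z(1) r5 w(3) e by simp_all
    show "accessible L s (cell s (\<rho> w z) 3)" if "cell s (reg s Z) 0 = 0" using that w(8) aw z(1) cm by simp
    show "accessible L s (cell s (\<rho> w z) 2)" if "cell s (reg s Z) 0 = 0" "0 < cell s (\<rho> w z) 2"
      using that w(8) aw z(1) cm by simp
    show "accessible L s (cell s (reg s Z) 2)" if "0 < cell s (reg s Z) 2" using that w(9) az z(1) by simp
    show "cell s (\<rho> w z) 3 \<noteq> reg s Z" if "cell s (reg s Z) 0 = 0"
      using layout_disjoint[OF lay w(2) z(2), of "cell s (\<rho> w z) 3"] that w(4,8) z(1) cm by auto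
  qed
  from exec_result[OF loop_free_flush_body(1) this b] obtain k where
    k: "k \<le> max_time (flush_body Z)" "exec (bounded W N) L (flush_body Z) s k (result (flush_body Z) s)" by blast
  note res = result_flush_body[OF r(1) Z']
  show ?thesis
    by (rule exI[of _ w], rule exI[of _ k], rule exI[of _ "result (flush_body Z) s"])
      (use k loop_free_flush_body(2)[of Z] w(1,10) res z(1) r5 in \<open>auto simp: flush_regs_def\<close>)
qed

text \<open>Induction on the out-degree. Each reversed edge costs at most 100 steps for the body,
  one for the loop test and one for discarding the finished body.\<close>

lemma flush_loop:
  assumes "heap n E D m \<rho> (owner s) (cell s)" "reg s Z = z" "z < n" "Z \<notin> insert 3 flush_regs"
    "reg s 3 = 0" "reg s 5 = cell s z 1" "bounded W N s" "closed_nbhd E {z} \<subseteq> L"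
  shows "\<exists>k s'. k \<le> 1 + 102 * card (outs D z) \<and> exec (bounded W N) L (WhileLess 3 5 (flush_body Z)) s k s' \<and>
    heap n E (flush z D) m \<rho> (owner s') (cell s') \<and> owner s' = owner s \<and>
    (\<forall>x. x \<notin> flush_regs \<longrightarrow> reg s' x = reg s x)"
  using assms
proof (induction "card (outs D z)" arbitrary: D s)
  case 0
  have D: "orients E D" and E: "proper_graph n E" and lay: "layout n E \<rho> (owner s)"
    and ol: "olist n \<rho> (cell s) (outs D)" using 0(2) by (auto simp: heap_def)
  have "finite (outs D z)"
    by (rule finite_subset[of _ "snd ` D"]) (use orients_finite(1)[OF E D] in \<open>force simp: outs_def\<close>)+
  then have em: "outs D z = {}" using 0(1) by simp
  have "\<And>v u. u \<in> outs D v \<Longrightarrow> {v, u} \<in> E" using orients_edge[OF D] by (simp add: outs_def)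
  then have "cell s z 1 = 0" using olist_empty_iff[OF lay ol _ 0(4)] em by blast
  then have "exec (bounded W N) L (WhileLess 3 5 (flush_body Z)) s 1 s"
    using 0 by (intro exec_While_False) simp_all
  then show ?case using 0(2) em by (intro exI[of _ 1] exI[of _ s]) (simp add: flush_no_outs)
next
  case (Suc j)
  have D: "orients E D" and E: "proper_graph n E" and lay: "layout n E \<rho> (owner s)"
    and ol: "olist n \<rho> (cell s) (outs D)" using Suc.prems(1) by (auto simp: heap_def)
  have ne: "outs D z \<noteq> {}" using Suc.hyps(2) by auto
  from flush_iteration[OF Suc.prems(1-6) ne Suc.prems(7,8)]
  obtain w k s1 where w: "(z, w) \<in> D" "k \<le> 100" "exec (bounded W N) L (flush_body Z) s k s1"
    "heap n E (reverse_edge z w D) m \<rho> (owner s1) (cell s1)" "owner s1 = owner s"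
    "reg s1 5 = cell s1 z 1" "\<forall>x. x \<notin> flush_regs \<longrightarrow> reg s1 x = reg s x" by - (elim exE conjE, rule that, assumption+)
  have zw: "z \<noteq> w" using w(1) orients_irrefl[OF D] by auto
  have fin: "finite (outs D z)" using Suc.hyps(2) card.infinite by fastforce
  have "outs (reverse_edge z w D) z = outs D z - {w}" using zw by (simp add: outs_reverse_edge[OF D w(1)])
  then have c: "j = card (outs (reverse_edge z w D) z)"
    using Suc.hyps(2) fin w(1) by (simp add: outs_def)
  have pos: "reg s 3 < reg s 5"
  proof -
    have "\<And>v u. u \<in> outs D v \<Longrightarrow> {v, u} \<in> E" using orients_edge[OF D] by (simp add: outs_def)
    then show ?thesis using olist_empty_iff[OF lay ol _ Suc.prems(3)] ne Suc.prems(5,6) by simp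
  qed
  have r: "reg s1 Z = z" "reg s1 3 = 0" using w(7) Suc.prems(2,4,5) by (auto simp: flush_regs_def)
  from Suc.hyps(1)[OF c w(4) r(1) Suc.prems(3,4) r(2) w(6) conjunct2[OF exec_bound[OF w(3)]] Suc.prems(8)]
  obtain k' s' where s': "k' \<le> 1 + 102 * card (outs (reverse_edge z w D) z)"
    "exec (bounded W N) L (WhileLess 3 5 (flush_body Z)) s1 k' s'"
    "heap n E (flush z (reverse_edge z w D)) m \<rho> (owner s') (cell s')" "owner s' = owner s1"
    "\<forall>x. x \<notin> flush_regs \<longrightarrow> reg s' x = reg s1 x" by - (elim exE conjE, rule that, assumption+)
  have "exec (bounded W N) L (WhileLess 3 5 (flush_body Z)) s (Suc (k + 1 + k')) s'"
    by (rule exec_While_True[OF pos Suc.prems(7) w(3) s'(2)])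
  moreover have "Suc (k + 1 + k') \<le> 1 + 102 * card (outs D z)"
    using s'(1) w(2) c Suc.hyps(2) by simp
  ultimately show ?case using s'(3-5) w(5,7) flush_reverse_edge[OF D w(1)]
    by (intro exI[of _ "Suc (k + 1 + k')"] exI[of _ s']) simp
qed

lemma exec_If:
  assumes "exec B L (if reg s x < reg s y then c else d) s k s'" "B s"
  shows "exec B L (IfLess x y c d) s (Suc k) s'"
  by (rule exec_step[OF _ _ _ _ assms(1)]) (use assms(2) in auto)

lemma exec_loop_free:
  assumes "loop_free c" "safe W N L c s" "bounded W N s"
  obtains k where "k \<le> max_time c" "exec (bounded W N) L c s k (result c s)"
  using exec_result[OF assms] by blast

lemma flush_exec:
  assumes h: "heap n E D m \<rho> (owner s) (cell s)" and z: "reg s Z = z" "z < n" and Z: "Z \<notin> insert 3 flush_regs"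
    and r: "reg s 3 = 0" and b: "bounded W N s" and L: "closed_nbhd E {z} \<subseteq> L"
  shows "\<exists>k s'. k \<le> 3 + 102 * card (outs D z) \<and> exec (bounded W N) L (flush_com Z) s k s' \<and>
    heap n E (flush z D) m \<rho> (owner s') (cell s') \<and> owner s' = owner s \<and>
    (\<forall>x. x \<notin> flush_regs \<longrightarrow> reg s' x = reg s x)"
proof -
  have lay: "layout n E \<rho> (owner s)" using h by (simp add: heap_def)
  have "z \<in> L" using L closed_nbhdI(1)[of z "{z}" E] by auto
  then have a: "accessible L s z" using accessible_record[OF lay z(2)] by simp
  let ?s = "result (Load 5 Z 1) s"
  have "safe W N L (Load 5 Z 1) s" using a z by simp
  from exec_loop_free[OF _ this b] obtain k where k: "k \<le> 1" "exec (bounded W N) L (Load 5 Z 1) s k ?s" by auto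
  have rs: "reg ?s Z = z" "reg ?s 3 = 0" "reg ?s 5 = cell ?s z 1" "heap n E D m \<rho> (owner ?s) (cell ?s)"
    "owner ?s = owner s" "\<forall>x. x \<notin> flush_regs \<longrightarrow> reg ?s x = reg s x"
    using h z Z r by (auto simp: flush_regs_def)
  from flush_loop[OF rs(4,1) z(2) Z rs(2,3) conjunct2[OF exec_bound[OF k(2)]] L]
  obtain k' s' where s': "k' \<le> 1 + 102 * card (outs D z)"
    "exec (bounded W N) L (WhileLess 3 5 (flush_body Z)) ?s k' s'"
    "heap n E (flush z D) m \<rho> (owner s') (cell s')" "owner s' = owner ?s"
    "\<forall>x. x \<notin> flush_regs \<longrightarrow> reg s' x = reg ?s x" by - (elim exE conjE, rule that, assumption+)
  have "exec (bounded W N) L (flush_com Z) s (k + 1 + k') s'"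
    unfolding flush_com_def by (rule exec_Seq[OF k(2) s'(2)])
  then show ?thesis using s' rs(5,6) k(1) by (intro exI[of _ "k + 1 + k'"] exI[of _ s']) simp
qed

text \<open>The pivot of the algorithm: a vertex without out-edges is in no free list, so its status
  can change without an update elsewhere.\<close>

lemma heap_set_mate:
  assumes h: "heap n E D m \<rho> own c" and z: "z < n" "outs D z = {}"
  shows "heap n E D (m(z := k)) \<rho> own (upd c z 0 k)"
proof -
  have "(z, v) \<notin> D" for v using z(2) by (auto simp: outs_def)
  then have "frees D (m(z := k)) = frees D m" by (auto simp: frees_def fun_eq_iff)
  moreover have "upd c z 0 k p 1 = c p 1" "upd c z 0 k p 2 = c p 2" "upd c z 0 k p 3 = c p 3"
    "upd c z 0 k p 4 = c p 4" "upd c z 0 k p 5 = c p 5" for p by (simp_all add: upd_apply)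
  note f = this
  ultimately show ?thesis
    using h unfolding heap_def olist_def flist_def twins_def f by (simp add: upd_apply)
qed

lemma exec_primitive:
  assumes "safe W N L c t" "bounded W N t" "loop_free c" "max_time c = 1" "result c t = t'"
  shows "\<exists>k\<le>1. exec (bounded W N) L c t k t'"
  using exec_result[OF assms(3,1,2)] assms(4,5) by simp

definition settle_regs :: "nat set" where "settle_regs = {5, 6, 7, 8, 9, 10, 11, 12, 13}"

text \<open>The neighbourhood of the new partner in \<open>X\<close> may be accessed as well,
  because the change of its mate makes the partner an involved vertex.\<close>

lemma settle_exec:
  assumes h: "heap n E D m \<rho> (owner s) (cell s)" and z: "reg s Z = z" "z < n" and Z: "Z \<in> {1, 2}"
    and r: "reg s 3 = 0" "reg s 4 = 1" and b: "bounded W N s" and W: "n \<le> W"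
  shows "\<exists>k s' D' m' X c. k \<le> 100 + 102 * c \<and> exec (bounded W N) (closed_nbhd E (insert z X)) (settle_com Z) s k s' \<and>
    heap n E D' m' \<rho> (owner s') (cell s') \<and> owner s' = owner s \<and>
    (\<forall>x. x \<notin> settle_regs \<longrightarrow> reg s' x = reg s x) \<and> settle_rel E z D m D' m' X c"
proof -
  have D: "orients E D" and E: "proper_graph n E" and lay: "layout n E \<rho> (owner s)" using h by (auto simp: heap_def)
  let ?D1 = "flush z D"
  have D1: "orients E ?D1" by (rule orients_flush[OF D])
  have Zf: "Z \<notin> insert 3 flush_regs" using Z by (auto simp: flush_regs_def)
  from flush_exec[OF h z Zf r(1) b order_refl]
  obtain k1 s1 where s1: "k1 \<le> 3 + 102 * card (outs D z)"
    "exec (bounded W N) (closed_nbhd E {z}) (flush_com Z) s k1 s1"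
    "heap n E ?D1 m \<rho> (owner s1) (cell s1)" "owner s1 = owner s"
    "\<forall>x. x \<notin> flush_regs \<longrightarrow> reg s1 x = reg s x" by - (elim exE conjE, rule that, assumption+)
  have r1: "reg s1 Z = z" "reg s1 3 = 0" "reg s1 4 = 1" using s1(5) Zf z r by (auto simp: flush_regs_def)
  have b1: "bounded W N s1" using exec_bound[OF s1(2)] by simp
  have lay1: "layout n E \<rho> (owner s1)" and m1: "cell s1 z 0 = m z" and tw1: "twins E \<rho> (cell s1)"
    and fl1: "flist n \<rho> (cell s1) (frees ?D1 m)"
    using s1(3) z by (auto simp: heap_def)
  have fE: "\<And>v u. u \<in> frees ?D1 m v \<Longrightarrow> {v, u} \<in> E"
    using orients_edge[OF D1] by (fastforce simp: frees_def insert_commute)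
  have acc: "accessible L s' p" if "p \<in> records_of E \<rho> z" "z \<in> L" "owner s' = owner s" for p s' L
    using accessible_record[OF lay z(2) that(1,2)] that(3) by (simp add: accessible_def)
  let ?tail = "Seq (Load 12 11 5) (Seq (Add 13 12 4) (Seq (Store Z 0 13)
         (Seq (flush_com 12) (Seq (Add 13 Z 4) (Store 12 0 13)))))"
  let ?inner = "Seq (Load 11 Z 2) (IfLess 3 11 ?tail Skip)"
  have unfold: "settle_com Z = Seq (flush_com Z) (Seq (Load 10 Z 0) (IfLess 3 10 Skip ?inner))"
    by (simp add: settle_com_def)
  show ?thesis
  proof (cases "m z = 0 \<and> frees ?D1 m z \<noteq> {}")
    case False
    let ?L = "closed_nbhd E {z}"
    have zL: "z \<in> ?L" by (simp add: closed_nbhdI)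
    let ?s2 = "s1\<lparr>reg := (reg s1)(10 := m z)\<rparr>"
    have sf: "safe W N ?L (Load 10 Z 0) s1" using acc[OF _ zL s1(4)] r1 by simp
    have "\<exists>k\<le>1. exec (bounded W N) ?L (Load 10 Z 0) s1 k ?s2"
      by (rule exec_primitive[OF sf b1]) (use r1 m1 in auto)
    then obtain k2 where k2: "k2 \<le> 1" "exec (bounded W N) ?L (Load 10 Z 0) s1 k2 ?s2" by blast
    have b2: "bounded W N ?s2" using exec_bound[OF k2(2)] by simp
    have "\<exists>k3 s3. k3 \<le> 10 \<and> exec (bounded W N) ?L (IfLess 3 10 Skip ?inner) ?s2 k3 s3 \<and>
       cell s3 = cell s1 \<and> owner s3 = owner s1 \<and> (\<forall>x. x \<notin> settle_regs \<longrightarrow> reg s3 x = reg s1 x)"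
    proof (cases "m z = 0")
      case False
      then have "exec (bounded W N) ?L (IfLess 3 10 Skip ?inner) ?s2 (Suc 0) ?s2"
        using r1 b2 by (intro exec_If) (auto intro: exec_Skip)
      then show ?thesis by (intro exI[of _ "Suc 0"] exI[of _ ?s2]) (auto simp: settle_regs_def)
    next
      case True
      then have "cell s1 z 2 = 0" using flist_head[OF lay1 fl1 fE z(2)] False by simp
      let ?s3 = "?s2\<lparr>reg := (reg ?s2)(11 := 0)\<rparr>"
      have sf: "safe W N ?L (Load 11 Z 2) ?s2" using acc[OF _ zL s1(4)] r1 Z by auto
      have "\<exists>k\<le>1. exec (bounded W N) ?L (Load 11 Z 2) ?s2 k ?s3"
        by (rule exec_primitive[OF sf b2]) (use r1 Z \<open>cell s1 z 2 = 0\<close> in auto)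
      then obtain k3 where k3: "k3 \<le> 1" "exec (bounded W N) ?L (Load 11 Z 2) ?s2 k3 ?s3" by blast
      have "exec (bounded W N) ?L (IfLess 3 11 ?tail Skip) ?s3 (Suc 0) ?s3"
        using r1 exec_bound[OF k3(2)] by (intro exec_If) (auto intro: exec_Skip)
      from exec_Seq[OF k3(2) this] have "exec (bounded W N) ?L ?inner ?s2 (k3 + 1 + Suc 0) ?s3" .
      then have "exec (bounded W N) ?L (IfLess 3 10 Skip ?inner) ?s2 (Suc (k3 + 1 + Suc 0)) ?s3"
        using r1 True b2 by (intro exec_If) simp_all
      then show ?thesis using k3(1)
        by (intro exI[of _ "Suc (k3 + 1 + Suc 0)"] exI[of _ ?s3]) (auto simp: settle_regs_def)
    qed
    then obtain k3 s3 where s3: "k3 \<le> 10" "exec (bounded W N) ?L (IfLess 3 10 Skip ?inner) ?s2 k3 s3"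
       "cell s3 = cell s1" "owner s3 = owner s1" "\<forall>x. x \<notin> settle_regs \<longrightarrow> reg s3 x = reg s1 x" by - (elim exE conjE, rule that, assumption+)
    have ex: "exec (bounded W N) ?L (settle_com Z) s (k1 + 1 + (k2 + 1 + k3)) s3"
      unfolding unfold by (rule exec_Seq[OF s1(2) exec_Seq[OF k2(2) s3(2)]])
    \<comment> \<open>After the flush every neighbour of \<open>z\<close> is an in-neighbour, so an
      empty free list means that all neighbours are matched.\<close>
    have "m z \<noteq> 0 \<or> (\<forall>w. {z, w} \<in> E \<longrightarrow> m w \<noteq> 0)"
    proof (cases "m z = 0")
      case True
      then have em: "frees ?D1 m z = {}" using False by simp
      have "m w \<noteq> 0" if "{z, w} \<in> E" for w
      proof -
        have "(w, z) \<in> ?D1" using orients_cases[OF D1 that] outs_flush[OF D, of z] by (auto simp: outs_def)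
        then show ?thesis using em by (auto simp: frees_def)
      qed
      then show ?thesis by blast
    qed simp
    then have "settle_rel E z D m ?D1 m {} (card (outs D z))" by (simp add: settle_rel_def)
    moreover have "k1 + 1 + (k2 + 1 + k3) \<le> 100 + 102 * card (outs D z)" using s1(1) k2(1) s3(1) by simp
    moreover have "\<forall>x. x \<notin> settle_regs \<longrightarrow> reg s3 x = reg s x"
      using s3(5) s1(5) by (auto simp: settle_regs_def flush_regs_def)
    ultimately show ?thesis using ex s1(3,4) s3(3,4)
      by (intro exI[of _ "k1 + 1 + (k2 + 1 + k3)"] exI[of _ s3] exI[of _ ?D1] exI[of _ m] exI[of _ "{}"]
          exI[of _ "card (outs D z)"]) simp
  next
    case True
    then have mz: "m z = 0" by simp
    from True flist_head[OF lay1 fl1 fE z(2)] obtain x where x: "x \<in> frees ?D1 m z" "cell s1 z 2 = \<rho> z x"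
      "0 < cell s1 z 2" by auto
    have xz: "(x, z) \<in> ?D1" "m x = 0" using x(1) by (auto simp: frees_def)
    have e: "{z, x} \<in> E" "{x, z} \<in> E" using fE[OF x(1)] by (simp_all add: insert_commute)
    have xn: "x < n" using proper_graphD[OF E e(1)] by auto
    have nb: "cell s1 (\<rho> z x) 5 = x" using tw1 e by (simp add: twins_def)
    let ?L = "closed_nbhd E {z, x}"
    have zL: "z \<in> ?L" "x \<in> ?L" by (simp_all add: closed_nbhdI)
    let ?s2 = "s1\<lparr>reg := (reg s1)(10 := 0)\<rparr>"
    let ?s3 = "?s2\<lparr>reg := (reg ?s2)(11 := \<rho> z x)\<rparr>"
    let ?s4 = "?s3\<lparr>reg := (reg ?s3)(12 := x)\<rparr>"
    let ?s5 = "?s4\<lparr>reg := (reg ?s4)(13 := Suc x)\<rparr>"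
    let ?s6 = "?s5\<lparr>cell := upd (cell s1) z 0 (Suc x)\<rparr>"
    have Z0: "Z \<noteq> 10" "Z \<noteq> 11" "Z \<noteq> 12" "Z \<noteq> 13" "Z \<noteq> 3" using Z by auto
    have az: "accessible ?L s1 p" if "p \<in> records_of E \<rho> z" for p using acc[OF that zL(1) s1(4)] .
    have "\<exists>k\<le>1. exec (bounded W N) ?L (Load 10 Z 0) s1 k ?s2"
      by (rule exec_primitive[OF _ b1]) (use az r1 m1 mz in \<open>simp_all add: upd_def\<close>)
    then obtain k2 where k2: "k2 \<le> 1" "exec (bounded W N) ?L (Load 10 Z 0) s1 k2 ?s2" by blast
    have b2: "bounded W N ?s2" using exec_bound[OF k2(2)] by simp
    have "\<exists>k\<le>1. exec (bounded W N) ?L (Load 11 Z 2) ?s2 k ?s3"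
      by (rule exec_primitive[OF _ b2]) (use az r1 Z0 x(2) in \<open>simp_all add: upd_def\<close>)
    then obtain k3 where k3: "k3 \<le> 1" "exec (bounded W N) ?L (Load 11 Z 2) ?s2 k3 ?s3" by blast
    have b3: "bounded W N ?s3" using exec_bound[OF k3(2)] by simp
    have "\<exists>k\<le>1. exec (bounded W N) ?L (Load 12 11 5) ?s3 k ?s4"
      by (rule exec_primitive[OF _ b3]) (use az e(1) nb in \<open>simp_all add: upd_def\<close>)
    then obtain k4 where k4: "k4 \<le> 1" "exec (bounded W N) ?L (Load 12 11 5) ?s3 k4 ?s4" by blast
    have b4: "bounded W N ?s4" using exec_bound[OF k4(2)] by simp
    have "\<exists>k\<le>1. exec (bounded W N) ?L (Add 13 12 4) ?s4 k ?s5"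
      by (rule exec_primitive[OF _ b4]) (use r1 xn W in \<open>simp_all add: upd_def\<close>)
    then obtain k5 where k5: "k5 \<le> 1" "exec (bounded W N) ?L (Add 13 12 4) ?s4 k5 ?s5" by blast
    have b5: "bounded W N ?s5" using exec_bound[OF k5(2)] by simp
    have "\<exists>k\<le>1. exec (bounded W N) ?L (Store Z 0 13) ?s5 k ?s6"
      by (rule exec_primitive[OF _ b5]) (use az r1 Z0 in \<open>simp_all add: upd_def\<close>)
    then obtain k6 where k6: "k6 \<le> 1" "exec (bounded W N) ?L (Store Z 0 13) ?s5 k6 ?s6" by blast
    have b6: "bounded W N ?s6" using exec_bound[OF k6(2)] by simp
    let ?m1 = "m(z := Suc x)"
    have h6: "heap n E ?D1 ?m1 \<rho> (owner ?s6) (cell ?s6)"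
      using heap_set_mate[OF s1(3) z(2) outs_flush[OF D]] by simp
    have f12: "(12::nat) \<notin> insert 3 flush_regs" by (simp add: flush_regs_def)
    have "closed_nbhd E {x} \<subseteq> ?L" by (rule closed_nbhd_mono) simp
    from flush_exec[OF h6 _ xn f12 _ b6 this] r1
    obtain k7 s7 where s7: "k7 \<le> 3 + 102 * card (outs ?D1 x)"
      "exec (bounded W N) ?L (flush_com 12) ?s6 k7 s7"
      "heap n E (flush x ?D1) ?m1 \<rho> (owner s7) (cell s7)" "owner s7 = owner ?s6"
      "\<forall>y. y \<notin> flush_regs \<longrightarrow> reg s7 y = reg ?s6 y" by auto
    have b7: "bounded W N s7" using exec_bound[OF s7(2)] by simp
    have r7: "reg s7 12 = x" "reg s7 Z = z" "reg s7 4 = 1"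
      using s7(5) Zf Z0 r1 by (auto simp: flush_regs_def)
    let ?s8 = "s7\<lparr>reg := (reg s7)(13 := Suc z)\<rparr>"
    have "\<exists>k\<le>1. exec (bounded W N) ?L (Add 13 Z 4) s7 k ?s8"
      by (rule exec_primitive[OF _ b7]) (use r7 z W in \<open>simp_all add: upd_def\<close>)
    then obtain k8 where k8: "k8 \<le> 1" "exec (bounded W N) ?L (Add 13 Z 4) s7 k8 ?s8" by blast
    have b8: "bounded W N ?s8" using exec_bound[OF k8(2)] by simp
    let ?s9 = "?s8\<lparr>cell := upd (cell s7) x 0 (Suc z)\<rparr>"
    have ax: "accessible ?L s7 x"
      using accessible_record[OF lay xn _ zL(2), of x] s7(4) s1(4) by (simp add: accessible_def)
    have "\<exists>k\<le>1. exec (bounded W N) ?L (Store 12 0 13) ?s8 k ?s9"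
      by (rule exec_primitive[OF _ b8]) (use ax r7 in \<open>simp_all add: upd_def\<close>)
    then obtain k9 where k9: "k9 \<le> 1" "exec (bounded W N) ?L (Store 12 0 13) ?s8 k9 ?s9" by blast
    let ?D2 = "flush x ?D1" and ?m2 = "m(z := Suc x, x := Suc z)"
    have h9: "heap n E ?D2 ?m2 \<rho> (owner ?s9) (cell ?s9)"
      using heap_set_mate[OF s7(3) xn outs_flush[OF D1]] by simp
    have "closed_nbhd E {z} \<subseteq> ?L" by (rule closed_nbhd_mono) simp
    note s1L = exec_mono[OF s1(2) this]
    let ?k = "k1 + 1 + (k2 + 1 + Suc (k3 + 1 + Suc (k4 + 1 + (k5 + 1 + (k6 + 1 + (k7 + 1 + (k8 + 1 + k9)))))))"
    have "exec (bounded W N) ?L ?tail ?s3 (k4 + 1 + (k5 + 1 + (k6 + 1 + (k7 + 1 + (k8 + 1 + k9))))) ?s9"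
      by (rule exec_Seq[OF k4(2) exec_Seq[OF k5(2) exec_Seq[OF k6(2) exec_Seq[OF s7(2) exec_Seq[OF k8(2) k9(2)]]]]])
    then have "exec (bounded W N) ?L (IfLess 3 11 ?tail Skip) ?s3 (Suc (k4 + 1 + (k5 + 1 + (k6 + 1 + (k7 + 1 + (k8 + 1 + k9)))))) ?s9"
      using b3 r1 x by (intro exec_If) simp_all
    from exec_Seq[OF k3(2) this]
    have "exec (bounded W N) ?L (IfLess 3 10 Skip ?inner) ?s2 (Suc (k3 + 1 + Suc (k4 + 1 + (k5 + 1 + (k6 + 1 + (k7 + 1 + (k8 + 1 + k9))))))) ?s9"
      using b2 r1 by (intro exec_If) simp_all
    from exec_Seq[OF s1L exec_Seq[OF k2(2) this]]
    have ex: "exec (bounded W N) ?L (settle_com Z) s ?k ?s9" unfolding unfold .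
    have st: "settle_rel E z D m ?D2 ?m2 {x} (card (outs D z) + card (outs ?D1 x))"
      unfolding settle_rel_def using e(1) mz xz(2) by blast
    have kb: "?k \<le> 100 + 102 * (card (outs D z) + card (outs ?D1 x))"
      using s1(1) s7(1) k2(1) k3(1) k4(1) k5(1) k6(1) k8(1) k9(1) by simp
    have rg: "\<forall>y. y \<notin> settle_regs \<longrightarrow> reg ?s9 y = reg s y"
      using s7(5) s1(5) by (auto simp: settle_regs_def flush_regs_def)
    have ow: "owner ?s9 = owner s" using s7(4) s1(4) by simp
    show ?thesis
      by (rule exI[of _ ?k], rule exI[of _ ?s9], rule exI[of _ ?D2], rule exI[of _ ?m2], rule exI[of _ "{x}"],
        rule exI[of _ "card (outs D z) + card (outs ?D1 x)"]) (intro conjI kb ex h9 ow rg st)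
  qed
qed

definition insert_com :: com where
  "insert_com = Seq (Alloc 5 1) (Seq (Alloc 6 2) (Seq (Store 5 4 6) (Seq (Store 6 4 5)
     (Seq (Store 5 5 2) (Seq (Store 6 5 1) (Seq (push 1 5) (if_free 1 (link 2 6))))))))"

definition delete_com :: com where
  "delete_com = Seq (Load 5 1 1) (Seq (Load 6 5 4) (Seq (Load 8 5 1) (Seq (Store 1 1 8)
     (Seq (if_free 1 (unlink 6)) (Seq (Free 5) (Seq (Free 6) (Seq (Load 10 1 0) (Seq (Add 13 2 4)
     (IfLess 10 13 Skip (IfLess 13 10 Skip (Seq (Store 1 0 3) (Store 2 0 3))))))))))))"

definition matching_com :: com where
  "matching_com = Seq (Const 4 1) (Seq (flush_com 1) (Seq (flush_com 2)
     (Seq (IfLess 0 4 insert_com delete_com) (Seq (settle_com 1) (settle_com 2)))))"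

section \<open>Inserting and deleting the two records of an edge\<close>

lemma olist_cong:
  assumes "olist n \<rho> c S" "\<And>v u. u \<in> S v \<Longrightarrow> {v, u} \<in> E"
    and "\<And>x y. {x, y} \<in> E \<Longrightarrow> \<rho>' x y = \<rho> x y"
    and "\<And>v p. v < n \<Longrightarrow> p \<in> records_of E \<rho> v \<Longrightarrow> c' p 1 = c p 1"
  shows "olist n \<rho>' c' S"
  unfolding olist_def
proof (intro allI impI)
  fix v assume v: "v < n"
  from assms(1) v obtain xs where xs: "distinct xs" "set xs = S v" "lseg (\<lambda>p. c p 1) v (map (\<rho> v) xs)"
    by (auto simp: olist_def)
  have E: "{v, u} \<in> E" if "u \<in> set xs" for u using that xs(2) assms(2) by simp
  have eq: "map (\<rho>' v) xs = map (\<rho> v) xs" using assms(3) E by simp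
  have l: "lseg (\<lambda>p. c' p 1) v (map (\<rho> v) xs)"
    by (rule lseg_frame[OF xs(3)]) (use assms(4)[OF v] E in auto)
  show "\<exists>xs. distinct xs \<and> set xs = S v \<and> lseg (\<lambda>p. c' p 1) v (map (\<rho>' v) xs)"
    by (rule exI[of _ xs]) (simp only: eq l xs simp_thms)
qed

lemma flist_cong:
  assumes "flist n \<rho> c S" "\<And>v u. u \<in> S v \<Longrightarrow> {v, u} \<in> E"
    and "\<And>x y. {x, y} \<in> E \<Longrightarrow> \<rho>' x y = \<rho> x y"
    and "\<And>v p. v < n \<Longrightarrow> p \<in> records_of E \<rho> v \<Longrightarrow> c' p 2 = c p 2 \<and> c' p 3 = c p 3"
  shows "flist n \<rho>' c' S"
  unfolding flist_def
proof (intro allI impI)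
  fix v assume v: "v < n"
  from assms(1) v obtain xs where xs: "distinct xs" "set xs = S v"
    "dseg (\<lambda>p. c p 2) (\<lambda>p. c p 3) v (map (\<rho> v) xs)" by (auto simp: flist_def)
  have E: "{v, u} \<in> E" if "u \<in> set xs" for u using that xs(2) assms(2) by simp
  have eq: "map (\<rho>' v) xs = map (\<rho> v) xs" using assms(3) E by simp
  have l: "dseg (\<lambda>p. c' p 2) (\<lambda>p. c' p 3) v (map (\<rho> v) xs)"
    by (rule dseg_frame[OF xs(3)]) (use assms(4)[OF v] E in auto)
  show "\<exists>xs. distinct xs \<and> set xs = S v \<and> dseg (\<lambda>p. c' p 2) (\<lambda>p. c' p 3) v (map (\<rho>' v) xs)"
    by (rule exI[of _ xs]) (simp only: eq l xs simp_thms)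
qed

lemma orients_insert:
  assumes D: "orients E D" and uv: "{u, v} \<notin> E" "u \<noteq> v"
  shows "orients (insert {u, v} E) (insert (u, v) D)"
proof -
  have n: "(u, v) \<notin> D" "(v, u) \<notin> D"
    using orients_edge[OF D, of u v] orients_edge[OF D, of v u] uv by (metis insert_commute)+
  show ?thesis unfolding orients_def
  proof (intro conjI allI impI)
    fix x y
    show "{x, y} \<in> insert {u, v} E" if "(x, y) \<in> insert (u, v) D" using that orients_edge[OF D] by auto
    assume "{x, y} \<in> insert {u, v} E"
    then consider "x = u" "y = v" | "x = v" "y = u" | "{x, y} \<in> E" "(x, y) \<noteq> (u, v)" "(y, x) \<noteq> (u, v)"
      using uv by (auto simp: doubleton_eq_iff insert_commute)
    then show "((x, y) \<in> insert (u, v) D) \<noteq> ((y, x) \<in> insert (u, v) D)"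
    proof cases
      case 3
      then have "((x, y) \<in> D) \<noteq> ((y, x) \<in> D)" using D unfolding orients_def by blast
      then show ?thesis using 3(2,3) by auto
    qed (use n uv(2) in auto)
  qed
qed

lemma orients_delete:
  assumes D: "orients E D" and uv: "(u, v) \<in> D"
  shows "orients (E - {{u, v}}) (D - {(u, v)})"
proof -
  have n: "(v, u) \<notin> D" by (rule orients_asym[OF D uv])
  show ?thesis unfolding orients_def
  proof (intro conjI allI impI)
    fix x y
    show "{x, y} \<in> E - {{u, v}}" if "(x, y) \<in> D - {(u, v)}"
      using that orients_edge[OF D] n by (auto simp: doubleton_eq_iff)
    assume "{x, y} \<in> E - {{u, v}}"
    then have "{x, y} \<in> E" and ne: "{x, y} \<noteq> {u, v}" by simp_all
    then have "((x, y) \<in> D) \<noteq> ((y, x) \<in> D)" using D unfolding orients_def by blast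
    moreover have "(x, y) \<noteq> (u, v)" "(y, x) \<noteq> (u, v)" using ne by (auto simp: doubleton_eq_iff)
    ultimately show "((x, y) \<in> D - {(u, v)}) \<noteq> ((y, x) \<in> D - {(u, v)})" by simp
  qed
qed

lemma exec_straight:
  assumes "safe W N L c t" "bounded W N t" "loop_free c" "max_time c \<le> T" "result c t = t'"
  shows "\<exists>k. k \<le> T \<and> exec (bounded W N) L c t k t'"
proof -
  from exec_result[OF assms(3,1,2)] obtain k where "k \<le> max_time c" "exec (bounded W N) L c t k (result c t)"
    by - (elim exE conjE, rule that, assumption+)
  then show ?thesis using assms(4,5) by (intro exI[of _ k]) simp
qed

lemma insert_exec:
  assumes h: "heap n E D m \<rho> (owner s) (cell s)" and r: "reg s 1 = u" "reg s 2 = v" "reg s 3 = 0"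
    and uv: "u < n" "v < n" "u \<noteq> v" "{u, v} \<notin> E" and b: "bounded W N s"
    and N: "card (dom (owner s)) + 2 \<le> N" "N \<le> W" and L: "u \<in> L" "v \<in> L"
  shows "\<exists>k s' \<rho>'. k \<le> 100 \<and> exec (bounded W N) L insert_com s k s' \<and>
    heap n (insert {u, v} E) (insert (u, v) D) m \<rho>' (owner s') (cell s') \<and>
    (\<forall>x. x \<notin> settle_regs \<longrightarrow> reg s' x = reg s x)"
proof -
  from h have E: "proper_graph n E" and D: "orients E D" and lay: "layout n E \<rho> (owner s)"
    and tw: "twins E \<rho> (cell s)" and ol: "olist n \<rho> (cell s) (outs D)"
    and fl: "flist n \<rho> (cell s) (frees D m)" and m: "\<forall>v<n. cell s v 0 = m v"
    unfolding heap_def by blast+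
  let ?E = "insert {u, v} E" and ?D = "insert (u, v) D" and ?own = "owner s" and ?c = "cell s"
  define a where "a = (LEAST a. ?own a = None)"
  define own1 where "own1 = ?own(a := Some u)"
  define b' where "b' = (LEAST a. own1 a = None)"
  define own2 where "own2 = own1(b' := Some v)"
  have fin: "finite (dom ?own)" using b by (simp add: bounded_def)
  then have fin1: "finite (dom own1)" by (simp add: own1_def)
  have a: "?own a = None" using least_free(1)[OF fin] by (simp add: a_def)
  have "own1 b' = None" using least_free(1)[OF fin1] by (simp add: b'_def)
  then have b': "?own b' = None" "b' \<noteq> a" by (auto simp: own1_def split: if_splits)
  have root: "?own p = Some p" if "p < n" for p using lay that by (simp add: layout_def)
  have rec: "?own (\<rho> x y) = Some x" "n \<le> \<rho> x y" if "{x, y} \<in> E" for x y using lay that by (simp_all add: layout_def)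
  \<comment> \<open>The roots occupy all addresses below \<open>n\<close>, so fresh addresses are at
    least \<open>n\<close> and in particular not the list end 0.\<close>
  have an: "n \<le> a" "n \<le> b'" using root a b'(1) by (metis not_le option.distinct(1))+
  have fresh: "\<rho> x y \<noteq> a" "\<rho> x y \<noteq> b'" if "{x, y} \<in> E" for x y using rec[OF that] a b'(1) by auto
  define \<rho>' where "\<rho>' x y = (if x = u \<and> y = v then a else if x = v \<and> y = u then b' else \<rho> x y)" for x y
  have old: "\<rho>' x y = \<rho> x y" if "{x, y} \<in> E" for x y
    using that uv(4) unfolding \<rho>'_def by (metis insert_commute)
  have new: "\<rho>' u v = a" "\<rho>' v u = b'" using uv(3) by (auto simp: \<rho>'_def)
  have memE: "{x, y} \<in> ?E \<longleftrightarrow> {x, y} \<in> E \<or> (x = u \<and> y = v) \<or> (x = v \<and> y = u)" for x y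
    by (auto simp: doubleton_eq_iff)
  have ow2: "own2 p = (if p = a then Some u else if p = b' then Some v else ?own p)" for p
    using b'(2) by (simp add: own2_def own1_def)
  have lay': "layout n ?E \<rho>' own2"
    unfolding layout_def
  proof (intro conjI allI impI)
    show "own2 p = Some p" if "p < n" for p using that an root ow2 by auto
    fix x y
    assume xy: "{x, y} \<in> ?E"
    then show "n \<le> \<rho>' x y" using an rec(2) old new unfolding memE by auto
    show "own2 (\<rho>' x y) = Some x" using xy rec(1) old new fresh b'(2) unfolding memE ow2 by auto
  next
    fix x y y'
    assume xy: "{x, y} \<in> ?E" and xy': "{x, y'} \<in> ?E" and eq: "\<rho>' x y = \<rho>' x y'"
    show "y = y'"
    proof (cases "{x, y} \<in> E \<and> {x, y'} \<in> E")
      case True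
      then show ?thesis using eq old layout_inj[OF lay] by metis
    next
      case False
      then show ?thesis using xy xy' eq old new fresh b'(2) uv(3) unfolding memE by (elim disjE) (metis+)
    qed
  next
    show "dom own2 \<subseteq> {..<n} \<union> {\<rho>' x y |x y. {x, y} \<in> ?E}"
    proof
      fix p assume "p \<in> dom own2"
      then have "p = a \<or> p = b' \<or> p \<in> dom ?own" unfolding domIff ow2 by (simp split: if_splits)
      then consider "p = a" | "p = b'" | "p \<in> dom ?own" by blast
      then show "p \<in> {..<n} \<union> {\<rho>' x y |x y. {x, y} \<in> ?E}"
      proof cases
        case 1
        then have "p = \<rho>' u v \<and> {u, v} \<in> ?E" using new by simp
        then show ?thesis by blast
      next
        case 2
        then have "p = \<rho>' v u \<and> {v, u} \<in> ?E" using new by (simp add: insert_commute)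
        then show ?thesis by blast
      next
        case 3
        have "dom ?own \<subseteq> {..<n} \<union> {\<rho> x y |x y. {x, y} \<in> E}" using lay by (simp add: layout_def)
        then consider "p < n" | x y where "p = \<rho> x y" "{x, y} \<in> E" using 3 by blast
        then show ?thesis
        proof cases
          case 2
          then have "p = \<rho>' x y \<and> {x, y} \<in> ?E" using old by simp
          then show ?thesis by blast
        qed simp
      qed
    qed
  qed
  define c1 where "c1 = upd (upd (upd (upd (?c(a := (\<lambda>_. 0), b' := (\<lambda>_. 0))) a 4 b') b' 4 a) a 5 v) b' 5 u"
  have c1: "c1 p g = ?c p g" if "p \<noteq> a" "p \<noteq> b'" for p g using that by (simp add: c1_def upd_apply)
  have c1n: "c1 a 4 = b'" "c1 a 5 = v" "c1 b' 4 = a" "c1 b' 5 = u" using b'(2) by (auto simp: c1_def upd_apply)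
  \<comment> \<open>Fresh records occur in no list, so initialising them disturbs none.\<close>
  have keep: "c1 p g = ?c p g" if "x < n" "p \<in> records_of E \<rho> x" for x p g
    using layout_owner[OF lay that] a b'(1) by (intro c1) auto
  have oE: "\<And>v u. u \<in> outs D v \<Longrightarrow> {v, u} \<in> E" using orients_edge[OF D] by (simp add: outs_def)
  have fE: "\<And>v u. u \<in> frees D m v \<Longrightarrow> {v, u} \<in> E"
    using orients_edge[OF D] by (fastforce simp: frees_def insert_commute)
  have ol1: "olist n \<rho>' c1 (outs D)" 
    by (rule olist_cong[where E = E, OF ol]) (erule oE, erule old, rule keep)
  have fl1: "flist n \<rho>' c1 (frees D m)" 
    by (rule flist_cong[where E = E, OF fl]) (erule fE, erule old, simp add: keep)
  have tw1: "twins ?E \<rho>' c1"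
    unfolding twins_def
  proof (intro allI impI)
    fix x y assume "{x, y} \<in> ?E"
    then consider "{x, y} \<in> E" | "x = u" "y = v" | "x = v" "y = u" unfolding memE by blast
    then show "c1 (\<rho>' x y) 4 = \<rho>' y x \<and> c1 (\<rho>' x y) 5 = y"
    proof cases
      case 1
      then have "{y, x} \<in> E" by (simp add: insert_commute)
      then show ?thesis using 1 tw old c1[OF fresh[OF 1]] by (simp add: twins_def)
    qed (use c1n new in auto)
  qed
  let ?c2 = "push_cells c1 u a"
  let ?c3 = "if m u = 0 then link_cells ?c2 v b' else ?c2"
  have nD: "(u, v) \<notin> D" "(v, u) \<notin> D"
    using orients_edge[OF D, of u v] orients_edge[OF D, of v u] uv(4) by (metis insert_commute)+
  have e: "{u, v} \<in> ?E" "{v, u} \<in> ?E" by (auto simp: insert_commute)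
  have c2f: "?c2 p g = c1 p g" if "g \<noteq> 1" for p g using that by (rule push_fields(2))
  have c3f: "?c3 p g = ?c2 p g" if "g \<noteq> 2" "g \<noteq> 3" for p g using that by (simp add: link_fields(3))
  have ol2: "olist n \<rho>' ?c2 (outs ?D)"
  proof -
    have "olist n \<rho>' (push_cells c1 u (\<rho>' u v)) ((outs D)(u := insert v (outs D u)))"
      by (rule olist_push[OF lay' ol1 _ uv(1) e(1)]) (use oE nD in \<open>auto simp: outs_def\<close>)
    moreover have "(outs D)(u := insert v (outs D u)) = outs ?D" by (auto simp: outs_def fun_eq_iff)
    ultimately show ?thesis using new by simp
  qed
  have c22: "?c2 p 2 = c1 p 2" "?c2 p 3 = c1 p 3" for p by (rule c2f, simp)+
  have fl2: "flist n \<rho>' ?c2 (frees D m)" using fl1 unfolding flist_def c22 .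
  have fl3: "flist n \<rho>' ?c3 (frees ?D m)"
  proof (cases "m u = 0")
    case True
    have "flist n \<rho>' (link_cells ?c2 v (\<rho>' v u)) ((frees D m)(v := insert u (frees D m v)))"
      by (rule flist_link[OF lay' fl2 _ uv(2) e(2)]) (use fE nD in \<open>auto simp: frees_def\<close>)
    moreover have "(frees D m)(v := insert u (frees D m v)) = frees ?D m"
      using True by (auto simp: frees_def fun_eq_iff)
    ultimately show ?thesis using new True by simp
  next
    case False
    then have "frees ?D m = frees D m" by (auto simp: frees_def fun_eq_iff)
    then show ?thesis using fl2 False by simp
  qed
  have c31: "?c3 p 1 = ?c2 p 1" for p by (rule c3f, simp_all)
  have ol3: "olist n \<rho>' ?c3 (outs ?D)" using ol2 unfolding olist_def c31 .
  have c3c: "?c3 p 4 = c1 p 4" "?c3 p 5 = c1 p 5" "?c3 p 0 = c1 p 0" for p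
    using c3f[of 4 p] c3f[of 5 p] c3f[of 0 p] c2f[of 4 p] c2f[of 5 p] c2f[of 0 p] by simp_all
  have tw3: "twins ?E \<rho>' ?c3" using tw1 unfolding twins_def c3c .
  have m3: "\<forall>x<n. ?c3 x 0 = m x" using m an c1 unfolding c3c by simp
  have pg: "proper_graph n ?E" using E uv unfolding proper_graph_def by blast
  have heap': "heap n ?E ?D m \<rho>' own2 ?c3"
    unfolding heap_def by (intro conjI pg orients_insert[OF D uv(4,3)] lay' tw3 ol3 fl3 m3)
  define s1 where "s1 = s\<lparr>reg := (reg s)(5 := a, 6 := b'), owner := own2, cell := c1\<rparr>"
  define s2 where "s2 = result (push 1 5) s1"
  define s3 where "s3 = result (if_free 1 (link 2 6)) s2"
  have ru: "?own u = Some u" "own1 v = Some v" using root uv an by (auto simp: own1_def)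
  have six: "result (Store 6 5 1) (result (Store 5 5 2) (result (Store 6 4 5) (result (Store 5 4 6)
     (result (Alloc 6 2) (result (Alloc 5 1) s))))) = s1"
    using r ru unfolding s1_def c1_def own2_def b'_def own1_def a_def
    by (simp add: Let_def upd_def)
  have al1: "result (Alloc 5 1) s = s\<lparr>reg := (reg s)(5 := a), owner := own1, cell := ?c(a := (\<lambda>_. 0))\<rparr>"
    using r ru unfolding own1_def a_def by (simp add: Let_def)
  have al2: "result (Alloc 6 2) (result (Alloc 5 1) s) =
      s\<lparr>reg := (reg s)(5 := a, 6 := b'), owner := own2, cell := ?c(a := (\<lambda>_. 0), b' := (\<lambda>_. 0))\<rparr>"
    unfolding al1 using r ru unfolding own2_def b'_def by (simp add: Let_def)
  have res: "result insert_com s = s3"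
    unfolding insert_com_def result.simps(1) six s2_def s3_def ..
  have r1: "reg s1 1 = u" "reg s1 2 = v" "reg s1 3 = 0" "reg s1 5 = a" "reg s1 6 = b'" "owner s1 = own2" "cell s1 = c1"
    using r by (auto simp: s1_def)
  have r2: "cell s2 = ?c2" "owner s2 = own2" "reg s2 1 = u" "reg s2 2 = v" "reg s2 3 = 0" "reg s2 6 = b'"
    unfolding s2_def using r1 by (simp_all add: result_push)
  have m2: "cell s2 u 0 = m u" using m uv an c1 unfolding r2(1) c2f[of 0, simplified] by simp
  have r3: "cell s3 = ?c3" "owner s3 = own2"
    unfolding s3_def result_if_free using r2 m2 by (auto simp: result_link)
  have rg: "reg s3 x = reg s x" if "x \<notin> settle_regs" for x
  proof -
    have "reg s2 x = reg s x" using that by (simp add: s2_def result_push s1_def settle_regs_def)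
    then show ?thesis
      using that r2 unfolding s3_def result_if_free by (auto simp: result_link settle_regs_def)
  qed
  have acc: "accessible L t p" if "owner t = own2" "p \<in> {u, v, a, b'}" for t p
    using that L lay' uv ow2 b'(2) an unfolding accessible_def layout_def by auto
  have safe6: "safe W N L (Alloc 5 1) s" "safe W N L (Alloc 6 2) (result (Alloc 5 1) s)"
  proof -
    show "safe W N L (Alloc 5 1) s" using r ru L N by (auto simp: accessible_def)
    have "dom own1 = insert a (dom ?own)" by (auto simp: own1_def split: if_splits)
    then have "card (dom own1) \<le> Suc (card (dom ?own))" using fin by (simp add: card_insert_if)
    then have "card (dom own1) < N" using N(1) by linarith
    then show "safe W N L (Alloc 6 2) (result (Alloc 5 1) s)"
      unfolding al1 using r ru L N by (simp add: accessible_def)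
  qed
  have accs: "accessible L (s\<lparr>reg := r, owner := own2\<rparr>) p" if "p \<in> {u, v, a, b'}" for p r
    by (rule acc[OF _ that]) simp
  have sfp: "safe W N L (push 1 5) s1" by (rule safe_push) (use acc[of s1] r1 in simp_all)
  have sfi: "safe W N L (if_free 1 (link 2 6)) s2"
  proof (rule safe_if_free)
    show "reg s2 3 = 0" "accessible L s2 (reg s2 1)" using r2 acc[of s2] by simp_all
    show "safe W N L (link 2 6) (s2\<lparr>reg := (reg s2)(10 := 0)\<rparr>)"
    proof (rule safe_link)
      assume "0 < cell (s2\<lparr>reg := (reg s2)(10 := 0)\<rparr>) (reg (s2\<lparr>reg := (reg s2)(10 := 0)\<rparr>) 2) 2"
      then have "0 < ?c2 v 2" using r2 by simp
      then have "?c2 v 2 \<in> records_of ?E \<rho>' v"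
        using flist_head[OF lay' fl2 _ uv(2)] fE by (fastforce split: if_splits)
      from accessible_record[of n ?E \<rho>' s2, OF _ uv(2) this L(2)] r2 lay'
      show "accessible L (s2\<lparr>reg := (reg s2)(10 := 0)\<rparr>) (cell (s2\<lparr>reg := (reg s2)(10 := 0)\<rparr>) (reg (s2\<lparr>reg := (reg s2)(10 := 0)\<rparr>) 2) 2)"
        by simp
    qed (use r2 acc[of s2] in simp_all)
  qed
  have sf: "safe W N L insert_com s"
    unfolding insert_com_def safe.simps(1) six s2_def[symmetric]
    unfolding al2 by (intro conjI safe6 sfp sfi) (use accs r in simp_all)
  have "loop_free insert_com" "max_time insert_com \<le> 100"
    by (simp_all add: insert_com_def push_def if_free_def link_def)
  from exec_straight[OF sf b this res] obtain k where k: "k \<le> 100" "exec (bounded W N) L insert_com s k s3"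
    by - (elim exE conjE, rule that, assumption+)
  have "heap n ?E ?D m \<rho>' (owner s3) (cell s3)" unfolding r3 by (rule heap')
  then show ?thesis using k rg by (intro exI[of _ k] exI[of _ s3] exI[of _ \<rho>'] conjI allI impI)
qed

lemma delete_exec:
  assumes h: "heap n E D m \<rho> (owner s) (cell s)" and r: "reg s 1 = u" "reg s 2 = v" "reg s 3 = 0" "reg s 4 = 1"
    and uv: "outs D u = {v}" "outs D v = {}" and b: "bounded W N s" and W: "n \<le> W"
    and L: "u \<in> L" "v \<in> L"
  defines "m' \<equiv> if m u = Suc v then m(u := 0, v := 0) else m"
  shows "\<exists>k s'. k \<le> 100 \<and> exec (bounded W N) L delete_com s k s' \<and>
    heap n (E - {{u, v}}) (D - {(u, v)}) m' \<rho> (owner s') (cell s') \<and>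
    (\<forall>x. x \<notin> settle_regs \<longrightarrow> reg s' x = reg s x)"
proof -
  from h have E: "proper_graph n E" and D: "orients E D" and lay: "layout n E \<rho> (owner s)"
    and tw: "twins E \<rho> (cell s)" and ol: "olist n \<rho> (cell s) (outs D)"
    and fl: "flist n \<rho> (cell s) (frees D m)" and m: "\<forall>v<n. cell s v 0 = m v"
    unfolding heap_def by blast+
  let ?E = "E - {{u, v}}" and ?D = "D - {(u, v)}" and ?own = "owner s" and ?c = "cell s"
  have uvD: "(u, v) \<in> D" using uv(1) by (auto simp: outs_def)
  have e: "{u, v} \<in> E" "{v, u} \<in> E" using orients_edge[OF D uvD] by (simp_all add: insert_commute)
  have un: "u < n" and vn: "v < n" and ne: "u \<noteq> v" using proper_graphD[OF E e(1)] by auto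
  have oE: "\<And>v u. u \<in> outs D v \<Longrightarrow> {v, u} \<in> E" using orients_edge[OF D] by (simp add: outs_def)
  have fE: "\<And>v u. u \<in> frees D m v \<Longrightarrow> {v, u} \<in> E"
    using orients_edge[OF D] by (fastforce simp: frees_def insert_commute)
  define r where "r = \<rho> u v"
  define t where "t = \<rho> v u"
  have "outs D u \<noteq> {}" using uv(1) by simp
  from olist_pop[OF lay ol oE un this]
  have pop: "?c u 1 = r" "olist n \<rho> (upd ?c u 1 (?c r 1)) ((outs D)(u := {}))"
    unfolding uv(1) r_def by auto
  have tw': "?c r 4 = t" using tw e unfolding r_def t_def by (simp add: twins_def)
  have ow: "?own r = Some u" "?own t = Some v" "n \<le> r" "n \<le> t" "?own u = Some u" "?own v = Some v"
    using lay e un vn unfolding r_def t_def by (simp_all add: layout_def)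
  define c1 where "c1 = upd ?c u 1 (?c r 1)"
  define c2 where "c2 = (if m u = 0 then unlink_cells c1 t else c1)"
  have c1f: "c1 p g = ?c p g" if "g \<noteq> 1" for p g using that by (simp add: c1_def upd_apply)
  have c2f: "c2 p g = c1 p g" if "g \<noteq> 2" "g \<noteq> 3" for p g using that by (simp add: c2_def unlink_fields(3))
  have c1l: "c1 p 2 = ?c p 2" "c1 p 3 = ?c p 3" for p by (rule c1f, simp)+
  have c2o: "c2 p 1 = c1 p 1" for p by (rule c2f, simp_all)
  have c2r: "c2 p 4 = ?c p 4" "c2 p 5 = ?c p 5" "c2 p 0 = ?c p 0" for p
    using c2f[of 4 p] c2f[of 5 p] c2f[of 0 p] c1f[of 4 p] c1f[of 5 p] c1f[of 0 p] by simp_all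
  have oD: "outs ?D = (outs D)(u := {})" using uv(1) by (auto simp: outs_def fun_eq_iff)
  have ol2: "olist n \<rho> c2 (outs ?D)" using pop(2) unfolding olist_def c2o oD c1_def .
  have fl1: "flist n \<rho> c1 (frees D m)" using fl unfolding flist_def c1l .
  have uin: "u \<in> frees D m v" if "m u = 0" using that uvD by (simp add: frees_def)
  have fl2: "flist n \<rho> c2 (frees ?D m)"
  proof (cases "m u = 0")
    case True
    have "frees ?D m = (frees D m)(v := frees D m v - {u})" by (auto simp: frees_def fun_eq_iff)
    then show ?thesis using flist_unlink(1)[OF lay fl1 fE vn uin[OF True]] True
      unfolding c2_def t_def by simp
  next
    case False
    then have "frees ?D m = frees D m" by (auto simp: frees_def fun_eq_iff)
    then show ?thesis using fl1 False unfolding c2_def by simp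
  qed
  let ?own' = "?own(r := None, t := None)"
  have lay2: "layout n ?E \<rho> ?own'"
  proof -
    have neq: "\<rho> x y \<noteq> r \<and> \<rho> x y \<noteq> t" if "{x, y} \<in> ?E" for x y
    proof -
      have xy: "{x, y} \<in> E" "{x, y} \<noteq> {u, v}" using that by auto
      have o: "?own (\<rho> x y) = Some x" using lay xy(1) by (simp add: layout_def)
      have "\<rho> x y \<noteq> r"
      proof
        assume eq: "\<rho> x y = r"
        then have "x = u" using o ow(1) by simp
        then have "y = v" using layout_inj[OF lay, of u y v] xy(1) e(1) eq unfolding r_def by simp
        then show False using xy(2) \<open>x = u\<close> by simp
      qed
      moreover have "\<rho> x y \<noteq> t"
      proof
        assume eq: "\<rho> x y = t"
        then have "x = v" using o ow(2) by simp
        then have "y = u" using layout_inj[OF lay, of v y u] xy(1) e(2) eq unfolding t_def by simp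
        then show False using xy(2) \<open>x = v\<close> by (simp add: insert_commute)
      qed
      ultimately show ?thesis by simp
    qed
    have sub: "dom ?own \<subseteq> {..<n} \<union> {\<rho> u v | u v. {u, v} \<in> E}" using lay by (simp add: layout_def)
    show ?thesis unfolding layout_def
    proof (intro conjI allI impI)
      show "?own' p = Some p" if "p < n" for p using that ow(3,4) lay by (simp add: layout_def)
      fix x y assume xy: "{x, y} \<in> ?E"
      then have "{x, y} \<in> E" by simp
      then show "n \<le> \<rho> x y" "?own' (\<rho> x y) = Some x" using neq[OF xy] lay by (simp_all add: layout_def)
    next
      fix x y y' assume "{x, y} \<in> ?E" "{x, y'} \<in> ?E" "\<rho> x y = \<rho> x y'"
      then show "y = y'" using layout_inj[OF lay, of x y y'] by simp
    next
      show "dom ?own' \<subseteq> {..<n} \<union> {\<rho> x y |x y. {x, y} \<in> ?E}"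
      proof
        fix p assume "p \<in> dom ?own'"
        then have p: "p \<in> dom ?own" "p \<noteq> r" "p \<noteq> t" by (auto split: if_splits)
        then consider "p < n" | x y where "p = \<rho> x y" "{x, y} \<in> E" using sub by blast
        then show "p \<in> {..<n} \<union> {\<rho> x y |x y. {x, y} \<in> ?E}"
        proof cases
          case 2
          have "{x, y} \<noteq> {u, v}"
          proof
            assume "{x, y} = {u, v}"
            then have "x = u \<and> y = v \<or> x = v \<and> y = u" by (simp add: doubleton_eq_iff)
            then show False using 2(1) p(2,3) unfolding r_def t_def by auto
          qed
          then have "p = \<rho> x y \<and> {x, y} \<in> ?E" using 2 by simp
          then show ?thesis by blast
        qed simp
      qed
    qed
  qed
  have tw2: "twins ?E \<rho> c2" using tw unfolding twins_def c2r by simp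
  have m2: "\<forall>x<n. c2 x 0 = m x" using m unfolding c2r .
  have pg: "proper_graph n ?E" using E unfolding proper_graph_def by simp
  have heap2: "heap n ?E ?D m \<rho> ?own' c2"
    unfolding heap_def by (intro conjI pg orients_delete[OF D uvD] lay2 tw2 ol2 fl2 m2)
  \<comment> \<open>Without the deleted edge both endpoints have no out-edges, so their mates can be
    reset silently.\<close>
  have em: "outs ?D u = {}" "outs ?D v = {}" using uv by (auto simp: outs_def)
  define c3 where "c3 = (if m u = Suc v then upd (upd c2 u 0 0) v 0 0 else c2)"
  have heap3: "heap n ?E ?D m' \<rho> ?own' c3"
    unfolding m'_def c3_def using heap2 heap_set_mate[OF heap_set_mate[OF heap2 un em(1)] vn em(2)] by simp
  define s1 where "s1 = s\<lparr>reg := (reg s)(5 := r, 6 := t, 8 := ?c r 1), cell := c1\<rparr>"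
  define s2 where "s2 = result (if_free 1 (unlink 6)) s1"
  define s3 where "s3 = s2\<lparr>owner := ?own'\<rparr>"
  define s4 where "s4 = s3\<lparr>reg := (reg s3)(10 := m u, 13 := Suc v)\<rparr>"
  define s5 where "s5 = s4\<lparr>cell := c3\<rparr>"
  have four: "result (Store 1 1 8) (result (Load 8 5 1) (result (Load 6 5 4) (result (Load 5 1 1) s))) = s1"
    using assms(2-5) pop(1) tw' unfolding s1_def c1_def by (simp add: upd_def)
  have r1: "reg s1 1 = u" "reg s1 2 = v" "reg s1 3 = 0" "reg s1 4 = 1" "reg s1 5 = r" "reg s1 6 = t"
    "owner s1 = ?own" "cell s1 = c1" using assms(2-5) by (auto simp: s1_def)
  have m1: "c1 u 0 = m u" using m un c1f by simp
  have r2: "reg s2 1 = u" "reg s2 2 = v" "reg s2 3 = 0" "reg s2 4 = 1" "reg s2 5 = r" "reg s2 6 = t"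
    "owner s2 = ?own" "cell s2 = c2"
    unfolding s2_def result_if_free c2_def using r1 m1 by (auto simp: result_unlink)
  have rg2: "reg s2 x = reg s x" if "x \<notin> settle_regs" for x
    using that r1 unfolding s2_def result_if_free by (auto simp: result_unlink settle_regs_def s1_def)
  have fr: "result (Free 6) (result (Free 5) s2) = s3"
    using r2 ow un vn unfolding s3_def by auto
  have m2u: "c2 u 0 = m u" using m2 un by simp
  have ld: "result (Add 13 2 4) (result (Load 10 1 0) s3) = s4"
    using r2 m2u unfolding s4_def s3_def by simp
  have tail: "result (IfLess 10 13 Skip (IfLess 13 10 Skip (Seq (Store 1 0 3) (Store 2 0 3)))) s4 = s5"
  proof (cases "m u = Suc v")
    case True
    then show ?thesis using r2 unfolding s5_def s4_def s3_def c3_def by (simp add: upd_def)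
  next
    case False
    then consider "m u < Suc v" | "Suc v < m u" by linarith
    then show ?thesis using False r2 unfolding s5_def s4_def s3_def c3_def by cases simp_all
  qed
  have res: "result delete_com s = s5"
    unfolding delete_com_def result.simps(1) four s2_def[symmetric] fr ld tail ..
  have acc: "accessible L t' p" if "owner t' = ?own" "p \<in> {u, v, r, t}" for t' p
    using that L ow by (auto simp: accessible_def)
  have acc': "accessible L t' p" if "owner t' = ?own'" "p \<in> {u, v}" for t' p
    using that L ow un vn by (auto simp: accessible_def)
  have s0: "safe W N L (Load 5 1 1) s" "safe W N L (Load 6 5 4) (result (Load 5 1 1) s)"
    "safe W N L (Load 8 5 1) (result (Load 6 5 4) (result (Load 5 1 1) s))"
    "safe W N L (Store 1 1 8) (result (Load 8 5 1) (result (Load 6 5 4) (result (Load 5 1 1) s)))"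
    using assms(2-5) pop(1) acc[of s] by simp_all
  have sfu: "safe W N L (if_free 1 (unlink 6)) s1"
  proof (rule safe_if_free)
    show "reg s1 3 = 0" "accessible L s1 (reg s1 1)" using r1 acc[of s1] by simp_all
    assume "cell s1 (reg s1 1) 0 = 0"
    then have mu0: "m u = 0" using r1 m1 by simp
    note un' = flist_unlink(2,3)[OF lay fl1 fE vn uin[OF mu0], folded t_def]
    have a3: "accessible L s1 p" if "p \<in> records_of E \<rho> v" for p
      using accessible_record[of n E \<rho> s1 v p L] lay vn that L(2) r1 by simp
    show "safe W N L (unlink 6) (s1\<lparr>reg := (reg s1)(10 := 0)\<rparr>)"
      by (rule safe_unlink) (use r1 acc[of s1] a3 un' in simp_all)
  qed
  have sff: "safe W N L (Free 5) s2" "safe W N L (Free 6) (result (Free 5) s2)"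
    using r2 acc[of s2] ow un vn ne L by (auto simp: accessible_def)
  have sfl: "safe W N L (Load 10 1 0) s3" "safe W N L (Add 13 2 4) (result (Load 10 1 0) s3)"
    using r2 acc'[of s3] vn W by (auto simp: s3_def)
  have sft: "safe W N L (IfLess 10 13 Skip (IfLess 13 10 Skip (Seq (Store 1 0 3) (Store 2 0 3)))) s4"
    using r2 acc'[of s4] by (simp add: s4_def s3_def)
  have sf: "safe W N L delete_com s"
    unfolding delete_com_def safe.simps(1) four s2_def[symmetric] fr ld
    by (intro conjI s0 sfu sff sfl sft)
  have "loop_free delete_com" "max_time delete_com \<le> 100"
    by (simp_all add: delete_com_def if_free_def unlink_def)
  from exec_straight[OF sf b this res] obtain k where k: "k \<le> 100" "exec (bounded W N) L delete_com s k s5"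
    by - (elim exE conjE, rule that, assumption+)
  have "owner s5 = ?own'" "cell s5 = c3" by (simp_all add: s5_def s4_def s3_def)
  then have "heap n ?E ?D m' \<rho> (owner s5) (cell s5)" using heap3 by simp
  moreover have "reg s5 x = reg s x" if "x \<notin> settle_regs" for x
    using that rg2[OF that] by (simp add: s5_def s4_def s3_def settle_regs_def)
  ultimately show ?thesis using k by (intro exI[of _ k] exI[of _ s5] conjI allI impI)
qed

section \<open>One complete update\<close>

lemma mutual_insert: "mutual n E m \<Longrightarrow> mutual n (insert e E) m"
  unfolding mutual_def by blast

lemma saturated_insert: "saturated E {} m \<Longrightarrow> saturated (insert {u, v} E) {u, v} m"
  unfolding saturated_def by (auto simp: doubleton_eq_iff)

lemma saturated_delete:
  "saturated E {} m \<Longrightarrow> saturated (E - {{u, v}}) {u, v} (if m u = Suc v then m(u := 0, v := 0) else m)"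
  unfolding saturated_def by auto

lemma mutual_delete:
  assumes m: "mutual n E m" and uv: "u < n" "v < n" "u \<noteq> v"
  shows "mutual n (E - {{u, v}}) (if m u = Suc v then m(u := 0, v := 0) else m)"
    (is "mutual n _ ?m")
  unfolding mutual_def
proof (intro allI impI)
  fix x w assume x: "x < n" "?m x = Suc w"
  then have mx: "m x = Suc w" by (auto split: if_splits)
  have e: "{x, w} \<in> E" "m w = Suc x" using m x(1) mx unfolding mutual_def by blast+
  show "{x, w} \<in> E - {{u, v}} \<and> ?m w = Suc x"
  proof (cases "m u = Suc v")
    case True
    then have mv: "m v = Suc u" using m uv unfolding mutual_def by blast
    have xn: "x \<noteq> u" "x \<noteq> v" using x(2) True by (auto split: if_splits)
    have "w \<noteq> u" "w \<noteq> v" using xn e(2) True mv by auto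
    then show ?thesis using e xn True by (auto simp: doubleton_eq_iff)
  next
    case False
    have "{x, w} \<noteq> {u, v}"
    proof
      assume "{x, w} = {u, v}"
      then have "x = u \<and> w = v \<or> x = v \<and> w = u" by (simp add: doubleton_eq_iff)
      then show False using False mx e(2) by auto
    qed
    then show ?thesis using e False by simp
  qed
qed

text \<open>A disagreement with \<open>R'\<close> after the change is an old disagreement, a pair
  that the reference has given up, or the new pair \<open>p\<close>.\<close>

lemma edge_change_potential:
  assumes "finite D" "finite R" "D' \<subseteq> insert p D"
  shows "card (D' - R') \<le> card (D - R) + card (R - R') + 1"
proof -
  have "D' - R' \<subseteq> insert p ((D - R) \<union> (R - R'))" using assms(3) by auto
  then have "card (D' - R') \<le> card (insert p ((D - R) \<union> (R - R')))"
    using assms(1,2) by (intro card_mono) auto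
  also have "\<dots> \<le> Suc (card ((D - R) \<union> (R - R')))" using assms(1,2) by (simp add: card_insert_if)
  also have "card ((D - R) \<union> (R - R')) \<le> card (D - R) + card (R - R')" by (rule card_Un_le)
  finally show ?thesis by simp
qed

text \<open>As no mate is lost while settling, a new partner has turned from free to matched at the
  end; this later shows that it is involved.\<close>

lemma settle_both:
  assumes E: "proper_graph n E" and D: "orients E D" and m: "mutual n E m" "saturated E {u, v} m"
    and uv: "u < n" "v < n"
    and s1: "settle_rel E u D m D1 m1 X1 c1" and s2: "settle_rel E v D1 m1 D2 m2 X2 c2"
  shows "orients E D2" "mutual n E m2" "saturated E {} m2"
    "\<And>x. x \<in> X1 \<union> X2 \<Longrightarrow> m x = 0 \<and> m2 x \<noteq> 0 \<and> ({u, x} \<in> E \<or> {v, x} \<in> E)"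
    "\<And>x. m2 x \<noteq> m x \<Longrightarrow> x \<in> {u, v} \<union> X1 \<union> X2"
    "\<And>R d. orients E R \<Longrightarrow> \<forall>v. card (outs R v) \<le> d \<Longrightarrow>
       c1 + c2 + card (D2 - R) \<le> card (D - R) + 8 * d"
proof -
  have D1: "orients E D1" using settle_rel_orients[OF s1 D] .
  show "orients E D2" using settle_rel_orients[OF s2 D1] .
  note a = settle_rel_mates[OF E m s1 uv(1)]
  note b = settle_rel_mates[OF E a(1,2) s2 uv(2)]
  show "mutual n E m2" by (rule b(1))
  have "{u, v} - {u} - {v} = {}" by auto
  then show "saturated E {} m2" using b(2) by (simp only:)
  show "m x = 0 \<and> m2 x \<noteq> 0 \<and> ({u, x} \<in> E \<or> {v, x} \<in> E)" if "x \<in> X1 \<union> X2" for x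
  proof (cases "x \<in> X1")
    case True
    then show ?thesis using a(5)[OF True] b(3)[of x] by simp
  next
    case False
    then have "x \<in> X2" using that by simp
    then show ?thesis using b(5)[of x] a(3)[of x] by fastforce
  qed
  show "x \<in> {u, v} \<union> X1 \<union> X2" if "m2 x \<noteq> m x" for x
    using that a(4)[of x] b(4)[of x] by fastforce
  show "c1 + c2 + card (D2 - R) \<le> card (D - R) + 8 * d"
    if "orients E R" "\<forall>v. card (outs R v) \<le> d" for R d
    using settle_rel_potential[OF E D that s1] settle_rel_potential[OF E D1 that s2] by linarith
qed

text \<open>Besides the roots there are two records per edge, one at each endpoint.\<close>

lemma layout_card:
  assumes lay: "layout n E \<rho> own" and E: "proper_graph n E"
  shows "finite (dom own)" "card (dom own) \<le> n + 2 * card E"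
proof -
  let ?P = "{(u, v). {u, v} \<in> E}"
  have sub: "dom own \<subseteq> {..<n} \<union> (\<lambda>(u, v). \<rho> u v) ` ?P" using lay unfolding layout_def by auto
  have fE: "finite E" using proper_graph_finite[OF E] by simp
  have P: "?P \<subseteq> (\<Union>e\<in>E. {(u, v). {u, v} = e})" by auto
  have two: "finite {(u, v). {u, v} = e} \<and> card {(u, v). {u, v} = e} \<le> 2" if e: "e \<in> E" for e
  proof -
    obtain a b where ab: "e = {a, b}" using E e unfolding proper_graph_def by blast
    have s: "{(u, v). {u, v} = e} \<subseteq> {(a, b), (b, a)}" unfolding ab by (auto simp: doubleton_eq_iff)
    have "card (set [(a, b), (b, a)]) \<le> length [(a, b), (b, a)]" by (rule card_length)
    then have "card {(a, b), (b, a)} \<le> 2" by (simp only: list.set list.size)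
    then have "card {(u, v). {u, v} = e} \<le> 2" using card_mono[OF _ s] by (meson finite.intros order_trans)
    moreover have "finite {(u, v). {u, v} = e}" by (rule finite_subset[OF s]) simp
    ultimately show ?thesis by (rule conjI[rotated])
  qed
  have fU: "finite (\<Union>e\<in>E. {(u, v). {u, v} = e})" using fE two by blast
  then have fP: "finite ?P" using P finite_subset by blast
  have "card ?P \<le> card (\<Union>e\<in>E. {(u, v). {u, v} = e})" by (rule card_mono[OF fU P])
  also have "\<dots> \<le> (\<Sum>e\<in>E. card {(u, v). {u, v} = e})" by (rule card_UN_le[OF fE])
  also have "\<dots> \<le> (\<Sum>e\<in>E. 2)" using two by (intro sum_mono) blast
  finally have cP: "card ?P \<le> 2 * card E" by simp
  show "finite (dom own)" using sub fP by (meson finite_UnI finite_imageI finite_lessThan finite_subset)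
  have "card (dom own) \<le> card ({..<n} \<union> (\<lambda>(u, v). \<rho> u v) ` ?P)" using sub fP by (intro card_mono) auto
  also have "\<dots> \<le> card {..<n} + card ((\<lambda>(u, v). \<rho> u v) ` ?P)" by (rule card_Un_le)
  also have "\<dots> \<le> n + card ?P" using card_image_le[OF fP] by simp
  finally show "card (dom own) \<le> n + 2 * card E" using cP by simp
qed

text \<open>\<open>I\<close> will consist of the endpoints and the new partners. The conditions on
  mates bound it from both sides, so that it can be identified with the set of involved vertices, by
  which locality is measured.\<close>

lemma process_exec:
  assumes h: "heap n E D m \<rho> (owner s) (cell s)" and mm: "mutual n E m" "saturated E {} m"
    and val: "valid_update n E up" and cW: "\<And>p f. cell s p f \<le> W"
  defines "E' \<equiv> apply_update E up"
  assumes W: "1 \<le> W" "n \<le> W" "n + 2 * card E' + 2 \<le> W"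
  shows "\<exists>k s' D' m' \<rho>' I. exec (bounded W (n + 2 * card E' + 2)) (closed_nbhd E' I) matching_com (s\<lparr>reg := input up\<rparr>) k s' \<and>
    heap n E' D' m' \<rho>' (owner s') (cell s') \<and> mutual n E' m' \<and> saturated E' {} m' \<and>
    endpoints up \<subseteq> I \<and> I \<subseteq> closed_nbhd E' (endpoints up) \<and>
    (\<forall>x\<in>I. x \<in> endpoints up \<or> x < n \<and> m x = 0 \<and> m' x \<noteq> 0) \<and> (\<forall>x<n. m x \<noteq> m' x \<longrightarrow> x \<in> I) \<and>
    amortised 1000 E E' D D' k"
proof -
  from h have E: "proper_graph n E" and D: "orients E D" and lay: "layout n E \<rho> (owner s)"
    unfolding heap_def by blast+
  have fE: "finite E" using proper_graph_finite[OF E] by simp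
  obtain u v where ep: "endpoints up = {u, v}" and rg: "input up 1 = u" "input up 2 = v" "input up 3 = 0"
    "\<And>x. input up x \<le> max 1 (max u v)"
    and cs: "up = Insert u v \<or> up = Delete u v"
    by (cases up) (auto simp: max_def)
  have uv: "u < n" "v < n" "u \<noteq> v"
    using val cs proper_graphD[OF E, of u v] by auto
  \<comment> \<open>The additive 2 accounts for the records of an edge to be deleted, which is no
    longer counted in \<open>E'\<close> but still stored.\<close>
  let ?N = "n + 2 * card E' + 2"
  let ?B = "bounded W ?N"
  let ?s0 = "s\<lparr>reg := input up\<rparr>"
  have cE: "card E \<le> card E' + 1"
    using fE cs unfolding E'_def by (auto simp: card_Diff_singleton_if card_insert_if)
  have b0: "?B ?s0"
  proof -
    have "input up x \<le> W" for x using rg(4)[of x] uv(1,2) W(1,2) by (simp add: max_def split: if_splits)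
    moreover have "card (dom (owner s)) \<le> ?N" using layout_card(2)[OF lay E] cE by linarith
    ultimately show ?thesis using cW layout_card(1)[OF lay E] by (simp add: bounded_def)
  qed
  let ?s1 = "?s0\<lparr>reg := (input up)(4 := 1)\<rparr>"
  have "\<exists>k\<le>1. exec ?B {} (Const 4 1) ?s0 k ?s1"
    by (rule exec_primitive[OF _ b0]) (use W in simp_all)
  then obtain k1 where k1: "k1 \<le> 1" "exec ?B {} (Const 4 1) ?s0 k1 ?s1" by blast
  have b1: "?B ?s1" using exec_bound[OF k1(2)] by simp
  have h1: "heap n E D m \<rho> (owner ?s1) (cell ?s1)" using h by simp
  have r1: "reg ?s1 1 = u" "reg ?s1 2 = v" "reg ?s1 3 = 0" "reg ?s1 4 = 1" "reg ?s1 0 = input up 0"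
    using rg by simp_all
  have f12: "(1::nat) \<notin> insert 3 flush_regs" "(2::nat) \<notin> insert 3 flush_regs" by (simp_all add: flush_regs_def)
  let ?D1 = "flush u D" and ?D2 = "flush v (flush u D)"
  have D1: "orients E ?D1" and D2: "orients E ?D2" by (intro orients_flush D)+
  from flush_exec[OF h1 r1(1) uv(1) f12(1) r1(3) b1 order_refl]
  obtain k2 s2 where s2: "k2 \<le> 3 + 102 * card (outs D u)" "exec ?B (closed_nbhd E {u}) (flush_com 1) ?s1 k2 s2"
    "heap n E ?D1 m \<rho> (owner s2) (cell s2)" "owner s2 = owner ?s1"
    "\<forall>x. x \<notin> flush_regs \<longrightarrow> reg s2 x = reg ?s1 x" by - (elim exE conjE, rule that, assumption+)
  have r2: "reg s2 1 = u" "reg s2 2 = v" "reg s2 3 = 0" "reg s2 4 = 1" "reg s2 0 = input up 0"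
    using s2(5) r1 by (simp_all add: flush_regs_def)
  have b2: "?B s2" using exec_bound[OF s2(2)] by simp
  from flush_exec[OF s2(3) r2(2) uv(2) f12(2) r2(3) b2 order_refl]
  obtain k3 s3 where s3: "k3 \<le> 3 + 102 * card (outs ?D1 v)" "exec ?B (closed_nbhd E {v}) (flush_com 2) s2 k3 s3"
    "heap n E ?D2 m \<rho> (owner s3) (cell s3)" "owner s3 = owner s2"
    "\<forall>x. x \<notin> flush_regs \<longrightarrow> reg s3 x = reg s2 x" by - (elim exE conjE, rule that, assumption+)
  have r3: "reg s3 1 = u" "reg s3 2 = v" "reg s3 3 = 0" "reg s3 4 = 1" "reg s3 0 = input up 0"
    using s3(5) r2 by (simp_all add: flush_regs_def)
  have b3: "?B s3" using exec_bound[OF s3(2)] by simp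
  have "\<exists>k4 s4 D3 m3 \<rho>'. k4 \<le> 101 \<and> exec ?B {u, v} (IfLess 0 4 insert_com delete_com) s3 k4 s4 \<and>
     heap n E' D3 m3 \<rho>' (owner s4) (cell s4) \<and> (\<forall>x. x \<notin> settle_regs \<longrightarrow> reg s4 x = reg s3 x) \<and>
     D3 \<subseteq> insert (u, v) ?D2 \<and> mutual n E' m3 \<and> saturated E' {u, v} m3 \<and> (\<forall>x. x \<notin> {u, v} \<longrightarrow> m3 x = m x)"
  proof (cases "up = Insert u v")
    case True
    then have nE: "{u, v} \<notin> E" and E': "E' = insert {u, v} E" using val by (auto simp: E'_def)
    have "card (dom (owner s3)) + 2 \<le> ?N"
      using layout_card(2)[OF lay E] s3(4) s2(4) E' fE nE by simp
    from insert_exec[OF s3(3) r3(1-3) uv nE b3 this W(3), of "{u, v}"]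
    obtain k s4 \<rho>' where s4: "k \<le> 100" "exec ?B {u, v} insert_com s3 k s4"
      "heap n (insert {u, v} E) (insert (u, v) ?D2) m \<rho>' (owner s4) (cell s4)"
      "\<forall>x. x \<notin> settle_regs \<longrightarrow> reg s4 x = reg s3 x" by auto
    have "exec ?B {u, v} (IfLess 0 4 insert_com delete_com) s3 (Suc k) s4"
      using r3 s4(2) b3 True by (intro exec_If) simp_all
    then show ?thesis
      using s4 mutual_insert[OF mm(1)] saturated_insert[OF mm(2)] unfolding E'
      by (intro exI[of _ "Suc k"] exI[of _ s4] exI[of _ "insert (u, v) ?D2"] exI[of _ m] exI[of _ \<rho>'] conjI) simp_all
  next
    case False
    then have up: "up = Delete u v" using cs by simp
    then have e: "{u, v} \<in> E" and E': "E' = E - {{u, v}}" using val by (auto simp: E'_def)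
    have ov: "outs ?D2 v = {}" by (rule outs_flush[OF D1])
    have "(v, u) \<notin> ?D2" using ov by (auto simp: outs_def)
    then have uvD: "(u, v) \<in> ?D2" using orients_cases[OF D2 e] by simp
    have "outs ?D1 u = {}" by (rule outs_flush[OF D])
    \<comment> \<open>Flushing \<open>v\<close> after \<open>u\<close> can give back to
      \<open>u\<close> only the edge between them.\<close>
    then have "outs ?D2 u \<subseteq> {v}" using mem_flush[OF D1] by (auto simp: outs_def split: if_splits)
    then have ou: "outs ?D2 u = {v}" using uvD by (auto simp: outs_def)
    let ?m = "if m u = Suc v then m(u := 0, v := 0) else m"
    from delete_exec[OF s3(3) r3(1-4) ou ov b3 W(2), of "{u, v}"]
    obtain k s4 where s4: "k \<le> 100" "exec ?B {u, v} delete_com s3 k s4"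
      "heap n (E - {{u, v}}) (?D2 - {(u, v)}) ?m \<rho> (owner s4) (cell s4)"
      "\<forall>x. x \<notin> settle_regs \<longrightarrow> reg s4 x = reg s3 x" by auto
    have "exec ?B {u, v} (IfLess 0 4 insert_com delete_com) s3 (Suc k) s4"
      using r3 s4(2) b3 up by (intro exec_If) simp_all
    moreover have "?D2 - {(u, v)} \<subseteq> insert (u, v) ?D2" by auto
    moreover have "\<forall>x. x \<notin> {u, v} \<longrightarrow> ?m x = m x" by simp
    ultimately show ?thesis
      using s4 mutual_delete[OF mm(1) uv] saturated_delete[OF mm(2), of u v] unfolding E'
      by (intro exI[of _ "Suc k"] exI[of _ s4] exI[of _ "?D2 - {(u, v)}"] exI[of _ ?m] exI[of _ \<rho>] conjI)
        (assumption | simp only: le_SucI Suc_le_mono | simp)+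
  qed
  then obtain k4 s4 D3 m3 \<rho>' where s4: "k4 \<le> 101" "exec ?B {u, v} (IfLess 0 4 insert_com delete_com) s3 k4 s4"
     "heap n E' D3 m3 \<rho>' (owner s4) (cell s4)" "\<forall>x. x \<notin> settle_regs \<longrightarrow> reg s4 x = reg s3 x"
     "D3 \<subseteq> insert (u, v) ?D2" "mutual n E' m3" "saturated E' {u, v} m3" "\<forall>x. x \<notin> {u, v} \<longrightarrow> m3 x = m x"
    by - (elim exE conjE, rule that, assumption+)
  have E'p: "proper_graph n E'" and D3: "orients E' D3" using s4(3) by (auto simp: heap_def)
  have r4: "reg s4 1 = u" "reg s4 2 = v" "reg s4 3 = 0" "reg s4 4 = 1"
    using s4(4) r3 by (simp_all add: settle_regs_def)
  have b4: "?B s4" using exec_bound[OF s4(2)] by simp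
  from settle_exec[OF s4(3) r4(1) uv(1) _ r4(3,4) b4 W(2)]
  obtain k5 s5 D4 m4 X1 c1 where s5: "k5 \<le> 100 + 102 * c1"
    "exec ?B (closed_nbhd E' (insert u X1)) (settle_com 1) s4 k5 s5"
    "heap n E' D4 m4 \<rho>' (owner s5) (cell s5)" "owner s5 = owner s4"
    "\<forall>x. x \<notin> settle_regs \<longrightarrow> reg s5 x = reg s4 x" "settle_rel E' u D3 m3 D4 m4 X1 c1" by auto
  have r5: "reg s5 1 = u" "reg s5 2 = v" "reg s5 3 = 0" "reg s5 4 = 1"
    using s5(5) r4 by (simp_all add: settle_regs_def)
  have b5: "?B s5" using exec_bound[OF s5(2)] by simp
  from settle_exec[OF s5(3) r5(2) uv(2) _ r5(3,4) b5 W(2)]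
  obtain k6 s6 D5 m5 X2 c2 where s6: "k6 \<le> 100 + 102 * c2"
    "exec ?B (closed_nbhd E' (insert v X2)) (settle_com 2) s5 k6 s6"
    "heap n E' D5 m5 \<rho>' (owner s6) (cell s6)" "owner s6 = owner s5"
    "\<forall>x. x \<notin> settle_regs \<longrightarrow> reg s6 x = reg s5 x" "settle_rel E' v D4 m4 D5 m5 X2 c2" by auto
  note sb = settle_both[OF E'p D3 s4(6,7) uv(1,2) s5(6) s6(6)]
  let ?I = "{u, v} \<union> X1 \<union> X2"
  let ?L = "closed_nbhd E' ?I"
  \<comment> \<open>The first flushes run in the old graph, while locality refers to the new one.
    The two differ only in the edge between the endpoints, which both belong to
    \<open>?I\<close>.\<close>
  have nbE: "closed_nbhd E {x} \<subseteq> ?L" if "x \<in> {u, v}" for x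
  proof -
    have "y \<in> ?L" if "{x, y} \<in> E" for y
    proof (cases "{x, y} \<in> E'")
      case True
      then show ?thesis using \<open>x \<in> {u, v}\<close> by (intro closed_nbhdI(2)[of x]) auto
    next
      case False
      then have "{x, y} = {u, v}" using that cs unfolding E'_def by auto
      then have "y \<in> {u, v}" by auto
      then show ?thesis by (intro closed_nbhdI(1)) auto
    qed
    moreover have "x \<in> ?L" using that by (intro closed_nbhdI(1)) auto
    ultimately show ?thesis unfolding closed_nbhd_def[of E] by auto
  qed
  have L0: "{u, v} \<subseteq> ?L" by (auto intro: closed_nbhdI(1))
  have L5: "closed_nbhd E' (insert u X1) \<subseteq> ?L" "closed_nbhd E' (insert v X2) \<subseteq> ?L"
    by (rule closed_nbhd_mono, fastforce)+
  let ?k = "k1 + 1 + (k2 + 1 + (k3 + 1 + (k4 + 1 + (k5 + 1 + k6))))"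
  have uin: "u \<in> {u, v}" and vin: "v \<in> {u, v}" by auto
  have ex: "exec ?B ?L matching_com ?s0 ?k s6"
    unfolding matching_com_def
    by (rule exec_Seq[OF exec_mono[OF k1(2)] exec_Seq[OF exec_mono[OF s2(2) nbE[OF uin]]
          exec_Seq[OF exec_mono[OF s3(2) nbE[OF vin]] exec_Seq[OF exec_mono[OF s4(2) L0]
          exec_Seq[OF exec_mono[OF s5(2) L5(1)] exec_mono[OF s6(2) L5(2)]]]]]]) simp
  have I1: "?I \<subseteq> closed_nbhd E' (endpoints up)"
    unfolding ep using sb(4) by (auto simp: closed_nbhd_def)
  have I2: "\<forall>x\<in>?I. x \<in> endpoints up \<or> x < n \<and> m x = 0 \<and> m5 x \<noteq> 0"
  proof
    fix x assume x: "x \<in> ?I"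
    show "x \<in> endpoints up \<or> x < n \<and> m x = 0 \<and> m5 x \<noteq> 0"
    proof (cases "x \<in> {u, v}")
      case False
      then have "x \<in> X1 \<union> X2" using x by auto
      from sb(4)[OF this] have "m3 x = 0" "m5 x \<noteq> 0" "{u, x} \<in> E' \<or> {v, x} \<in> E'" by auto
      moreover from this(3) have "x < n" using proper_graphD(2)[OF E'p] by blast
      moreover have "m3 x = m x" using s4(8) False by blast
      ultimately show ?thesis by simp
    qed (simp add: ep)
  qed
  have I3: "\<forall>x<n. m x \<noteq> m5 x \<longrightarrow> x \<in> ?I"
  proof (intro allI impI)
    fix x assume "m x \<noteq> m5 x"
    show "x \<in> ?I"
    proof (cases "x \<in> {u, v}")
      case False
      then have "m5 x \<noteq> m3 x" using s4(8) \<open>m x \<noteq> m5 x\<close> by simp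
      then show ?thesis by (rule sb(5))
    qed auto
  qed
  have am: "amortised 1000 E E' D D5 ?k"
    unfolding amortised_def
  proof (intro allI impI)
    fix R R' d
    assume R: "orients E R" "orients E' R'" "\<forall>v. card (outs R v) \<le> d" "\<forall>v. card (outs R' v) \<le> d"
    have fin: "finite D" "finite ?D1" "finite ?D2" "finite R"
      using orients_finite(1)[OF E] D D1 D2 R(1) by blast+
    have "card (?D1 - R) + card (outs D u) \<le> card (D - R) + 2 * d"
      using flush_potential[OF fin(1) D R(1) fin(4)] R(3) by blast
    moreover have "card (?D2 - R) + card (outs ?D1 v) \<le> card (?D1 - R) + 2 * d"
      using flush_potential[OF fin(2) D1 R(1) fin(4)] R(3) by blast
    moreover have "card (D3 - R') \<le> card (?D2 - R) + card (R - R') + 1"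
      by (rule edge_change_potential[OF fin(3,4) s4(5)])
    moreover have "c1 + c2 + card (D5 - R') \<le> card (D3 - R') + 8 * d" by (rule sb(6)[OF R(2,4)])
    \<comment> \<open>Two flushes before the change and at most two in each settling make six times
      \<open>2 * d\<close>; the changed edge adds 1.\<close>
    ultimately have sum: "card (outs D u) + card (outs ?D1 v) + c1 + c2 + card (D5 - R')
        \<le> card (D - R) + card (R - R') + 1 + 12 * d" by linarith
    have "?k \<le> 400 + 102 * (card (outs D u) + card (outs ?D1 v) + c1 + c2)"
      using k1(1) s2(1) s3(1) s4(1) s5(1) s6(1) by simp
    then have "?k + 1000 * card (D5 - R')
        \<le> 400 + 1000 * (card (outs D u) + card (outs ?D1 v) + c1 + c2 + card (D5 - R'))" by simp
    also have "\<dots> \<le> 400 + 1000 * (card (D - R) + card (R - R') + 1 + 12 * d)"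
      using sum by (intro add_left_mono mult_left_mono) simp_all
    also have "\<dots> \<le> 1000 * (card (D - R) + card (R - R') + 16 * (d + 1))" by simp
    finally show "?k + 1000 * card (D5 - R') \<le> 1000 * (card (D - R) + card (R - R') + 16 * (d + 1))" .
  qed
  have "endpoints up \<subseteq> ?I" unfolding ep by auto
  then show ?thesis using ex s6(3) sb(2,3) I1 I2 I3 am
    by (intro exI[of _ ?k] exI[of _ s6] exI[of _ D5] exI[of _ m5] exI[of _ \<rho>'] exI[of _ ?I] conjI)
qed

section \<open>The run over a whole sequence\<close>

lemma heap_initial: "heap n {} {} (\<lambda>_. 0) (\<lambda>_ _. 0) (owner (initial_state n)) (cell (initial_state n))"
  unfolding heap_def proper_graph_def orients_def layout_def twins_def olist_def flist_def outs_def frees_def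
    initial_state_def
  by (auto split: if_splits)

lemma outputs_heap:
  assumes "heap n E D m \<rho> own (cell s)" "mutual n E m" "saturated E {} m"
  shows "outputs_maximal_matching n E (mate_of s)"
proof -
  have "proper_graph n E" and c: "\<forall>v<n. cell s v 0 = m v" using assms(1) unfolding heap_def by blast+
  from outputs_maximal_matching_mutual[OF this(1) assms(2,3)]
  show ?thesis unfolding outputs_maximal_matching_def mate_of_def using c by auto
qed

lemma state_after_Suc:
  "i < length us \<Longrightarrow> state_after P n (take (Suc i) us) = process P (state_after P n (take i us)) (us ! i)"
  by (simp add: state_after_def take_Suc_conv_app_nth)

lemma space_bound: "1 \<le> n \<Longrightarrow> c \<le> n * n \<Longrightarrow> n + 2 * c + 2 \<le> ((n::nat) + 1) ^ 4"
proof -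
  assume n: "1 \<le> n" "c \<le> n * n"
  have "(n + 1) ^ 4 = n ^ 4 + 4 * n ^ 3 + 6 * (n * n) + 4 * n + 1"
    by (simp add: power4_eq_xxxx power3_eq_cube algebra_simps)
  then show ?thesis using n by linarith
qed

text \<open>Orientation, mates and record addresses are ghost data. Each update only yields their
  existence, so dependent choice strings them together along the run.\<close>

lemma sequential_run:
  assumes ap: "arboricity_preserving n \<alpha> us"
  defines "s \<equiv> (\<lambda>i. state_after matching_com n (take i us))" and "G \<equiv> graph_at us" and "W \<equiv> (n + 1) ^ 4"
  shows "\<exists>D. \<forall>i. (i \<le> length us \<longrightarrow> orients (G i) (D i) \<and> outputs_maximal_matching n (G i) (mate_of (s i))) \<and>
    (i < length us \<longrightarrow> (\<exists>k I. exec (bounded W (n + 2 * card (G (Suc i)) + 2)) (closed_nbhd (G (Suc i)) I) matching_com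
        (s i\<lparr>reg := input (us ! i)\<rparr>) k (s (Suc i)) \<and>
      involved n (us ! i) (s i) (s (Suc i)) = I \<and> I \<subseteq> closed_nbhd (G (Suc i)) (endpoints (us ! i)) \<and>
      amortised 1000 (G i) (G (Suc i)) (D i) (D (Suc i)) k))"
proof -
  let ?T = "length us"
  \<comment> \<open>The premise on \<open>i\<close> makes the invariant vacuous beyond the end of
    the sequence, so that the choice can go on for ever.\<close>
  define inv where "inv i x \<longleftrightarrow> (case x of (D, m, \<rho>) \<Rightarrow> i \<le> ?T \<longrightarrow>
     heap n (G i) D m \<rho> (owner (s i)) (cell (s i)) \<and> mutual n (G i) m \<and> saturated (G i) {} m \<and>
     (\<forall>p f. cell (s i) p f \<le> W))" for i and x :: "(nat \<times> nat) set \<times> (nat \<Rightarrow> nat) \<times> (nat \<Rightarrow> nat \<Rightarrow> nat)"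
  define nxt where "nxt i x y \<longleftrightarrow> (i < ?T \<longrightarrow> (\<exists>k I. exec (bounded W (n + 2 * card (G (Suc i)) + 2))
        (closed_nbhd (G (Suc i)) I) matching_com (s i\<lparr>reg := input (us ! i)\<rparr>) k (s (Suc i)) \<and>
      involved n (us ! i) (s i) (s (Suc i)) = I \<and> I \<subseteq> closed_nbhd (G (Suc i)) (endpoints (us ! i)) \<and>
      amortised 1000 (G i) (G (Suc i)) (fst x) (fst y) k))"
    for i and x y :: "(nat \<times> nat) set \<times> (nat \<Rightarrow> nat) \<times> (nat \<Rightarrow> nat \<Rightarrow> nat)"
  have "\<exists>f. \<forall>i. inv i (f i) \<and> nxt i (f i) (f (Suc i))"
  proof (rule dependent_nat_choice)
    have "s 0 = initial_state n" by (simp add: s_def state_after_def)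
    then have "inv 0 ({}, \<lambda>_. 0, \<lambda>_ _. 0)"
      using heap_initial[of n] unfolding inv_def G_def
      by (simp add: mutual_def saturated_def initial_state_def)
    then show "\<exists>x. inv 0 x" by blast
  next
    fix x i assume x: "inv i x"
    show "\<exists>y. inv (Suc i) y \<and> nxt i x y"
    proof (cases "i < ?T")
      case False
      then have "inv (Suc i) x \<and> nxt i x x" by (auto simp: inv_def nxt_def split: prod.splits)
      then show ?thesis by blast
    next
      case i: True
      obtain D m \<rho> where xD: "x = (D, m, \<rho>)" by (cases x) auto
      have h: "heap n (G i) D m \<rho> (owner (s i)) (cell (s i))" "mutual n (G i) m" "saturated (G i) {} m"
        "\<And>p f. cell (s i) p f \<le> W" using x i unfolding inv_def xD by auto
      have val: "valid_update n (G i) (us ! i)" using ap i by (simp add: arboricity_preserving_def G_def)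
      have GS: "apply_update (G i) (us ! i) = G (Suc i)" using graph_at_Suc[OF i] by (simp add: G_def)
      have E: "proper_graph n (G i)" using h(1) by (simp add: heap_def)
      have "endpoints (us ! i) \<subseteq> {..<n} \<and> endpoints (us ! i) \<noteq> {}"
      proof (cases "us ! i")
        case (Delete u v)
        then show ?thesis using val proper_graphD[OF E, of u v] by simp
      qed (use val in simp)
      then have ep: "endpoints (us ! i) \<subseteq> {..<n}" and n: "1 \<le> n" by auto
      have pG: "proper_graph n (G (Suc i))" using proper_graph_at[OF ap, of "Suc i"] i by (simp add: G_def)
      have sp: "n + 2 * card (G (Suc i)) + 2 \<le> W"
        unfolding W_def by (rule space_bound[OF n proper_graph_finite(2)[OF pG]])
      have W1: "1 \<le> W" "n \<le> W" using sp by linarith+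
      from process_exec[OF h(1-3) val h(4) W1 sp[folded GS]]
      obtain k s' D' m' \<rho>' I where r: "exec (bounded W (n + 2 * card (G (Suc i)) + 2)) (closed_nbhd (G (Suc i)) I)
            matching_com (s i\<lparr>reg := input (us ! i)\<rparr>) k s'"
        "heap n (G (Suc i)) D' m' \<rho>' (owner s') (cell s')" "mutual n (G (Suc i)) m'" "saturated (G (Suc i)) {} m'"
        "endpoints (us ! i) \<subseteq> I" "I \<subseteq> closed_nbhd (G (Suc i)) (endpoints (us ! i))"
        "\<forall>x\<in>I. x \<in> endpoints (us ! i) \<or> x < n \<and> m x = 0 \<and> m' x \<noteq> 0" "\<forall>x<n. m x \<noteq> m' x \<longrightarrow> x \<in> I"
        "amortised 1000 (G i) (G (Suc i)) D D' k"
        unfolding GS by - (elim exE conjE, rule that, assumption+)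
      have s': "s' = s (Suc i)"
        using exec_config(3)[OF r(1)] state_after_Suc[OF i, of matching_com n] by (simp add: s_def)
      have cW: "\<forall>p f. cell s' p f \<le> W" using exec_bound[OF r(1)] by (simp add: bounded_def)
      have mt: "mate_of (s i) x \<noteq> mate_of s' x \<longleftrightarrow> m x \<noteq> m' x" if "x < n" for x
      proof -
        have "cell (s i) x 0 = m x" "cell s' x 0 = m' x" using h(1) r(2) that by (auto simp: heap_def)
        then show ?thesis by (simp add: mate_of_def split: nat.splits)
      qed
      \<comment> \<open>A vertex of \<open>I\<close> that is no endpoint has turned from free to
        matched, so it is involved.\<close>
      have inI: "involved n (us ! i) (s i) s' = I"
      proof
        show "involved n (us ! i) (s i) s' \<subseteq> I" using r(5,8) mt unfolding involved_def by auto
        show "I \<subseteq> involved n (us ! i) (s i) s'" using r(7) mt unfolding involved_def by force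
      qed
      have "inv (Suc i) (D', m', \<rho>')" unfolding inv_def s'[symmetric] using r(2-4) cW by simp
      moreover have "nxt i x (D', m', \<rho>')"
        unfolding nxt_def s'[symmetric] xD fst_conv using r(1,6,9) inI by blast
      ultimately show ?thesis by blast
    qed
  qed
  then obtain f where f: "\<And>i. inv i (f i)" "\<And>i. nxt i (f i) (f (Suc i))" by blast
  have A: "orients (G i) (fst (f i)) \<and> outputs_maximal_matching n (G i) (mate_of (s i))" if "i \<le> ?T" for i
  proof -
    obtain D m \<rho> where xD: "f i = (D, m, \<rho>)" by (cases "f i") auto
    have "heap n (G i) D m \<rho> (owner (s i)) (cell (s i))" "mutual n (G i) m" "saturated (G i) {} m"
      using f(1)[of i] that unfolding inv_def xD by auto
    from outputs_heap[OF this] this(1) show ?thesis by (simp add: xD heap_def)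
  qed
  show ?thesis
    by (rule exI[of _ "\<lambda>i. fst (f i)"]) (use A f(2) in \<open>auto simp only: nxt_def\<close>)
qed

lemma sequential_part:
  "\<exists>(P :: com) (C :: nat). \<forall>(n :: nat) (\<alpha> :: nat) (us :: update list).
      arboricity_preserving n \<alpha> us \<longrightarrow>
        maintains_maximal_matching P n us \<and>
        local_algorithm P n us \<and>
        uses_words_up_to ((n + 1) ^ C) P n us \<and>
        real (total_time P n us)
          \<le> real C * (real \<alpha> + sqrt (real \<alpha> * log 2 (real n))) * real (length us) \<and>
        uses_linear_space C P n us"
\<comment> \<open>This is the factor \<open>200 * K\<close> of the amortisation with
  \<open>K = 1000\<close>; it also exceeds the exponent 4 of the word bound and the factor in the
  space bound.\<close>
proof (intro exI[of _ matching_com] exI[of _ "200 * 1000"] allI impI)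
  fix n \<alpha> us assume ap: "arboricity_preserving n \<alpha> us"
  let ?T = "length us" and ?G = "graph_at us" and ?s = "\<lambda>i. state_after matching_com n (take i us)"
  let ?C = "200 * 1000 :: nat" and ?W = "(n + 1) ^ 4"
  from sequential_run[OF ap] obtain D where
    A: "\<And>i. i \<le> ?T \<Longrightarrow> orients (?G i) (D i) \<and> outputs_maximal_matching n (?G i) (mate_of (?s i))" and
    X: "\<And>i. i < ?T \<Longrightarrow> \<exists>k I. exec (bounded ?W (n + 2 * card (?G (Suc i)) + 2)) (closed_nbhd (?G (Suc i)) I) matching_com
        (?s i\<lparr>reg := input (us ! i)\<rparr>) k (?s (Suc i)) \<and>
      involved n (us ! i) (?s i) (?s (Suc i)) = I \<and> I \<subseteq> closed_nbhd (?G (Suc i)) (endpoints (us ! i)) \<and>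
      amortised 1000 (?G i) (?G (Suc i)) (D i) (D (Suc i)) k" by blast
  have Y: "terminates matching_com (us ! i) (?s i)"
    "local_update matching_com n (?G (Suc i)) (us ! i) (?s i)"
    "\<forall>j\<le>time matching_com (us ! i) (?s i). bounded ?W (n + 2 * card (?G (Suc i)) + 2) (snd (config matching_com (us ! i) (?s i) j))"
    "amortised 1000 (?G i) (?G (Suc i)) (D i) (D (Suc i)) (time matching_com (us ! i) (?s i))"
    if i: "i < ?T" for i
  proof -
    from X[OF i] obtain k I where e: "exec (bounded ?W (n + 2 * card (?G (Suc i)) + 2)) (closed_nbhd (?G (Suc i)) I) matching_com
        (?s i\<lparr>reg := input (us ! i)\<rparr>) k (?s (Suc i))"
      and I: "involved n (us ! i) (?s i) (?s (Suc i)) = I" "I \<subseteq> closed_nbhd (?G (Suc i)) (endpoints (us ! i))"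
      and am: "amortised 1000 (?G i) (?G (Suc i)) (D i) (D (Suc i)) k" by blast
    note ec = exec_config[OF e]
    show "terminates matching_com (us ! i) (?s i)" by (rule ec(1))
    show "local_update matching_com n (?G (Suc i)) (us ! i) (?s i)"
      unfolding local_update_def ec(2,3) I(1) Let_def using I(2) ec(4) by blast
    show "\<forall>j\<le>time matching_com (us ! i) (?s i). bounded ?W (n + 2 * card (?G (Suc i)) + 2) (snd (config matching_com (us ! i) (?s i) j))"
      unfolding ec(2) by (rule ec(5))
    show "amortised 1000 (?G i) (?G (Suc i)) (D i) (D (Suc i)) (time matching_com (us ! i) (?s i))"
      unfolding ec(2) by (rule am)
  qed
  have WC: "?W \<le> (n + 1) ^ ?C" by (rule power_increasing) simp_all
  have 1: "maintains_maximal_matching matching_com n us"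
    unfolding maintains_maximal_matching_def using Y(1) A by blast
  have 2: "local_algorithm matching_com n us" unfolding local_algorithm_def using Y(2) by blast
  have 3: "uses_words_up_to ((n + 1) ^ ?C) matching_com n us"
    unfolding uses_words_up_to_def Let_def
  proof (intro allI impI)
    fix i j assume "i < ?T" "j \<le> time matching_com (us ! i) (?s i)"
    then have b: "bounded ?W (n + 2 * card (?G (Suc i)) + 2) (snd (config matching_com (us ! i) (?s i) j))"
      using Y(3) by blast
    show "(\<forall>x. reg (snd (config matching_com (us ! i) (?s i) j)) x \<le> (n + 1) ^ ?C) \<and>
      (\<forall>p f. cell (snd (config matching_com (us ! i) (?s i) j)) p f \<le> (n + 1) ^ ?C)"
      using b WC unfolding bounded_def by (meson order_trans)
  qed
  have 4: "real (total_time matching_com n us)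
      \<le> real ?C * (real \<alpha> + sqrt (real \<alpha> * log 2 (real n))) * real ?T"
    unfolding total_time_def by (rule amortised_total[OF ap _ Y(4)]) (use A in blast)
  have 5: "uses_linear_space ?C matching_com n us"
    unfolding uses_linear_space_def
  proof (intro allI impI)
    fix i j assume i: "i < ?T" and "j \<le> time matching_com (us ! i) (?s i)"
    then have "bounded ?W (n + 2 * card (?G (Suc i)) + 2) (snd (config matching_com (us ! i) (?s i) j))"
      using Y(3) by blast
    then have "card (dom (owner (snd (config matching_com (us ! i) (?s i) j)))) \<le> n + 2 * card (?G (Suc i)) + 2"
      unfolding bounded_def by blast
    \<comment> \<open>A valid update requires a vertex; with \<open>n\<close> positive the additive
      2 in the number of records is absorbed.\<close>
    moreover have "1 \<le> n"
    proof -
      have "valid_update n (?G i) (us ! i)" using ap i by (simp add: arboricity_preserving_def)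
      moreover have "proper_graph n (?G i)" using proper_graph_at[OF ap, of i] i by simp
      ultimately show ?thesis using proper_graphD(1)[of n "?G i"] by (cases "us ! i") fastforce+
    qed
    ultimately show "card (dom (owner (snd (config matching_com (us ! i) (?s i) j)))) \<le> ?C * (n + card (?G (Suc i)))"
      by simp
  qed
  show "maintains_maximal_matching matching_com n us \<and> local_algorithm matching_com n us \<and>
        uses_words_up_to ((n + 1) ^ ?C) matching_com n us \<and>
        real (total_time matching_com n us)
          \<le> real ?C * (real \<alpha> + sqrt (real \<alpha> * log 2 (real n))) * real (length us) \<and>
        uses_linear_space ?C matching_com n us"
    by (intro conjI 1 2 3 4 5)
qed

section \<open>The distributed algorithm\<close>

text \<open>Messages: \<open>0\<close> hands the edge over to the recipient, \<open>1\<close> answers that its sender is free,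
  \<open>2\<close> proposes a match. Entry \<open>w + 3\<close> of the memory of \<open>v\<close> is \<open>0\<close> if \<open>w\<close> is not a
  neighbour, \<open>1\<close> if the edge is directed from \<open>v\<close> to \<open>w\<close>, and otherwise \<open>3\<close> or \<open>2\<close> according
  to whether \<open>w\<close> is known to be free. Entry \<open>2\<close> is a timer: a vertex flushes when it shows \<open>3\<close>
  and looks for a mate when it shows \<open>1\<close>. The endpoint with the larger identifier starts after
  the other one has finished.\<close>

definition pack :: "nat \<Rightarrow> nat \<Rightarrow> nat \<Rightarrow> (nat \<Rightarrow> nat) \<Rightarrow> local_memory" where
  "pack i m t c = (\<lambda>k. if k = 0 then i else if k = 1 then m else if k = 2 then t else c (k - 3))"

lemma pack_simps [simp]: "pack i m t c 0 = i" "pack i m t c (Suc 0) = m" "pack i m t c 2 = t"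
  "pack i m t c (w + 3) = c w" "pack i m t c (Suc (Suc (Suc w))) = c w"
  by (simp_all add: pack_def)

text \<open>A proposal is accepted without a check, since it goes only to a vertex known to be free.
  \<open>LEAST\<close> merely picks the sender; in the runs considered there is one proposal at a
  time.\<close>

definition recv_mate :: "nat \<Rightarrow> (nat \<Rightarrow> nat option) \<Rightarrow> nat" where
  "recv_mate m i = (if \<exists>w. i w = Some 2 then Suc (LEAST w. i w = Some 2) else m)"

definition recv_code :: "(nat \<Rightarrow> nat) \<Rightarrow> (nat \<Rightarrow> nat option) \<Rightarrow> nat \<Rightarrow> nat" where
  "recv_code c i w = (if i w = Some 0 then 1 else if i w = Some 1 then 3 else c w)"

definition flushing :: "nat \<Rightarrow> (nat \<Rightarrow> nat option) \<Rightarrow> bool" where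
  "flushing t i \<longleftrightarrow> t = 3 \<or> (\<exists>w. i w = Some 2)"

definition picking :: "nat \<Rightarrow> nat \<Rightarrow> (nat \<Rightarrow> nat) \<Rightarrow> (nat \<Rightarrow> nat option) \<Rightarrow> bool" where
  "picking m t c i \<longleftrightarrow> t = 1 \<and> recv_mate m i = 0 \<and> (\<exists>w. recv_code c i w = 3)"

definition pick :: "(nat \<Rightarrow> nat) \<Rightarrow> (nat \<Rightarrow> nat option) \<Rightarrow> nat" where
  "pick c i = (LEAST w. recv_code c i w = 3)"

definition round_mate :: "nat \<Rightarrow> nat \<Rightarrow> (nat \<Rightarrow> nat) \<Rightarrow> (nat \<Rightarrow> nat option) \<Rightarrow> nat" where
  "round_mate m t c i = (if picking m t c i then Suc (pick c i) else recv_mate m i)"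

text \<open>A reversed edge is provisionally entered as coming from a matched neighbour. Only a free
  neighbour answers and raises the entry to 3, so silence carries information.\<close>

definition round_code :: "nat \<Rightarrow> (nat \<Rightarrow> nat) \<Rightarrow> (nat \<Rightarrow> nat option) \<Rightarrow> nat \<Rightarrow> nat" where
  "round_code t c i w = (if flushing t i \<and> recv_code c i w = 1 then 2 else recv_code c i w)"

definition round_out :: "nat \<Rightarrow> nat \<Rightarrow> (nat \<Rightarrow> nat) \<Rightarrow> (nat \<Rightarrow> nat option) \<Rightarrow> nat \<Rightarrow> nat option" where
  "round_out m t c i w = (if picking m t c i \<and> w = pick c i then Some 2
     else if flushing t i \<and> recv_code c i w = 1 then Some 0
     else if i w = Some 0 \<and> recv_mate m i = 0 then Some 1 else None)"

text \<open>The phase of one endpoint takes six rounds, and \<open>9 = 3 + 6\<close>.\<close>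

definition event_timer :: "nat \<Rightarrow> nat \<Rightarrow> nat" where
  "event_timer v w = (if v < w then 3 else 9)"

text \<open>A new edge is directed from the smaller to the larger identifier, so both ends agree
  without communication. The larger end enters 2 without knowing the status of the other; that entry
  disappears when the smaller end flushes first.\<close>

definition matching_algorithm :: distributed_algorithm where
  "matching_algorithm = \<lparr>
     start_memory = (\<lambda>v. pack v 0 0 (\<lambda>_. 0)),
     on_event = (\<lambda>e \<mu>. case e of
         Inserted w \<Rightarrow> pack (\<mu> 0) (\<mu> 1) (event_timer (\<mu> 0) w)
           ((\<lambda>x. \<mu> (x + 3))(w := (if \<mu> 0 < w then 1 else 2)))
       | Deleted w \<Rightarrow> pack (\<mu> 0) (if \<mu> 1 = Suc w then 0 else \<mu> 1) (event_timer (\<mu> 0) w)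
           ((\<lambda>x. \<mu> (x + 3))(w := 0))),
     on_round = (\<lambda>\<mu> i. let c = (\<lambda>w. \<mu> (w + 3)) in
        (pack (\<mu> 0) (round_mate (\<mu> 1) (\<mu> 2) c i) (\<mu> 2 - 1) (round_code (\<mu> 2) c i),
         round_out (\<mu> 1) (\<mu> 2) c i, 1 < \<mu> 2)),
     mate_output = (\<lambda>\<mu>. case \<mu> 1 of 0 \<Rightarrow> None | Suc w \<Rightarrow> Some w)\<rparr>"

section \<open>Global snapshots and message counts\<close>

type_synonym snapshot = "(nat \<Rightarrow> nat) \<times> (nat \<Rightarrow> nat) \<times> (nat \<Rightarrow> nat \<Rightarrow> nat) \<times> (nat \<Rightarrow> nat \<Rightarrow> nat option)"

definition net :: "snapshot \<Rightarrow> network" where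
  "net x = (case x of (m, t, c, I) \<Rightarrow>
     \<lparr>memory = (\<lambda>v. pack v (m v) (t v) (c v)), awake = {v. t v \<noteq> 0}, inbox = I\<rparr>)"

text \<open>The round function is applied to every vertex, although only active ones compute: at a
  vertex with timer 0 and no mail it changes nothing and sends nothing.\<close>

definition next_round :: "graph \<Rightarrow> snapshot \<Rightarrow> snapshot" where
  "next_round E x = (case x of (m, t, c, I) \<Rightarrow>
     (\<lambda>v. round_mate (m v) (t v) (c v) (I v), \<lambda>v. t v - 1, \<lambda>v. round_code (t v) (c v) (I v),
      \<lambda>w v. if {v, w} \<in> E then round_out (m v) (t v) (c v) (I v) w else None))"

lemma quiet_round:
  assumes "\<forall>w. i w = None"
  shows "round_mate m 0 c i = m" "round_code 0 c i = c" "round_out m 0 c i w = None"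
  using assms by (auto simp: round_mate_def picking_def recv_mate_def round_code_def flushing_def
      recv_code_def round_out_def fun_eq_iff)

lemma round_net: "round matching_algorithm E (net x) = net (next_round E x)"
proof -
  obtain m t c I where x: "x = (m, t, c, I)" by (cases x) auto
  have inact: "t v = 0 \<and> (\<forall>w. I v w = None)" if "v \<notin> active (net x)" for v
    using that by (auto simp: active_def net_def x)
  have mem: "(if v \<in> active (net x) then new_memory matching_algorithm (net x) v else memory (net x) v)
     = pack v (round_mate (m v) (t v) (c v) (I v)) (t v - 1) (round_code (t v) (c v) (I v))" for v
    using inact[of v] quiet_round[of "I v"]
    by (auto simp: new_memory_def matching_algorithm_def net_def x Let_def)
  have out: "(if v \<in> active (net x) \<and> {v, w} \<in> E then outbox matching_algorithm (net x) v w else None)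
     = (if {v, w} \<in> E then round_out (m v) (t v) (c v) (I v) w else None)" for v w
    using inact[of v] quiet_round(3)[of "I v"]
    by (auto simp: outbox_def matching_algorithm_def net_def x Let_def)
  have "stays_awake matching_algorithm (net x) v \<longleftrightarrow> 1 < t v" for v
    by (simp add: stays_awake_def matching_algorithm_def net_def x Let_def)
  moreover have "v \<in> active (net x)" if "1 < t v" for v
    using inact[of v] that by (cases "v \<in> active (net x)") simp_all
  ultimately have "{v \<in> active (net x). stays_awake matching_algorithm (net x) v} = {v. 1 < t v}" by blast
  also have "\<dots> = {v. t v - 1 \<noteq> 0}" by auto
  finally have aw: "{v \<in> active (net x). stays_awake matching_algorithm (net x) v} = {v. t v - 1 \<noteq> 0}" .
  show ?thesis unfolding round_def mem out aw by (simp add: net_def next_round_def x not_le)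
qed

text \<open>The mail waiting after a round is what that round has sent, so messages can be counted
  on snapshots.\<close>

definition pending :: "snapshot \<Rightarrow> (nat \<times> nat \<times> nat) set" where
  "pending x = {(v, w, k). snd (snd (snd x)) w v = Some k}"

lemma inbox_net: "inbox (net x) = snd (snd (snd x))"
  by (cases x) (simp add: net_def)

lemma sent_net: "sent matching_algorithm E (net x) = pending (next_round E x)"
proof -
  have "inbox (round matching_algorithm E (net x)) w v = snd (snd (snd (next_round E x))) w v" for v w
    by (simp only: round_net inbox_net)
  then have "snd (snd (snd (next_round E x))) w v
     = (if v \<in> active (net x) \<and> {v, w} \<in> E then outbox matching_algorithm (net x) v w else None)" for v w
    by (simp add: round_def)
  then show ?thesis unfolding sent_def pending_def by (auto split: if_splits)
qed

lemma network_at_net: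
  "wakeup matching_algorithm u L = net x \<Longrightarrow> network_at matching_algorithm E u L j = net ((next_round E ^^ j) x)"
  by (induction j) (simp_all add: network_at_def round_net)

definition reaches :: "graph \<Rightarrow> snapshot \<Rightarrow> nat \<Rightarrow> snapshot \<Rightarrow> nat \<Rightarrow> bool" where
  "reaches E x k y q \<longleftrightarrow> (next_round E ^^ k) x = y \<and> (\<Sum>j<k. card (pending ((next_round E ^^ Suc j) x))) \<le> q"

lemma reaches_trans:
  assumes "reaches E x k y q" "reaches E y k' z q'"
  shows "reaches E x (k + k') z (q + q')"
proof -
  let ?f = "\<lambda>x j. card (pending ((next_round E ^^ Suc j) x))"
  have s: "(next_round E ^^ (k + j)) x = (next_round E ^^ j) y" for j
    using assms(1) by (simp add: reaches_def funpow_add add.commute[of k])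
  have "(\<Sum>j<k + k'. ?f x j) = (\<Sum>j<k. ?f x j) + (\<Sum>j<k'. ?f y j)" for k'
    by (induction k') (simp_all only: add_0_right add_Suc_right sum.lessThan_Suc lessThan_0 sum.empty
        s[of "Suc _", unfolded add_Suc_right] add.assoc)
  then show ?thesis using assms s[of k'] unfolding reaches_def by auto
qed

lemma reaches_mono: "reaches E x k y q \<Longrightarrow> k = k' \<Longrightarrow> y = y' \<Longrightarrow> q \<le> q' \<Longrightarrow> reaches E x k' y' q'"
  by (simp add: reaches_def)

lemma reaches_step: "next_round E x = y \<Longrightarrow> card (pending y) \<le> q \<Longrightarrow> reaches E x 1 y q"
  by (simp add: reaches_def)

section \<open>The rounds of a phase\<close>

text \<open>Between two rounds of a phase the mail is of one of four kinds: none, edges handed over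
  by one vertex, answers to one vertex, or a single proposal.\<close>

definition no_mail :: "nat \<Rightarrow> nat \<Rightarrow> nat option" where "no_mail = (\<lambda>_ _. None)"
definition flip_mail :: "nat \<Rightarrow> nat set \<Rightarrow> nat \<Rightarrow> nat \<Rightarrow> nat option" where
  "flip_mail z W = (\<lambda>w v. if v = z \<and> w \<in> W then Some 0 else None)"
definition free_mail :: "nat \<Rightarrow> nat set \<Rightarrow> nat \<Rightarrow> nat \<Rightarrow> nat option" where
  "free_mail z V = (\<lambda>w v. if w = z \<and> v \<in> V then Some 1 else None)"
definition match_mail :: "nat \<Rightarrow> nat \<Rightarrow> nat \<Rightarrow> nat \<Rightarrow> nat option" where
  "match_mail x z = (\<lambda>w v. if w = x \<and> v = z then Some 2 else None)"

lemma card_pending: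
  "card (pending (m, t, c, no_mail)) = 0"
  "card (pending (m, t, c, flip_mail z W)) = card W"
  "card (pending (m, t, c, free_mail z W)) = card W"
  "card (pending (m, t, c, match_mail x z)) = 1"
proof -
  have "pending (m, t, c, no_mail) = {}" by (auto simp: pending_def no_mail_def)
  then show "card (pending (m, t, c, no_mail)) = 0" by simp
  have "pending (m, t, c, flip_mail z W) = (\<lambda>w. (z, w, 0)) ` W"
    by (auto simp: pending_def flip_mail_def split: if_splits)
  then show "card (pending (m, t, c, flip_mail z W)) = card W" by (simp add: card_image inj_on_def)
  have "pending (m, t, c, free_mail z W) = (\<lambda>w. (w, z, 1)) ` W"
    by (auto simp: pending_def free_mail_def split: if_splits)
  then show "card (pending (m, t, c, free_mail z W)) = card W" by (simp add: card_image inj_on_def)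
  have "pending (m, t, c, match_mail x z) = {(z, x, 2)}"
    by (auto simp: pending_def match_mail_def split: if_splits)
  then show "card (pending (m, t, c, match_mail x z)) = 1" by simp
qed

definition calm :: "(nat \<Rightarrow> nat) \<Rightarrow> bool" where
  "calm t \<longleftrightarrow> (\<forall>v. t v \<noteq> 1 \<and> t v \<noteq> 3)"

definition flush_code :: "(nat \<Rightarrow> nat) \<Rightarrow> nat \<Rightarrow> nat" where
  "flush_code c w = (if c w = 1 then 2 else c w)"

lemmas round_defs = next_round_def round_mate_def round_code_def round_out_def picking_def flushing_def
  recv_mate_def recv_code_def

lemma round_idle: "calm t \<Longrightarrow> next_round E (m, t, c, no_mail) = (m, \<lambda>v. t v - 1, c, no_mail)"
  by (auto simp: round_defs calm_def no_mail_def fun_eq_iff)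

lemma round_flush:
  assumes "t z = 3" "\<And>v. v \<noteq> z \<Longrightarrow> t v \<noteq> 1 \<and> t v \<noteq> 3" "\<And>w. c z w = 1 \<Longrightarrow> {z, w} \<in> E"
  shows "next_round E (m, t, c, no_mail)
    = (m, \<lambda>v. t v - 1, c(z := flush_code (c z)), flip_mail z {w. c z w = 1})"
proof -
  have "t v = 3 \<longleftrightarrow> v = z" "t v \<noteq> 1" for v using assms(1) assms(2)[of v] by (cases "v = z"; simp)+
  then show ?thesis using assms(3)
    by (auto simp: round_defs no_mail_def flip_mail_def flush_code_def fun_eq_iff)
qed

lemma round_reply:
  assumes "calm t" "\<And>w. w \<in> W \<Longrightarrow> {w, z} \<in> E"
  shows "next_round E (m, t, c, flip_mail z W)
    = (m, \<lambda>v. t v - 1, \<lambda>v w. if w = z \<and> v \<in> W then 1 else c v w, free_mail z {w\<in>W. m w = 0})"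
  using assms by (auto simp: round_defs calm_def flip_mail_def free_mail_def fun_eq_iff)

lemma round_collect:
  assumes "calm t"
  shows "next_round E (m, t, c, free_mail z V)
    = (m, \<lambda>v. t v - 1, c(z := (\<lambda>w. if w \<in> V then 3 else c z w)), no_mail)"
  using assms by (auto simp: round_defs calm_def free_mail_def no_mail_def fun_eq_iff)

text \<open>The answers arrive in the very round in which the timer shows 1, so the choice is based
  on the entries \<open>c1\<close> after reading them.\<close>

lemma round_pick:
  assumes "t z = 1" "\<forall>v. v \<noteq> z \<longrightarrow> t v \<noteq> 1 \<and> t v \<noteq> 3"
    and c1: "c1 = c(z := (\<lambda>w. if w \<in> V then 3 else c z w))"
  shows "m z \<noteq> 0 \<or> (\<forall>w. c1 z w \<noteq> 3) \<Longrightarrow>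
      next_round E (m, t, c, free_mail z V) = (m, \<lambda>v. t v - 1, c1, no_mail)"
    "m z = 0 \<Longrightarrow> x = (LEAST w. c1 z w = 3) \<Longrightarrow> c1 z x = 3 \<Longrightarrow> {z, x} \<in> E \<Longrightarrow>
      next_round E (m, t, c, free_mail z V) = (m(z := Suc x), \<lambda>v. t v - 1, c1, match_mail x z)"
proof -
  have t: "t v = 1 \<longleftrightarrow> v = z" "t v \<noteq> 3" for v using assms(1) assms(2)[rule_format, of v] by (cases "v = z"; simp)+
  have rm: "recv_mate k (free_mail z V v) = k" for k v by (auto simp: recv_mate_def free_mail_def)
  have rc: "recv_code (c v) (free_mail z V v) = c1 v" for v
    by (auto simp: recv_code_def free_mail_def c1 fun_eq_iff)
  have fl: "\<not> flushing (t v) (free_mail z V v)" for v using t by (auto simp: flushing_def free_mail_def)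
  have pk: "picking (m v) (t v) (c v) (free_mail z V v) \<longleftrightarrow> v = z \<and> m z = 0 \<and> (\<exists>w. c1 z w = 3)" for v
    unfolding picking_def rm rc using t(1) by auto
  have no: "free_mail z V v w \<noteq> Some 0" for v w by (simp add: free_mail_def)
  show "next_round E (m, t, c, free_mail z V) = (m, \<lambda>v. t v - 1, c1, no_mail)"
    if "m z \<noteq> 0 \<or> (\<forall>w. c1 z w \<noteq> 3)"
  proof -
    have "\<not> picking (m v) (t v) (c v) (free_mail z V v)" for v using that pk[of v] by metis
    then show ?thesis using fl no
      by (simp add: next_round_def round_mate_def round_code_def round_out_def rm rc no_mail_def fun_eq_iff)
  qed
  show "next_round E (m, t, c, free_mail z V) = (m(z := Suc x), \<lambda>v. t v - 1, c1, match_mail x z)"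
    if "m z = 0" "x = (LEAST w. c1 z w = 3)" "c1 z x = 3" "{z, x} \<in> E"
  proof -
    have pk': "picking (m v) (t v) (c v) (free_mail z V v) \<longleftrightarrow> v = z" for v
      using that(1,3) pk[of v] by metis
    have px: "pick (c z) (free_mail z V z) = x" unfolding pick_def rc that(2) ..
    show ?thesis using fl no that(4) px
      by (auto simp: next_round_def round_mate_def round_code_def round_out_def rm rc pk' match_mail_def fun_eq_iff)
  qed
qed

lemma round_match:
  assumes "calm t" "\<And>w. c x w = 1 \<Longrightarrow> {x, w} \<in> E"
  shows "next_round E (m, t, c, match_mail x z)
    = (m(x := Suc z), \<lambda>v. t v - 1, c(x := flush_code (c x)), flip_mail x {w. c x w = 1})"
proof -
  have rm: "recv_mate k (match_mail x z v) = (if v = x then Suc z else k)" for k v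
    by (auto simp: recv_mate_def match_mail_def Least_equality)
  have rc: "recv_code d (match_mail x z v) = d" for d v
    by (auto simp: recv_code_def match_mail_def fun_eq_iff)
  have fl: "flushing (t v) (match_mail x z v) \<longleftrightarrow> v = x" for v
    using assms(1) by (auto simp: flushing_def match_mail_def calm_def)
  have pk: "\<not> picking (m v) (t v) (c v) (match_mail x z v)" for v
    using assms(1) by (auto simp: picking_def calm_def)
  have no: "match_mail x z v w \<noteq> Some 0" for v w by (simp add: match_mail_def)
  show ?thesis using pk fl no assms(2)
    by (auto simp: next_round_def round_mate_def round_code_def round_out_def rm rc flush_code_def flip_mail_def fun_eq_iff)
qed

text \<open>Vertices in \<open>Z\<close> may have changed their status without having told it to their
  out-neighbours.\<close>

definition coded :: "(nat \<times> nat) set \<Rightarrow> (nat \<Rightarrow> nat) \<Rightarrow> nat set \<Rightarrow> (nat \<Rightarrow> nat \<Rightarrow> nat) \<Rightarrow> bool" where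
  "coded D m Z c \<longleftrightarrow> (\<forall>v w. ((v, w) \<in> D \<longrightarrow> c v w = 1) \<and>
     ((v, w) \<notin> D \<longrightarrow> (w, v) \<notin> D \<longrightarrow> c v w = 0) \<and>
     ((w, v) \<in> D \<longrightarrow> c v w = 2 \<or> c v w = 3) \<and>
     ((w, v) \<in> D \<longrightarrow> w \<notin> Z \<longrightarrow> (c v w = 3 \<longleftrightarrow> m w = 0)))"

lemma codedD:
  assumes "coded D m Z c" "orients E D"
  shows "c v w = 1 \<longleftrightarrow> (v, w) \<in> D"
    "c v w = 3 \<Longrightarrow> (w, v) \<in> D"
    "(w, v) \<in> D \<Longrightarrow> w \<notin> Z \<Longrightarrow> c v w = 3 \<longleftrightarrow> m w = 0"
proof -
  have c: "(v, w) \<in> D \<Longrightarrow> c v w = 1" "(v, w) \<notin> D \<Longrightarrow> (w, v) \<notin> D \<Longrightarrow> c v w = 0"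
    "(w, v) \<in> D \<Longrightarrow> c v w = 2 \<or> c v w = 3" "(w, v) \<in> D \<Longrightarrow> w \<notin> Z \<Longrightarrow> c v w = 3 \<longleftrightarrow> m w = 0"
    using assms(1) unfolding coded_def by metis+
  show "c v w = 1 \<longleftrightarrow> (v, w) \<in> D" using c orients_asym[OF assms(2), of w v] by fastforce
  show "(w, v) \<in> D" if "c v w = 3" using c that by fastforce
  show "(w, v) \<in> D \<Longrightarrow> w \<notin> Z \<Longrightarrow> c v w = 3 \<longleftrightarrow> m w = 0" by (rule c(4))
qed

text \<open>The entries after a complete flush of \<open>z\<close>: edges handed over, answers given
  according to \<open>m\<close>, and answers collected.\<close>

definition flushed_code :: "(nat \<Rightarrow> nat \<Rightarrow> nat) \<Rightarrow> nat \<Rightarrow> (nat \<Rightarrow> nat) \<Rightarrow> nat \<Rightarrow> nat \<Rightarrow> nat" where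
  "flushed_code c z m v w = (if v = z then (if c z w = 1 then (if m w = 0 then 3 else 2) else c z w)
     else if w = z \<and> c z v = 1 then 1 else c v w)"

text \<open>Afterwards all edges at \<open>z\<close> point to \<open>z\<close>, so nobody keeps an
  entry on its status and \<open>z\<close> leaves \<open>Z\<close>. The answers tell
  \<open>z\<close> the status of its former out-neighbours. Mates may also change at vertices
  without out-edges, because no entry records their status before the flush.\<close>

lemma coded_flush:
  assumes c: "coded D m Z c" and D: "orients E D"
    and m': "\<And>w. w \<noteq> z \<Longrightarrow> m' w \<noteq> m w \<Longrightarrow> outs D w = {}"
  shows "coded (flush z D) m' (Z - {z}) (flushed_code c z m')"
  unfolding coded_def
proof (intro allI)
  fix v w
  note cD = codedD[OF c D]
  have c0: "(v, w) \<notin> D \<Longrightarrow> (w, v) \<notin> D \<Longrightarrow> c v w = 0" and c23: "(w, v) \<in> D \<Longrightarrow> c v w = 2 \<or> c v w = 3"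
    using c unfolding coded_def by metis+
  have zz: "(z, z) \<notin> D" by (rule orients_irrefl[OF D])
  have as: "(v, w) \<in> D \<Longrightarrow> (w, v) \<notin> D" by (rule orients_asym[OF D])
  have out: "(w, v) \<in> D \<Longrightarrow> w \<noteq> z \<Longrightarrow> m' w = m w" using m'[of w] by (auto simp: outs_def)
  note f = mem_flush[OF D]
  consider "v = z" "w = z" | "v = z" "w \<noteq> z" | "v \<noteq> z" "w = z" | "v \<noteq> z" "w \<noteq> z" by blast
  then show "((v, w) \<in> flush z D \<longrightarrow> flushed_code c z m' v w = 1) \<and>
     ((v, w) \<notin> flush z D \<longrightarrow> (w, v) \<notin> flush z D \<longrightarrow> flushed_code c z m' v w = 0) \<and>
     ((w, v) \<in> flush z D \<longrightarrow> flushed_code c z m' v w = 2 \<or> flushed_code c z m' v w = 3) \<and>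
     ((w, v) \<in> flush z D \<longrightarrow> w \<notin> Z - {z} \<longrightarrow> (flushed_code c z m' v w = 3 \<longleftrightarrow> m' w = 0))"
  proof cases
    case 1
    then show ?thesis using zz c0 cD(1)[of z z] by (simp add: f flushed_code_def)
  next
    case 2
    then show ?thesis
      using c0 c23 as cD(1)[of z w] cD(3)[of w z] out
      by (cases "(z, w) \<in> D"; cases "(w, z) \<in> D") (auto simp: f flushed_code_def)
  next
    case 3
    then show ?thesis
      using c0 c23 as cD(1)[of v z] cD(1)[of z v]
      by (cases "(v, z) \<in> D"; cases "(z, v) \<in> D") (auto simp: f flushed_code_def)
  next
    case 4
    then show ?thesis
      using c0 c23 as cD(1)[of v w] cD(3)[of w v] out
      by (cases "(v, w) \<in> D"; cases "(w, v) \<in> D") (auto simp: f flushed_code_def)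
  qed
qed

lemma flushed_code_rounds:
  assumes "c z z \<noteq> 1" "W = {w. c z w = 1}"
    and "c2 = (\<lambda>v w. if w = z \<and> v \<in> W then 1 else (c(z := flush_code (c z))) v w)"
  shows "flushed_code c z m = c2(z := (\<lambda>w. if w \<in> {w\<in>W. m w = 0} then 3 else c2 z w))"
  using assms(1) unfolding assms(2,3) by (auto simp: flushed_code_def flush_code_def fun_eq_iff)

text \<open>With a partner the rounds are: flush, answers, choice, acceptance with the flush of the
  partner, answers, collection. A reversed edge costs at most two messages, the proposal one more.
  The assumption on \<open>Z\<close> ensures that no neighbour of \<open>z\<close> has a stale
  status.\<close>

lemma phase:
  assumes E: "proper_graph n E" and D: "orients E D" and c: "coded D m Z c"
    and t: "t z = 3" "\<And>v. v \<noteq> z \<Longrightarrow> t v = 0 \<or> 9 \<le> t v"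
    and Z: "\<And>w. w \<in> Z \<Longrightarrow> w \<noteq> z \<Longrightarrow> {w, z} \<notin> E"
  shows "\<exists>D' m' X k c'. reaches E (m, t, c, no_mail) 6 (m', \<lambda>v. t v - 6, c', no_mail) (2 * k + 1) \<and>
    settle_rel E z D m D' m' X k \<and> coded D' m' (Z - {z}) c'"
proof -
  let ?t = "\<lambda>k v. t v - k"
  \<comment> \<open>The timer of the other endpoint is at least 9 and thus stays above 3 in all
    rounds of the phase.\<close>
  have nz: "?t k v \<noteq> 1 \<and> ?t k v \<noteq> 3" if "v \<noteq> z" "k \<le> 5" for v k using t(2)[OF that(1)] that(2) by auto
  have calm: "calm (?t k)" if k: "k = 1 \<or> 3 \<le> k \<and> k \<le> 5" for k
    unfolding calm_def
  proof
    fix v show "?t k v \<noteq> 1 \<and> ?t k v \<noteq> 3"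
      using nz[of v k] t(1) k by (cases "v = z") auto
  qed
  have tS: "(\<lambda>v. ?t k v - 1) = ?t (Suc k)" for k by (simp add: fun_eq_iff)
  define W where "W = {w. c z w = 1}"
  define F where "F = flushed_code c z m"
  define D1 where "D1 = flush z D"
  have W: "W = outs D z" unfolding W_def outs_def using codedD(1)[OF c D] by simp
  have D1: "orients E D1" unfolding D1_def by (rule orients_flush[OF D])
  have cF: "coded D1 m (Z - {z}) F" unfolding D1_def F_def by (rule coded_flush[OF c D]) simp
  have o1: "outs D1 z = {}" unfolding D1_def by (rule outs_flush[OF D])
  have sub: "outs D v \<subseteq> {..<n}" if "orients E D" for D v
    using orients_finite(2)[OF E that] by (auto simp: outs_def)
  have fin: "finite (outs D v)" if "orients E D" for D v by (rule finite_subset[OF sub[OF that]]) simp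
  define V where "V = {w\<in>W. m w = 0}"
  have cV: "card V \<le> card W" unfolding V_def W using fin[OF D] by (intro card_mono) auto
  define c2 where "c2 = (\<lambda>v w. if w = z \<and> v \<in> W then 1 else (c(z := flush_code (c z))) v w)"
  have irr: "c z z \<noteq> 1" using codedD(1)[OF c D] orients_irrefl[OF D] by simp
  have Fc: "F = c2(z := (\<lambda>w. if w \<in> V then 3 else c2 z w))"
    unfolding F_def V_def by (rule flushed_code_rounds[OF irr W_def c2_def])
  have "next_round E (m, ?t 0, c, no_mail) = (m, \<lambda>v. ?t 0 v - 1, c(z := flush_code (c z)), flip_mail z W)"
    unfolding W_def
  proof (rule round_flush)
    show "{z, w} \<in> E" if "c z w = 1" for w using that codedD(1)[OF c D] orients_edge[OF D] by simp
    show "?t 0 v \<noteq> 1 \<and> ?t 0 v \<noteq> 3" if "v \<noteq> z" for v by (rule nz[OF that]) simp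
  qed (use t(1) in simp)
  then have r0: "reaches E (m, t, c, no_mail) 1 (m, ?t 1, c(z := flush_code (c z)), flip_mail z W) (card W)"
    by (intro reaches_step) (simp_all add: card_pending)
  have "next_round E (m, ?t 1, c(z := flush_code (c z)), flip_mail z W)
      = (m, \<lambda>v. ?t 1 v - 1, c2, free_mail z V)"
    unfolding c2_def V_def
  proof (rule round_reply)
    show "calm (?t 1)" by (rule calm) simp
    show "{w, z} \<in> E" if "w \<in> W" for w
      using that orients_edge[OF D, of z w] unfolding W outs_def by (simp add: insert_commute)
  qed
  then have r1: "reaches E (m, ?t 1, c(z := flush_code (c z)), flip_mail z W) 1 (m, ?t 2, c2, free_mail z V) (card W)"
    using cV by (intro reaches_step) (simp_all add: card_pending numeral_eq_Suc)
  have r01: "reaches E (m, t, c, no_mail) 2 (m, ?t 2, c2, free_mail z V) (2 * card W)"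
    by (rule reaches_mono[OF reaches_trans[OF r0 r1]]) simp_all
  have t2: "?t 2 z = 1" "\<forall>v. v \<noteq> z \<longrightarrow> ?t 2 v \<noteq> 1 \<and> ?t 2 v \<noteq> 3" using t(1) nz[of _ 2] by auto
  note pick = round_pick[where m = m and E = E, OF t2 Fc]
  \<comment> \<open>After the flush every neighbour is an in-neighbour and none of them is in
    \<open>Z\<close>, so the entries show exactly which neighbours are free.\<close>
  have free: "F z w = 3 \<longleftrightarrow> m w = 0" if w: "{z, w} \<in> E" for w
  proof -
    have "(w, z) \<in> D1" using orients_cases[OF D1 w] o1 unfolding outs_def by blast
    moreover have "w \<notin> Z - {z}" using Z[of w] w by (auto simp: insert_commute)
    ultimately show ?thesis by (rule codedD(3)[OF cF D1])
  qed
  \<comment> \<open>Without a partner the phase is padded with idle rounds to the same length, so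
    that the other endpoint starts at the right timer value.\<close>
  have idle: "reaches E (m, ?t k, c, no_mail) 1 (m, ?t (Suc k), c, no_mail) 0" if "3 \<le> k" "k \<le> 5" for m c k
    using round_idle[OF calm[of k], of E m c] that unfolding tS by (intro reaches_step) (simp_all add: card_pending)
  show ?thesis
  proof (cases "m z \<noteq> 0 \<or> (\<forall>w. F z w \<noteq> 3)")
    case True
    have "next_round E (m, ?t 2, c2, free_mail z V) = (m, \<lambda>v. ?t 2 v - 1, F, no_mail)" by (rule pick(1)[OF True])
    then have r2: "reaches E (m, ?t 2, c2, free_mail z V) 1 (m, ?t 3, F, no_mail) 0"
      by (intro reaches_step) (simp_all add: card_pending numeral_eq_Suc)
    have i: "reaches E (m, ?t 3, F, no_mail) 1 (m, ?t 4, F, no_mail) 0"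
      "reaches E (m, ?t 4, F, no_mail) 1 (m, ?t 5, F, no_mail) 0"
      "reaches E (m, ?t 5, F, no_mail) 1 (m, ?t 6, F, no_mail) 0"
      using idle[of 3 m F] idle[of 4 m F] idle[of 5 m F] by simp_all
    have "reaches E (m, t, c, no_mail) 6 (m, ?t 6, F, no_mail) (2 * card (outs D z) + 1)"
      by (rule reaches_mono[OF reaches_trans[OF r01 reaches_trans[OF r2 reaches_trans[OF i(1) reaches_trans[OF i(2) i(3)]]]]])
        (simp_all add: W)
    moreover have "settle_rel E z D m D1 m {} (card (outs D z))"
      using True free unfolding settle_rel_def D1_def by blast
    ultimately show ?thesis using cF by blast
  next
    case False
    define x where "x = (LEAST w. F z w = 3)"
    define m2 where "m2 = m(z := Suc x, x := Suc z)"
    have mz: "m z = 0" and Fx: "F z x = 3" using False LeastI_ex[of "\<lambda>w. F z w = 3"] unfolding x_def by auto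
    have xz: "(x, z) \<in> D1" by (rule codedD(2)[OF cF D1 Fx])
    have e: "{z, x} \<in> E" using orients_edge[OF D1 xz] by (simp add: insert_commute)
    have ne: "x \<noteq> z" using xz orients_irrefl[OF D1] by blast
    have mx: "m x = 0" using free[OF e] Fx by simp
    define W2 where "W2 = {w. F x w = 1}"
    have W2: "W2 = outs D1 x" unfolding W2_def outs_def using codedD(1)[OF cF D1] by simp
    define V2 where "V2 = {w\<in>W2. m2 w = 0}"
    have cV2: "card V2 \<le> card W2" unfolding V2_def W2 using fin[OF D1] by (intro card_mono) auto
    define c4 where "c4 = (\<lambda>v w. if w = x \<and> v \<in> W2 then 1 else (F(x := flush_code (F x))) v w)"
    have irr2: "F x x \<noteq> 1" using codedD(1)[OF cF D1] orients_irrefl[OF D1] by simp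
    have Fc2: "flushed_code F x m2 = c4(x := (\<lambda>w. if w \<in> V2 then 3 else c4 x w))"
      unfolding V2_def by (rule flushed_code_rounds[OF irr2 W2_def c4_def])
    have "next_round E (m, ?t 2, c2, free_mail z V) = (m(z := Suc x), \<lambda>v. ?t 2 v - 1, F, match_mail x z)"
      by (rule pick(2)[OF mz x_def Fx e])
    then have r2: "reaches E (m, ?t 2, c2, free_mail z V) 1 (m(z := Suc x), ?t 3, F, match_mail x z) 1"
      by (intro reaches_step) (simp_all add: card_pending numeral_eq_Suc)
    have "next_round E (m(z := Suc x), ?t 3, F, match_mail x z)
        = ((m(z := Suc x))(x := Suc z), \<lambda>v. ?t 3 v - 1, F(x := flush_code (F x)), flip_mail x W2)"
      unfolding W2_def
    proof (rule round_match)
      show "{x, w} \<in> E" if "F x w = 1" for w using that codedD(1)[OF cF D1] orients_edge[OF D1] by simp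
    qed (rule calm, simp)
    then have r3: "reaches E (m(z := Suc x), ?t 3, F, match_mail x z) 1
        (m2, ?t 4, F(x := flush_code (F x)), flip_mail x W2) (card W2)"
      by (intro reaches_step) (simp_all add: card_pending m2_def numeral_eq_Suc)
    have "next_round E (m2, ?t 4, F(x := flush_code (F x)), flip_mail x W2)
        = (m2, \<lambda>v. ?t 4 v - 1, c4, free_mail x V2)"
      unfolding c4_def V2_def
    proof (rule round_reply)
      show "calm (?t 4)" by (rule calm) simp
      show "{w, x} \<in> E" if "w \<in> W2" for w
        using that orients_edge[OF D1, of x w] unfolding W2 outs_def by (simp add: insert_commute)
    qed
    then have r4: "reaches E (m2, ?t 4, F(x := flush_code (F x)), flip_mail x W2) 1
        (m2, ?t 5, c4, free_mail x V2) (card W2)"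
      using cV2 by (intro reaches_step) (simp_all add: card_pending numeral_eq_Suc)
    have "next_round E (m2, ?t 5, c4, free_mail x V2) = (m2, \<lambda>v. ?t 5 v - 1, flushed_code F x m2, no_mail)"
      unfolding Fc2 by (rule round_collect) (rule calm, simp)
    then have r5: "reaches E (m2, ?t 5, c4, free_mail x V2) 1 (m2, ?t 6, flushed_code F x m2, no_mail) 0"
      by (intro reaches_step) (simp_all add: card_pending numeral_eq_Suc)
    let ?k = "card (outs D z) + card (outs D1 x)"
    have run: "reaches E (m, t, c, no_mail) 6 (m2, ?t 6, flushed_code F x m2, no_mail) (2 * ?k + 1)"
      by (rule reaches_mono[OF reaches_trans[OF r01 reaches_trans[OF r2 reaches_trans[OF r3 reaches_trans[OF r4 r5]]]]])
        (simp_all add: W W2)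
    have st: "settle_rel E z D m (flush x D1) m2 {x} ?k"
      using e mz mx unfolding settle_rel_def D1_def m2_def by blast
    \<comment> \<open>Both \<open>z\<close> and \<open>x\<close> have changed their mates:
      \<open>x\<close> is the flushed vertex, and \<open>z\<close> has no out-edges in
      \<open>D1\<close>.\<close>
    have "coded (flush x D1) m2 (Z - {z} - {x}) (flushed_code F x m2)"
    proof (rule coded_flush[OF cF D1])
      show "outs D1 w = {}" if "w \<noteq> x" "m2 w \<noteq> m w" for w
        using that o1 unfolding m2_def by (cases "w = z") auto
    qed
    moreover have "Z - {z} - {x} = Z - {z}" using Z[of x] e ne by (auto simp: insert_commute)
    ultimately show ?thesis using run st by metis
  qed
qed

section \<open>Updates and the whole run of the network\<close>

text \<open>After an insertion \<open>Z\<close> contains only \<open>a\<close>, because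
  \<open>b\<close> enters the new edge without knowing the status of \<open>a\<close>. After a
  deletion both endpoints may have lost their mates silently, but then they are no longer adjacent,
  as the phase of \<open>a\<close> requires.\<close>

lemma wakeup_net:
  assumes m: "mutual n E m" and val: "valid_update n E up" and E: "proper_graph n E"
    and ep: "endpoints up = {a, b}" "a < b"
    and D: "orients E D" and c: "coded D m {} c" and s: "saturated E {} m"
  defines "E' \<equiv> apply_update E up" and "t \<equiv> (\<lambda>_. 0)(a := 3, b := 9)"
  shows "\<exists>m' c' D' Z p. wakeup matching_algorithm up (\<lambda>v. pack v (m v) 0 (c v)) = net (m', t, c', no_mail) \<and>
    orients E' D' \<and> coded D' m' Z c' \<and> mutual n E' m' \<and> saturated E' {a, b} m' \<and>
    D' \<subseteq> insert p D \<and> Z \<subseteq> {a, b} \<and> (b \<in> Z \<longrightarrow> {b, a} \<notin> E')"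
proof (cases up)
  case (Insert u v)
  have uv: "u < n" "v < n" "u \<noteq> v" "{u, v} \<notin> E" using val by (simp_all add: Insert)
  have ab: "{u, v} = {a, b}" using ep(1) by (simp add: Insert)
  then have ab': "{a, b} \<notin> E" "a \<noteq> b" using uv(4) ep(2) by auto
  have E': "E' = insert {a, b} E" by (simp add: E'_def Insert ab)
  have nD: "(a, b) \<notin> D" "(b, a) \<notin> D"
    using orients_edge[OF D, of a b] orients_edge[OF D, of b a] ab' by (metis insert_commute)+
  let ?c = "c(a := (c a)(b := 1), b := (c b)(a := 2))"
  have "u = a \<and> v = b \<or> u = b \<and> v = a" using ab by (auto simp: doubleton_eq_iff)
  then have "wakeup matching_algorithm up (\<lambda>v. pack v (m v) 0 (c v)) = net (m, t, ?c, no_mail)"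
    using ep(2) by (elim disjE conjE) (auto simp: Insert net_def matching_algorithm_def event_timer_def t_def no_mail_def
        fun_eq_iff)
  moreover have "orients E' (insert (a, b) D)" unfolding E' by (rule orients_insert[OF D ab'])
  moreover have "coded (insert (a, b) D) m {a} ?c"
    unfolding coded_def
  proof (intro allI)
    fix v w
    show "((v, w) \<in> insert (a, b) D \<longrightarrow> ?c v w = 1) \<and>
       ((v, w) \<notin> insert (a, b) D \<longrightarrow> (w, v) \<notin> insert (a, b) D \<longrightarrow> ?c v w = 0) \<and>
       ((w, v) \<in> insert (a, b) D \<longrightarrow> ?c v w = 2 \<or> ?c v w = 3) \<and>
       ((w, v) \<in> insert (a, b) D \<longrightarrow> w \<notin> {a} \<longrightarrow> (?c v w = 3 \<longleftrightarrow> m w = 0))"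
      using c[unfolded coded_def, THEN spec, THEN spec, of v w] nD ab'(2) by auto
  qed
  moreover have "mutual n E' m" unfolding E' by (rule mutual_insert[OF m])
  moreover have "saturated E' {a, b} m" unfolding E' by (rule saturated_insert[OF s])
  ultimately show ?thesis using ab'(2) by (intro exI[of _ m] exI[of _ ?c] exI[of _ "insert (a, b) D"] exI[of _ "{a}"]
      exI[of _ "(a, b)"] conjI) auto
next
  case (Delete u v)
  have uv: "{u, v} \<in> E" using val by (simp add: Delete)
  note un = proper_graphD[OF E uv]
  have ab: "{u, v} = {a, b}" using ep(1) by (simp add: Delete)
  have cs: "u = a \<and> v = b \<or> u = b \<and> v = a" using ab by (auto simp: doubleton_eq_iff)
  have E': "E' = E - {{a, b}}" by (simp add: E'_def Delete ab)
  have abn: "a < n" "b < n" "a \<noteq> b" using cs un by auto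
  let ?c = "c(a := (c a)(b := 0), b := (c b)(a := 0))"
  let ?m = "if m a = Suc b then m(a := 0, b := 0) else m"
  let ?D = "D - {(a, b), (b, a)}"
  \<comment> \<open>Each endpoint decides on its own whether the deleted edge was matched; since
    mates are mutual, both decide alike.\<close>
  have mm: "m a = Suc b \<longleftrightarrow> m b = Suc a" using m abn unfolding mutual_def by blast
  have "wakeup matching_algorithm up (\<lambda>v. pack v (m v) 0 (c v)) = net (?m, t, ?c, no_mail)"
    using cs ep(2) mm by (elim disjE conjE) (auto simp: Delete net_def matching_algorithm_def event_timer_def t_def no_mail_def
        fun_eq_iff)
  moreover have "orients E' ?D"
  proof -
    have "{a, b} \<in> E" using uv ab by simp
    then consider "(a, b) \<in> D" | "(b, a) \<in> D" using orients_cases[OF D] by blast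
    then show ?thesis
    proof cases
      case 1
      then have "?D = D - {(a, b)}" using orients_asym[OF D 1] by blast
      then show ?thesis unfolding E' using orients_delete[OF D 1] by simp
    next
      case 2
      then have "?D = D - {(b, a)}" using orients_asym[OF D 2] by blast
      then show ?thesis unfolding E' using orients_delete[OF D 2] by (simp add: insert_commute)
    qed
  qed
  moreover have "coded ?D ?m {a, b} ?c"
    unfolding coded_def
  proof (intro allI)
    fix v w
    show "((v, w) \<in> ?D \<longrightarrow> ?c v w = 1) \<and> ((v, w) \<notin> ?D \<longrightarrow> (w, v) \<notin> ?D \<longrightarrow> ?c v w = 0) \<and>
       ((w, v) \<in> ?D \<longrightarrow> ?c v w = 2 \<or> ?c v w = 3) \<and>
       ((w, v) \<in> ?D \<longrightarrow> w \<notin> {a, b} \<longrightarrow> (?c v w = 3 \<longleftrightarrow> ?m w = 0))"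
      using c[unfolded coded_def, THEN spec, THEN spec, of v w] abn(3) by auto
  qed
  moreover have "mutual n E' ?m" unfolding E' by (rule mutual_delete[OF m abn])
  moreover have "saturated E' {a, b} ?m" unfolding E' by (rule saturated_delete[OF s])
  ultimately show ?thesis by (intro exI[of _ ?m] exI[of _ ?c] exI[of _ ?D] exI[of _ "{a, b}"]
      exI[of _ "(a, b)"] conjI) (auto simp: E' insert_commute)
qed

lemma distributed_update:
  assumes E: "proper_graph n E" and m: "mutual n E m" and s: "saturated E {} m" and D: "orients E D"
    and c: "coded D m {} c" and val: "valid_update n E up"
  defines "E' \<equiv> apply_update E up"
  assumes E': "proper_graph n E'"
  shows "\<exists>D' m' c' x q. wakeup matching_algorithm up (\<lambda>v. pack v (m v) 0 (c v)) = net x \<and>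
    reaches E' x 12 (m', \<lambda>_. 0, c', no_mail) q \<and> orients E' D' \<and> coded D' m' {} c' \<and>
    mutual n E' m' \<and> saturated E' {} m' \<and> amortised 10 E E' D D' q"
proof -
  obtain u v where ep0: "endpoints up = {u, v}" by (cases up) auto
  have uv: "u < n \<and> v < n \<and> u \<noteq> v"
    using val proper_graphD[OF E, of u v] ep0 by (cases up) (auto simp: doubleton_eq_iff insert_commute)
  obtain a b where ab: "endpoints up = {a, b}" "a < b" "b < n"
  proof (cases "u < v")
    case True
    then show ?thesis using that[of u v] ep0 uv by blast
  next
    case False
    then have "v < u" using uv by linarith
    then show ?thesis using that[of v u] ep0 uv by (simp add: insert_commute)
  qed
  let ?t = "(\<lambda>_. 0)(a := 3, b := 9) :: nat \<Rightarrow> nat"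
  from wakeup_net[OF m val E ab(1,2) D c s, folded E'_def] obtain m1 c1 D1 Z p where
    w: "wakeup matching_algorithm up (\<lambda>v. pack v (m v) 0 (c v)) = net (m1, ?t, c1, no_mail)"
      "orients E' D1" "coded D1 m1 Z c1" "mutual n E' m1" "saturated E' {a, b} m1"
      "D1 \<subseteq> insert p D" "Z \<subseteq> {a, b}" "b \<in> Z \<longrightarrow> {b, a} \<notin> E'"
    by - (elim exE conjE, rule that, assumption+)
  have "\<exists>D' m' X k c'. reaches E' (m1, ?t, c1, no_mail) 6 (m', \<lambda>v. ?t v - 6, c', no_mail) (2 * k + 1) \<and>
    settle_rel E' a D1 m1 D' m' X k \<and> coded D' m' (Z - {a}) c'"
    by (rule phase[OF E' w(2,3)]) (use ab(2) w(7,8) in auto)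
  then obtain D2 m2 X1 k1 c2 where p1: "reaches E' (m1, ?t, c1, no_mail) 6 (m2, \<lambda>v. ?t v - 6, c2, no_mail) (2 * k1 + 1)"
      "settle_rel E' a D1 m1 D2 m2 X1 k1" "coded D2 m2 (Z - {a}) c2"
    by - (elim exE conjE, rule that, assumption+)
  have D2: "orients E' D2" by (rule settle_rel_orients[OF p1(2) w(2)])
  \<comment> \<open>After six rounds the timer is 0 at \<open>a\<close> and \<open>9 - 6 = 3\<close>
    at \<open>b\<close>, so the phase lemma applies to \<open>b\<close>.\<close>
  have "\<exists>D' m' X k c'. reaches E' (m2, \<lambda>v. ?t v - 6, c2, no_mail) 6 (m', \<lambda>v. (?t v - 6) - 6, c', no_mail) (2 * k + 1) \<and>
    settle_rel E' b D2 m2 D' m' X k \<and> coded D' m' (Z - {a} - {b}) c'"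
    by (rule phase[OF E' D2 p1(3)]) (use ab(2) w(7) in auto)
  then obtain D3 m3 X2 k2 c3 where p2: "reaches E' (m2, \<lambda>v. ?t v - 6, c2, no_mail) 6 (m3, \<lambda>v. (?t v - 6) - 6, c3, no_mail) (2 * k2 + 1)"
      "settle_rel E' b D2 m2 D3 m3 X2 k2" "coded D3 m3 (Z - {a} - {b}) c3"
    by - (elim exE conjE, rule that, assumption+)
  have Z: "Z - {a} - {b} = {}" using w(7) by blast
  have an: "a < n" using ab by linarith
  note sb = settle_both[OF E' w(2,4,5) an ab(3) p1(2) p2(2)]
  let ?q = "2 * k1 + 1 + (2 * k2 + 1)"
  have run: "reaches E' (m1, ?t, c1, no_mail) 12 (m3, \<lambda>_. 0, c3, no_mail) ?q"
    by (rule reaches_mono[OF reaches_trans[OF p1(1) p2(1)]]) (simp_all add: fun_eq_iff)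
  have am: "amortised 10 E E' D D3 ?q"
    unfolding amortised_def
  proof (intro allI impI)
    fix R R' d
    assume R: "orients E R" "orients E' R'" "\<forall>v. card (outs R v) \<le> d" "\<forall>v. card (outs R' v) \<le> d"
    have fin: "finite D" "finite R" using orients_finite(1)[OF E] D R(1) by blast+
    have "card (D1 - R') \<le> card (D - R) + card (R - R') + 1" by (rule edge_change_potential[OF fin w(6)])
    moreover have "k1 + k2 + card (D3 - R') \<le> card (D1 - R') + 8 * d" by (rule sb(6)[OF R(2,4)])
    ultimately show "?q + 10 * card (D3 - R') \<le> 10 * (card (D - R) + card (R - R') + 16 * (d + 1))" by simp
  qed
  show ?thesis using w(1) run sb(1-3) p2(3)[unfolded Z] am
    by (intro exI[of _ D3] exI[of _ m3] exI[of _ c3] exI[of _ "(m1, ?t, c1, no_mail)"] exI[of _ ?q] conjI)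
qed

text \<open>The network may fall silent before round \<open>k\<close>, because the last rounds may
  be idle. A silent snapshot does not change any more, so the memories at the first silent round are
  already the final ones.\<close>

lemma quiet_network:
  assumes w: "wakeup matching_algorithm up L = net x" and r: "reaches E x k (m, \<lambda>_. 0, c, no_mail) q"
  shows "active (network_at matching_algorithm E up L k) = {}"
    "rounds matching_algorithm E up L \<le> k"
    "memory (network_at matching_algorithm E up L (rounds matching_algorithm E up L)) = (\<lambda>v. pack v (m v) 0 (c v))"
    "messages matching_algorithm E up L \<le> q"
proof -
  let ?N = "network_at matching_algorithm E up L" and ?y = "(m, \<lambda>_. 0, c, no_mail)"
  let ?r = "rounds matching_algorithm E up L"
  note N = network_at_net[OF w]
  have y: "(next_round E ^^ k) x = ?y" using r by (simp add: reaches_def)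
  show a: "active (?N k) = {}" unfolding N y by (simp add: active_def net_def no_mail_def)
  show le: "?r \<le> k" unfolding rounds_def by (rule Least_le) (rule a)
  have ar: "active (?N ?r) = {}" unfolding rounds_def by (rule LeastI) (rule a)
  obtain m' t' c' I' where z: "(next_round E ^^ ?r) x = (m', t', c', I')" by (cases "(next_round E ^^ ?r) x") auto
  have t': "t' = (\<lambda>_. 0)" "I' = no_mail"
    using ar unfolding N z by (auto simp: active_def net_def no_mail_def fun_eq_iff)
  have idle: "next_round E (m', \<lambda>_. 0, c', no_mail) = (m', \<lambda>_. 0, c', no_mail)"
    using round_idle[of "\<lambda>_. 0" E m' c'] by (simp add: calm_def)
  have "(next_round E ^^ j) (m', \<lambda>_. 0, c', no_mail) = (m', \<lambda>_. 0, c', no_mail)" for j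
    by (induction j) (simp_all add: idle)
  moreover have "(next_round E ^^ k) x = (next_round E ^^ (k - ?r)) ((next_round E ^^ ?r) x)"
    using funpow_add[of "k - ?r" ?r "next_round E"] le by simp
  ultimately have "(m', \<lambda>_. 0, c', no_mail) = ?y" using y z t' by simp
  then show "memory (?N ?r) = (\<lambda>v. pack v (m v) 0 (c v))" unfolding N z by (simp add: net_def t')
  have "messages matching_algorithm E up L = (\<Sum>j<?r. card (pending ((next_round E ^^ Suc j) x)))"
    unfolding messages_def N by (simp add: sent_net)
  also have "\<dots> \<le> (\<Sum>j<k. card (pending ((next_round E ^^ Suc j) x)))"
    using le by (intro sum_mono2) auto
  finally show "messages matching_algorithm E up L \<le> q" using r unfolding reaches_def by simp
qed

lemma mate_output_pack:
  "mate_output matching_algorithm (pack v k t c) = (case k of 0 \<Rightarrow> None | Suc w \<Rightarrow> Some w)"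
  by (simp add: matching_algorithm_def)

lemma sent_bound: "(v, w, k) \<in> sent matching_algorithm E N \<Longrightarrow> k \<le> 2"
  by (auto simp: sent_def outbox_def matching_algorithm_def Let_def round_out_def split: if_splits)

definition dist_inv :: "nat \<Rightarrow> graph \<Rightarrow> (nat \<Rightarrow> local_memory) \<Rightarrow> (nat \<times> nat) set \<Rightarrow> bool" where
  "dist_inv n E L D \<longleftrightarrow> (\<exists>m c. L = (\<lambda>v. pack v (m v) 0 (c v)) \<and> mutual n E m \<and> saturated E {} m \<and>
     orients E D \<and> coded D m {} c)"

lemma distributed_part:
  "\<exists>(A :: distributed_algorithm) (C :: nat). \<forall>(n :: nat) (\<alpha> :: nat) (us :: update list).
      arboricity_preserving n \<alpha> us \<longrightarrow>
        dist_maintains_maximal_matching A n us \<and>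
        sends_messages_up_to ((n + 1) ^ C) A us \<and>
        real (total_messages A us)
          \<le> real C * (real \<alpha> + sqrt (real \<alpha> * log 2 (real n))) * real (length us) \<and>
        worst_case_rounds_le C A us"
\<comment> \<open>This is the factor \<open>200 * K\<close> with \<open>K = 10\<close>; it also
  covers the 12 rounds of an update.\<close>
proof (intro exI[of _ matching_algorithm] exI[of _ "200 * 10"] allI impI)
  fix n \<alpha> us assume ap: "arboricity_preserving n \<alpha> us"
  let ?T = "length us" and ?G = "graph_at us" and ?A = matching_algorithm
  let ?L = "memories ?A us"
  let ?C = "200 * 10 :: nat"
  define nxt where "nxt i D D' \<longleftrightarrow> (i < ?T \<longrightarrow> quiesces ?A (?G (Suc i)) (us ! i) (?L i) \<and>
      rounds ?A (?G (Suc i)) (us ! i) (?L i) \<le> 12 \<and>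
      amortised 10 (?G i) (?G (Suc i)) D D' (messages ?A (?G (Suc i)) (us ! i) (?L i)))" for i D D'
  have "\<exists>D. \<forall>i. (i \<le> ?T \<longrightarrow> dist_inv n (?G i) (?L i) (D i)) \<and> nxt i (D i) (D (Suc i))"
  proof (rule dependent_nat_choice)
    have "dist_inv n (?G 0) (?L 0) {}"
      unfolding dist_inv_def by (intro exI[of _ "\<lambda>_. 0"] exI[of _ "\<lambda>_ _. 0"])
        (simp add: matching_algorithm_def mutual_def saturated_def orients_def coded_def)
    then show "\<exists>D. 0 \<le> ?T \<longrightarrow> dist_inv n (?G 0) (?L 0) D" by blast
  next
    fix D i assume x: "i \<le> ?T \<longrightarrow> dist_inv n (?G i) (?L i) D"
    show "\<exists>D'. (Suc i \<le> ?T \<longrightarrow> dist_inv n (?G (Suc i)) (?L (Suc i)) D') \<and> nxt i D D'"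
    proof (cases "i < ?T")
      case False
      then show ?thesis by (simp add: nxt_def)
    next
      case i: True
      then have "dist_inv n (?G i) (?L i) D" using x by simp
      then obtain m c where L: "?L i = (\<lambda>v. pack v (m v) 0 (c v))" and
        h: "mutual n (?G i) m" "saturated (?G i) {} m" "orients (?G i) D" "coded D m {} c"
        unfolding dist_inv_def by - (elim exE conjE, rule that, assumption+)
      have val: "valid_update n (?G i) (us ! i)" using ap i by (simp add: arboricity_preserving_def)
      have pg: "proper_graph n (?G i)" "proper_graph n (?G (Suc i))"
        using proper_graph_at[OF ap, of i] proper_graph_at[OF ap, of "Suc i"] i by simp_all
      from distributed_update[OF pg(1) h val, folded graph_at_Suc[OF i], OF pg(2)]
      obtain D' m' c' y q where
        r: "wakeup ?A (us ! i) (\<lambda>v. pack v (m v) 0 (c v)) = net y" "reaches (?G (Suc i)) y 12 (m', \<lambda>_. 0, c', no_mail) q"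
          "orients (?G (Suc i)) D'" "coded D' m' {} c'" "mutual n (?G (Suc i)) m'"
          "saturated (?G (Suc i)) {} m'" "amortised 10 (?G i) (?G (Suc i)) D D' q"
        by - (elim exE conjE, rule that, assumption+)
      note qn = quiet_network[OF r(1)[folded L] r(2)]
      have "?L (Suc i) = (\<lambda>v. pack v (m' v) 0 (c' v))" using qn(3) by (simp add: Let_def)
      then have "dist_inv n (?G (Suc i)) (?L (Suc i)) D'" unfolding dist_inv_def using r(3-6) by blast
      moreover have "nxt i D D'"
        unfolding nxt_def quiesces_def
      proof (intro impI conjI)
        show "\<exists>j. active (network_at ?A (?G (Suc i)) (us ! i) (?L i) j) = {}" using qn(1) by blast
        show "rounds ?A (?G (Suc i)) (us ! i) (?L i) \<le> 12" by (rule qn(2))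
        show "amortised 10 (?G i) (?G (Suc i)) D D' (messages ?A (?G (Suc i)) (us ! i) (?L i))"
          using r(7) qn(4) unfolding amortised_def by (meson add_le_mono1 order_trans)
      qed
      ultimately show ?thesis by blast
    qed
  qed
  then obtain D where inv: "\<And>i. i \<le> ?T \<Longrightarrow> dist_inv n (?G i) (?L i) (D i)"
    and nx: "\<And>i. nxt i (D i) (D (Suc i))" by blast
  have out: "outputs_maximal_matching n (?G i) (\<lambda>v. mate_output ?A (?L i v))" if i: "i \<le> ?T" for i
  proof -
    obtain m c where L: "?L i = (\<lambda>v. pack v (m v) 0 (c v))" and h: "mutual n (?G i) m" "saturated (?G i) {} m"
      using inv[OF i] unfolding dist_inv_def by blast
    have "(\<lambda>v. mate_output ?A (?L i v)) = (\<lambda>v. case m v of 0 \<Rightarrow> None | Suc w \<Rightarrow> Some w)"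
      by (simp add: L mate_output_pack)
    then show ?thesis using outputs_maximal_matching_mutual[OF proper_graph_at[OF ap i] h] by simp
  qed
  have Y: "quiesces ?A (?G (Suc i)) (us ! i) (?L i)" "rounds ?A (?G (Suc i)) (us ! i) (?L i) \<le> 12"
    "amortised 10 (?G i) (?G (Suc i)) (D i) (D (Suc i)) (messages ?A (?G (Suc i)) (us ! i) (?L i))"
    if i: "i < ?T" for i using nx[of i] i unfolding nxt_def by blast+
  have 1: "dist_maintains_maximal_matching ?A n us"
    unfolding dist_maintains_maximal_matching_def using Y(1) out by blast
  have 2: "sends_messages_up_to ((n + 1) ^ ?C) ?A us"
    unfolding sends_messages_up_to_def Let_def
  proof (intro allI impI)
    fix i j assume i: "i < ?T"
    have "1 \<le> n"
    proof (cases "us ! i")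
      case (Insert u v)
      then have "u < n" using ap i unfolding arboricity_preserving_def by fastforce
      then show ?thesis by simp
    next
      case (Delete u v)
      then have "{u, v} \<in> ?G i" using ap i unfolding arboricity_preserving_def by fastforce
      then show ?thesis using proper_graphD(1)[OF proper_graph_at[OF ap, of i]] i by fastforce
    qed
    \<comment> \<open>The largest message is 2, so the polynomial bound has to reach 2 already for a
      single vertex.\<close>
    then have "2 \<le> n + 1" by simp
    also have "n + 1 \<le> (n + 1) ^ ?C" by (rule self_le_power) simp_all
    finally have "k \<le> (n + 1) ^ ?C" if "(v, w, k) \<in> sent ?A (?G (Suc i)) N" for v w k N
      using sent_bound[OF that] by (rule order_trans[rotated])
    then show "\<forall>(v, w, k)\<in>sent ?A (?G (Suc i)) (network_at ?A (?G (Suc i)) (us ! i) (?L i) j). k \<le> (n + 1) ^ ?C"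
      by blast
  qed
  have 3: "real (total_messages ?A us)
      \<le> real ?C * (real \<alpha> + sqrt (real \<alpha> * log 2 (real n))) * real ?T"
    unfolding total_messages_def
    by (rule amortised_total[OF ap _ Y(3)]) (use inv in \<open>auto simp: dist_inv_def\<close>)
  have 4: "worst_case_rounds_le ?C ?A us"
    unfolding worst_case_rounds_le_def using Y(2) by fastforce
  show "dist_maintains_maximal_matching ?A n us \<and> sends_messages_up_to ((n + 1) ^ ?C) ?A us \<and>
      real (total_messages ?A us) \<le> real ?C * (real \<alpha> + sqrt (real \<alpha> * log 2 (real n))) * real ?T \<and>
      worst_case_rounds_le ?C ?A us"
    using 1 2 3 4 by (intro conjI)
qed

theorem theorem6:
  "(\<exists>(P :: com) (C :: nat). \<forall>(n :: nat) (\<alpha> :: nat) (us :: update list).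
      arboricity_preserving n \<alpha> us \<longrightarrow>
        maintains_maximal_matching P n us \<and>
        local_algorithm P n us \<and>
        uses_words_up_to ((n + 1) ^ C) P n us \<and>
        real (total_time P n us)
          \<le> real C * (real \<alpha> + sqrt (real \<alpha> * log 2 (real n))) * real (length us) \<and>
        uses_linear_space C P n us) \<and>
   (\<exists>(A :: distributed_algorithm) (C :: nat). \<forall>(n :: nat) (\<alpha> :: nat) (us :: update list).
      arboricity_preserving n \<alpha> us \<longrightarrow>
        dist_maintains_maximal_matching A n us \<and>
        sends_messages_up_to ((n + 1) ^ C) A us \<and>
        real (total_messages A us)
          \<le> real C * (real \<alpha> + sqrt (real \<alpha> * log 2 (real n))) * real (length us) \<and>
        worst_case_rounds_le C A us)"
  by (rule conjI[OF sequential_part distributed_part])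

end
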